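(* Let $(\overline{M}^4=I\times F^3,\ \overline{g}=-\beta\,dt^2+g_t)$ be a non-contracting (resp. non-expanding) orthogonally splitted spacetime. Then for no future (resp. past) trapped, nearly future (resp. past) trapped, weakly future (resp. past) trapped or marginally future (resp. past) trapped surface $\Sigma$ in $\overline{M}$ does the function $\tau=\pi_{\mathbb{R}|\Sigma}$ achieve a strict local minimum (resp. maximum).
   Context: Orthogonally splitted spacetime: $\overline{M}=I\times F$ with $I\subset\mathbb{R}$ an open interval, $F$ a smooth manifold, and Lorentzian metric $\overline{g}=-\beta\,\pi_{\mathbb{R}}^*(dt^2)+\pi_F^*(g_t)$ (written $-\beta dt^2+g_t$), where $\pi_{\mathbb{R}},\pi_F$ are the projections, $\beta\in C^\infty(\overline{M})$ is positive and $\{g_t\}_{t\in I}$ is a smooth one-parameter family of Riemannian metrics on $F$. The time orientation is such that $\partial_t$ is future pointing. Non-contracting: $\partial_t\beta\leq 0$ and $(\mathcal{L}_{\partial_t}g_t)(v,v)\geq 0$ for all $t\in I$, $x\in F$, $v\in T_xF$ (with $\mathcal{L}$ the Lie derivative, i.e. the $t$-derivative of $g_t$). Non-expanding: $\partial_t\beta\geq 0$ and $(\mathcal{L}_{\partial_t}g_t)(v,v)\leq 0$ for all such $t,x,v$. Surfaces are connected immersed spacelike surfaces $\Sigma^2$ (induced metric Riemannian), not assumed complete. Mean curvature vector: $\overrightarrow{H}=\sum_{i=1}^2 II(E_i,E_i)$ with $\{E_i\}$ local orthonormal frame of $\Sigma$ and $II(X,Y)=-(\overline{\nabla}_XY)^\perp$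 (note the sign), $\overline{\nabla}$ being the Levi-Civita connection of $\overline{M}$. A vector $v$ is causal if $\overline{g}(v,v)\leq 0$; the zero vector is considered lightlike (hence causal), and orientation requirements apply where the vector is non-zero. $\Sigma$ is: future trapped if $\overrightarrow{H}$ is timelike and future pointing all over $\Sigma$; nearly future trapped if $\overrightarrow{H}$ is causal and future pointing all over $\Sigma$ and timelike at at least one point; weakly future trapped if $\overrightarrow{H}$ is causal, future pointing and non-zero at at least one point; marginally future trapped if $\overrightarrow{H}$ is lightlike, future pointing and non-zero at at least one point. The past notions are analogous with $\overrightarrow{H}$ past pointing. *)

theory Defs
  imports "HOL-Analysis.Analysis"
begin

section \<open>Smooth maps on open subsets of Euclidean spaces\<close>

primrec Ck_on :: "nat \<Rightarrow> 'a::euclidean_space set \<Rightarrow> ('a \<Rightarrow> 'b::euclidean_space) \<Rightarrow> bool" where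
  "Ck_on 0 S f \<longleftrightarrow> continuous_on S f"
| "Ck_on (Suc k) S f \<longleftrightarrow>
     (\<forall>x\<in>S. f differentiable (at x)) \<and> (\<forall>v. Ck_on k S (\<lambda>x. frechet_derivative f (at x) v))"

text \<open>Only used for open \<open>S\<close>.\<close>

definition smooth_on :: "'a::euclidean_space set \<Rightarrow> ('a \<Rightarrow> 'b::euclidean_space) \<Rightarrow> bool" where
  "smooth_on S f \<longleftrightarrow> (\<forall>k. Ck_on k S f)"


section \<open>Smooth manifolds\<close>

text \<open>A chart is a pair of its domain and a coordinate map. The coordinate map is a total function;
  its values outside the domain are irrelevant.\<close>

type_synonym ('m, 'e) chart = "'m set \<times> ('m \<Rightarrow> 'e)"

abbreviation chart_dom :: "('m, 'e) chart \<Rightarrow> 'm set" where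
  "chart_dom c \<equiv> fst c"

abbreviation coord :: "('m, 'e) chart \<Rightarrow> 'm \<Rightarrow> 'e" where
  "coord c \<equiv> snd c"

abbreviation chart_img :: "('m, 'e) chart \<Rightarrow> 'e set" where
  "chart_img c \<equiv> coord c ` chart_dom c"

definition param :: "('m, 'e) chart \<Rightarrow> 'e \<Rightarrow> 'm" where
  "param c = inv_into (chart_dom c) (coord c)"

definition smooth_manifold ::
    "'m::{t2_space, second_countable_topology} set \<Rightarrow> ('m, 'e::euclidean_space) chart set \<Rightarrow> bool" where
  "smooth_manifold M A \<longleftrightarrow>
     (\<Union>c\<in>A. chart_dom c) = M \<and>
     (\<forall>c\<in>A. openin (top_of_set M) (chart_dom c) \<and> open (chart_img c) \<and>
            homeomorphism (chart_dom c) (chart_img c) (coord c) (param c)) \<and>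
     (\<forall>c\<in>A. \<forall>c'\<in>A. smooth_on (coord c ` (chart_dom c \<inter> chart_dom c')) (coord c' \<circ> param c))"

definition smooth_map ::
    "'n::topological_space set \<Rightarrow> ('n, 'd::euclidean_space) chart set \<Rightarrow>
     'm::topological_space set \<Rightarrow> ('m, 'e::euclidean_space) chart set \<Rightarrow> ('n \<Rightarrow> 'm) \<Rightarrow> bool" where
  "smooth_map N B M A \<psi> \<longleftrightarrow>
     continuous_on N \<psi> \<and> \<psi> ` N \<subseteq> M \<and>
     (\<forall>d\<in>B. \<forall>c\<in>A. smooth_on (coord d ` (chart_dom d \<inter> \<psi> -` chart_dom c)) (coord c \<circ> \<psi> \<circ> param d))"

definition smooth_real_function :: "('m, 'e::euclidean_space) chart set \<Rightarrow> ('m \<Rightarrow> real) \<Rightarrow> bool" where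
  "smooth_real_function A f \<longleftrightarrow> (\<forall>c\<in>A. smooth_on (chart_img c) (f \<circ> param c))"


section \<open>Tangent vectors\<close>

text \<open>A tangent vector at \<open>p\<close> is the family of its coordinates in all charts around \<open>p\<close>, which are
  related by the derivatives of the coordinate changes. Entries at all other charts are set to \<open>0\<close>,
  so that vectors with the same coordinates are equal. Linear operations are chartwise.\<close>

type_synonym ('m, 'e) tangent = "('m, 'e) chart \<Rightarrow> 'e"

definition charts_at :: "('m, 'e) chart set \<Rightarrow> 'm \<Rightarrow> ('m, 'e) chart set" where
  "charts_at A p = {c \<in> A. p \<in> chart_dom c}"

definition tangent_space ::
    "('m, 'e::euclidean_space) chart set \<Rightarrow> 'm \<Rightarrow> ('m, 'e) tangent set" where
  "tangent_space A p =
     {v. (\<forall>c\<in>charts_at A p. \<forall>c'\<in>charts_at A p.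
            v c' = frechet_derivative (coord c' \<circ> param c) (at (coord c p)) (v c)) \<and>
         (\<forall>c. c \<notin> charts_at A p \<longrightarrow> v c = 0)}"

definition zero_tangent :: "('m, 'e::euclidean_space) tangent" where
  "zero_tangent = (\<lambda>c. 0)"

text \<open>The tangent vector at \<open>p\<close> with coordinates \<open>e\<close> in the chart \<open>c\<close>.\<close>

definition tangent_of ::
    "('m, 'e::euclidean_space) chart set \<Rightarrow> ('m, 'e) chart \<Rightarrow> 'm \<Rightarrow> 'e \<Rightarrow> ('m, 'e) tangent" where
  "tangent_of A c p e =
     (\<lambda>c'. if c' \<in> charts_at A p
           then frechet_derivative (coord c' \<circ> param c) (at (coord c p)) e else 0)"

text \<open>The derivative \<open>v(f)\<close> of a function \<open>f\<close> in the direction of a tangent vector \<open>v\<close> at \<open>p\<close>, and the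
  differential of a map \<open>\<psi>\<close>. By the chain rule the chart chosen at \<open>p\<close> is immaterial.\<close>

definition directional_derivative ::
    "('m, 'e::euclidean_space) chart set \<Rightarrow> ('m \<Rightarrow> 'b::euclidean_space) \<Rightarrow> 'm \<Rightarrow> ('m, 'e) tangent \<Rightarrow> 'b" where
  "directional_derivative A f p v =
     (let c = (SOME c. c \<in> charts_at A p)
      in frechet_derivative (f \<circ> param c) (at (coord c p)) (v c))"

definition differential ::
    "('n, 'd::euclidean_space) chart set \<Rightarrow> ('m, 'e::euclidean_space) chart set \<Rightarrow> ('n \<Rightarrow> 'm) \<Rightarrow>
     'n \<Rightarrow> ('n, 'd) tangent \<Rightarrow> ('m, 'e) tangent" where
  "differential B A \<psi> q v =
     (\<lambda>c. if c \<in> charts_at A (\<psi> q) then directional_derivative B (coord c \<circ> \<psi>) q v else 0)"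

definition smooth_vector_field_on ::
    "('m::topological_space, 'e::euclidean_space) chart set \<Rightarrow> 'm set \<Rightarrow> ('m \<Rightarrow> ('m, 'e) tangent) \<Rightarrow> bool" where
  "smooth_vector_field_on A U X \<longleftrightarrow>
     (\<forall>p\<in>U. X p \<in> tangent_space A p) \<and>
     (\<forall>c\<in>A. smooth_on (coord c ` (chart_dom c \<inter> U)) (\<lambda>z. X (param c z) c))"


section \<open>Metric tensors and the Levi-Civita connection\<close>

type_synonym ('m, 'e) metric = "'m \<Rightarrow> ('m, 'e) tangent \<Rightarrow> ('m, 'e) tangent \<Rightarrow> real"

definition symmetric_bilinear_on ::
    "('m, 'e::euclidean_space) tangent set \<Rightarrow> (('m, 'e) tangent \<Rightarrow> ('m, 'e) tangent \<Rightarrow> real) \<Rightarrow> bool" where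
  "symmetric_bilinear_on T b \<longleftrightarrow>
     (\<forall>u\<in>T. \<forall>v\<in>T. b u v = b v u) \<and>
     (\<forall>u\<in>T. \<forall>v\<in>T. \<forall>w\<in>T. \<forall>r s. b (\<lambda>c. r *\<^sub>R u c + s *\<^sub>R v c) w = r * b u w + s * b v w)"

definition metric_comp ::
    "('m, 'e::euclidean_space) chart set \<Rightarrow> ('m, 'e) metric \<Rightarrow> ('m, 'e) chart \<Rightarrow> 'e \<Rightarrow> 'e \<Rightarrow> 'e \<Rightarrow> real" where
  "metric_comp A g c z u v =
     g (param c z) (tangent_of A c (param c z) u) (tangent_of A c (param c z) v)"

definition riemannian_metric ::
    "'m set \<Rightarrow> ('m, 'e::euclidean_space) chart set \<Rightarrow> ('m, 'e) metric \<Rightarrow> bool" where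
  "riemannian_metric M A g \<longleftrightarrow>
     (\<forall>p\<in>M. symmetric_bilinear_on (tangent_space A p) (g p) \<and>
            (\<forall>v\<in>tangent_space A p. v \<noteq> zero_tangent \<longrightarrow> 0 < g p v v)) \<and>
     (\<forall>c\<in>A. \<forall>u v. smooth_on (chart_img c) (\<lambda>z. metric_comp A g c z u v))"

text \<open>In a chart, every affine connection has the form \<open>\<nabla>\<^sub>X Y = DY(X) + \<Gamma>(X, Y)\<close>. The Levi-Civita
  connection is the one with \<open>\<Gamma>\<close> symmetric (no torsion) and
  \<open>D\<^sub>u g(v, w) = g(\<Gamma>(u, v), w) + g(v, \<Gamma>(u, w))\<close> for constant \<open>v\<close>, \<open>w\<close> (compatible with \<open>g\<close>);
  its \<open>\<Gamma>\<close> are the Christoffel symbols.\<close>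

definition christoffel ::
    "('m, 'e::euclidean_space) chart set \<Rightarrow> ('m, 'e) metric \<Rightarrow> ('m, 'e) chart \<Rightarrow> 'e \<Rightarrow> 'e \<Rightarrow> 'e \<Rightarrow> 'e" where
  "christoffel A g c z =
     (THE \<Gamma>. bilinear \<Gamma> \<and> (\<forall>u v. \<Gamma> u v = \<Gamma> v u) \<and>
        (\<forall>u v w. frechet_derivative (\<lambda>y. metric_comp A g c y v w) (at z) u =
                 metric_comp A g c z (\<Gamma> u v) w + metric_comp A g c z v (\<Gamma> u w)))"

text \<open>Levi-Civita derivative of a vector field \<open>Y\<close> along \<open>\<psi>\<close> (that is, \<open>Y q\<close> is tangent at \<open>\<psi> q\<close>) in the
  direction of a vector \<open>v\<close> tangent to the source at \<open>q\<close>.\<close>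

definition covariant_derivative_along ::
    "('n, 'd::euclidean_space) chart set \<Rightarrow> ('m, 'e::euclidean_space) chart set \<Rightarrow> ('m, 'e) metric \<Rightarrow>
     ('n \<Rightarrow> 'm) \<Rightarrow> 'n \<Rightarrow> ('n, 'd) tangent \<Rightarrow> ('n \<Rightarrow> ('m, 'e) tangent) \<Rightarrow> ('m, 'e) tangent" where
  "covariant_derivative_along B A g \<psi> q v Y =
     (\<lambda>c. if c \<in> charts_at A (\<psi> q)
          then directional_derivative B (\<lambda>x. Y x c) q v +
               christoffel A g c (coord c (\<psi> q)) (differential B A \<psi> q v c) (Y q c)
          else 0)"


section \<open>Spacelike immersed submanifolds\<close>

definition induced_metric ::
    "('n, 'd::euclidean_space) chart set \<Rightarrow> ('m, 'e::euclidean_space) chart set \<Rightarrow> ('m, 'e) metric \<Rightarrow>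
     ('n \<Rightarrow> 'm) \<Rightarrow> ('n, 'd) metric" where
  "induced_metric B A g \<psi> q v w = g (\<psi> q) (differential B A \<psi> q v) (differential B A \<psi> q w)"

definition spacelike_immersion ::
    "'n::topological_space set \<Rightarrow> ('n, 'd::euclidean_space) chart set \<Rightarrow>
     'm::topological_space set \<Rightarrow> ('m, 'e::euclidean_space) chart set \<Rightarrow> ('m, 'e) metric \<Rightarrow> ('n \<Rightarrow> 'm) \<Rightarrow> bool" where
  "spacelike_immersion N B M A g \<psi> \<longleftrightarrow>
     smooth_map N B M A \<psi> \<and>
     (\<forall>q\<in>N. inj_on (differential B A \<psi> q) (tangent_space B q)) \<and>
     riemannian_metric N B (induced_metric B A g \<psi>)"

text \<open>The component of \<open>w\<close> orthogonal to the submanifold: \<open>w = d\<psi>(v) + n\<close> with \<open>n\<close> normal.\<close>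

definition normal_part ::
    "('n, 'd::euclidean_space) chart set \<Rightarrow> ('m, 'e::euclidean_space) chart set \<Rightarrow> ('m, 'e) metric \<Rightarrow>
     ('n \<Rightarrow> 'm) \<Rightarrow> 'n \<Rightarrow> ('m, 'e) tangent \<Rightarrow> ('m, 'e) tangent" where
  "normal_part B A g \<psi> q w =
     (THE n. (\<forall>v\<in>tangent_space B q. g (\<psi> q) n (differential B A \<psi> q v) = 0) \<and>
             (\<exists>v\<in>tangent_space B q. n = (\<lambda>c. w c - differential B A \<psi> q v c)))"

text \<open>Sign convention: \<open>II(X, Y) = - (\<nabla>\<^sub>X Y)\<^sup>\<bottom>\<close>.\<close>

definition second_fundamental_form ::
    "('n, 'd::euclidean_space) chart set \<Rightarrow> ('m, 'e::euclidean_space) chart set \<Rightarrow> ('m, 'e) metric \<Rightarrow>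
     ('n \<Rightarrow> 'm) \<Rightarrow> ('n \<Rightarrow> ('n, 'd) tangent) \<Rightarrow> ('n \<Rightarrow> ('n, 'd) tangent) \<Rightarrow> 'n \<Rightarrow> ('m, 'e) tangent" where
  "second_fundamental_form B A g \<psi> X Y q =
     (\<lambda>c. - normal_part B A g \<psi> q
              (covariant_derivative_along B A g \<psi> q (X q) (\<lambda>x. differential B A \<psi> x (Y x))) c)"

text \<open>Frames and the charts of the submanifold share the index type \<open>'k\<close>, whose cardinality is the
  dimension. The trace defining the mean curvature vector does not depend on the frame.\<close>

definition local_orthonormal_frame ::
    "('n::topological_space, real^'k) chart set \<Rightarrow> ('n, real^'k) metric \<Rightarrow> 'n \<Rightarrow>
     ('k::finite \<Rightarrow> 'n \<Rightarrow> ('n, real^'k) tangent) \<Rightarrow> bool" where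
  "local_orthonormal_frame B h q E \<longleftrightarrow>
     (\<exists>U. open U \<and> q \<in> U \<and>
          (\<forall>i. smooth_vector_field_on B U (E i)) \<and>
          (\<forall>x\<in>U. \<forall>i j. h x (E i x) (E j x) = (if i = j then 1 else 0)))"

definition mean_curvature_vector ::
    "('n::topological_space, real^'k::finite) chart set \<Rightarrow> ('m, 'e::euclidean_space) chart set \<Rightarrow>
     ('m, 'e) metric \<Rightarrow> ('n \<Rightarrow> 'm) \<Rightarrow> 'n \<Rightarrow> ('m, 'e) tangent" where
  "mean_curvature_vector B A g \<psi> q =
     (let E = (SOME E. local_orthonormal_frame B (induced_metric B A g \<psi>) q E)
      in (\<lambda>c. \<Sum>i\<in>UNIV. second_fundamental_form B A g \<psi> (E i) (E i) q c))"


section \<open>Orthogonally splitted spacetimes\<close>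

text \<open>The manifold \<open>I \<times> F\<close> has one chart \<open>(t, x) \<mapsto> (t, \<phi> x)\<close> for each chart \<open>\<phi>\<close> of \<open>F\<close>.\<close>

definition split_atlas ::
    "real set \<Rightarrow> ('f, 'e::euclidean_space) chart set \<Rightarrow> (real \<times> 'f, real \<times> 'e) chart set" where
  "split_atlas I A = (\<lambda>c. (I \<times> chart_dom c, \<lambda>(t, x). (t, coord c x))) ` A"

definition split_metric ::
    "real set \<Rightarrow> ('f, 'e::euclidean_space) chart set \<Rightarrow> (real \<times> 'f \<Rightarrow> real) \<Rightarrow> (real \<Rightarrow> ('f, 'e) metric) \<Rightarrow>
     (real \<times> 'f, real \<times> 'e) metric" where
  "split_metric I A \<beta> g p v w =
     - \<beta> p * directional_derivative (split_atlas I A) fst p v * directional_derivative (split_atlas I A) fst p w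
     + g (fst p) (snd p) (differential (split_atlas I A) A snd p v) (differential (split_atlas I A) A snd p w)"

definition smooth_family_of_riemannian_metrics ::
    "real set \<Rightarrow> ('f, 'e::euclidean_space) chart set \<Rightarrow> (real \<Rightarrow> ('f, 'e) metric) \<Rightarrow> bool" where
  "smooth_family_of_riemannian_metrics I A g \<longleftrightarrow>
     (\<forall>t\<in>I. riemannian_metric UNIV A (g t)) \<and>
     (\<forall>c\<in>A. \<forall>u v. smooth_on (I \<times> chart_img c) (\<lambda>(t, z). metric_comp A (g t) c z u v))"

definition orthogonally_splitted_spacetime ::
    "real set \<Rightarrow> ('f::{t2_space, second_countable_topology}, 'e::euclidean_space) chart set \<Rightarrow>
     (real \<times> 'f \<Rightarrow> real) \<Rightarrow> (real \<Rightarrow> ('f, 'e) metric) \<Rightarrow> bool" where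
  "orthogonally_splitted_spacetime I A \<beta> g \<longleftrightarrow>
     open I \<and> is_interval I \<and> I \<noteq> {} \<and>
     smooth_manifold UNIV A \<and>
     smooth_real_function (split_atlas I A) \<beta> \<and> (\<forall>p\<in>I \<times> UNIV. 0 < \<beta> p) \<and>
     smooth_family_of_riemannian_metrics I A g"

text \<open>As \<open>v\<close> is a fixed vector of \<open>T\<^sub>xF\<close>, the Lie derivative of \<open>g\<^sub>t\<close> along \<open>\<partial>\<^sub>t\<close> is the plain
  \<open>t\<close>-derivative of \<open>g\<^sub>t(v, v)\<close>.\<close>

definition non_contracting ::
    "real set \<Rightarrow> ('f, 'e::euclidean_space) chart set \<Rightarrow> (real \<times> 'f \<Rightarrow> real) \<Rightarrow> (real \<Rightarrow> ('f, 'e) metric) \<Rightarrow> bool" where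
  "non_contracting I A \<beta> g \<longleftrightarrow>
     (\<forall>t\<in>I. \<forall>x. deriv (\<lambda>s. \<beta> (s, x)) t \<le> 0 \<and>
        (\<forall>v\<in>tangent_space A x. deriv (\<lambda>s. g s x v v) t \<ge> 0))"

definition non_expanding ::
    "real set \<Rightarrow> ('f, 'e::euclidean_space) chart set \<Rightarrow> (real \<times> 'f \<Rightarrow> real) \<Rightarrow> (real \<Rightarrow> ('f, 'e) metric) \<Rightarrow> bool" where
  "non_expanding I A \<beta> g \<longleftrightarrow>
     (\<forall>t\<in>I. \<forall>x. deriv (\<lambda>s. \<beta> (s, x)) t \<ge> 0 \<and>
        (\<forall>v\<in>tangent_space A x. deriv (\<lambda>s. g s x v v) t \<le> 0))"

definition coordinate_time_field ::
    "real set \<Rightarrow> ('f, 'e::euclidean_space) chart set \<Rightarrow> real \<times> 'f \<Rightarrow> (real \<times> 'f, real \<times> 'e) tangent" where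
  "coordinate_time_field I A p = (\<lambda>c. if c \<in> charts_at (split_atlas I A) p then (1, 0) else 0)"


section \<open>Causal character and trapped submanifolds\<close>

text \<open>In these definitions \<open>T\<close> is a timelike vector field giving the time orientation: a non-zero
  causal vector \<open>v\<close> lies in the same time cone as \<open>T\<close> iff \<open>g(v, T) < 0\<close>. The zero vector is lightlike,
  and no orientation is required of it.\<close>

definition timelike :: "('m, 'e::euclidean_space) metric \<Rightarrow> 'm \<Rightarrow> ('m, 'e) tangent \<Rightarrow> bool" where
  "timelike g p v \<longleftrightarrow> g p v v < 0"

definition lightlike :: "('m, 'e::euclidean_space) metric \<Rightarrow> 'm \<Rightarrow> ('m, 'e) tangent \<Rightarrow> bool" where
  "lightlike g p v \<longleftrightarrow> g p v v = 0"

definition causal :: "('m, 'e::euclidean_space) metric \<Rightarrow> 'm \<Rightarrow> ('m, 'e) tangent \<Rightarrow> bool" where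
  "causal g p v \<longleftrightarrow> g p v v \<le> 0"

definition future_pointing ::
    "('m, 'e::euclidean_space) metric \<Rightarrow> ('m \<Rightarrow> ('m, 'e) tangent) \<Rightarrow> 'm \<Rightarrow> ('m, 'e) tangent \<Rightarrow> bool" where
  "future_pointing g T p v \<longleftrightarrow> (v \<noteq> zero_tangent \<longrightarrow> g p v (T p) < 0)"

definition past_pointing ::
    "('m, 'e::euclidean_space) metric \<Rightarrow> ('m \<Rightarrow> ('m, 'e) tangent) \<Rightarrow> 'm \<Rightarrow> ('m, 'e) tangent \<Rightarrow> bool" where
  "past_pointing g T p v \<longleftrightarrow> (v \<noteq> zero_tangent \<longrightarrow> g p v (T p) > 0)"

text \<open>The future and past notions are obtained with \<open>P = future_pointing g T\<close> and
  \<open>P = past_pointing g T\<close>; \<open>H\<close> is the mean curvature vector along \<open>\<psi>\<close>.\<close>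

definition trapped ::
    "'n set \<Rightarrow> ('n \<Rightarrow> 'm) \<Rightarrow> ('m, 'e::euclidean_space) metric \<Rightarrow> ('m \<Rightarrow> ('m, 'e) tangent \<Rightarrow> bool) \<Rightarrow>
     ('n \<Rightarrow> ('m, 'e) tangent) \<Rightarrow> bool" where
  "trapped N \<psi> g P H \<longleftrightarrow> (\<forall>q\<in>N. timelike g (\<psi> q) (H q) \<and> P (\<psi> q) (H q))"

definition nearly_trapped ::
    "'n set \<Rightarrow> ('n \<Rightarrow> 'm) \<Rightarrow> ('m, 'e::euclidean_space) metric \<Rightarrow> ('m \<Rightarrow> ('m, 'e) tangent \<Rightarrow> bool) \<Rightarrow>
     ('n \<Rightarrow> ('m, 'e) tangent) \<Rightarrow> bool" where
  "nearly_trapped N \<psi> g P H \<longleftrightarrow>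
     (\<forall>q\<in>N. causal g (\<psi> q) (H q) \<and> P (\<psi> q) (H q)) \<and> (\<exists>q\<in>N. timelike g (\<psi> q) (H q))"

definition weakly_trapped ::
    "'n set \<Rightarrow> ('n \<Rightarrow> 'm) \<Rightarrow> ('m, 'e::euclidean_space) metric \<Rightarrow> ('m \<Rightarrow> ('m, 'e) tangent \<Rightarrow> bool) \<Rightarrow>
     ('n \<Rightarrow> ('m, 'e) tangent) \<Rightarrow> bool" where
  "weakly_trapped N \<psi> g P H \<longleftrightarrow>
     (\<forall>q\<in>N. causal g (\<psi> q) (H q) \<and> P (\<psi> q) (H q)) \<and> (\<exists>q\<in>N. H q \<noteq> zero_tangent)"

definition marginally_trapped ::
    "'n set \<Rightarrow> ('n \<Rightarrow> 'm) \<Rightarrow> ('m, 'e::euclidean_space) metric \<Rightarrow> ('m \<Rightarrow> ('m, 'e) tangent \<Rightarrow> bool) \<Rightarrow>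
     ('n \<Rightarrow> ('m, 'e) tangent) \<Rightarrow> bool" where
  "marginally_trapped N \<psi> g P H \<longleftrightarrow>
     (\<forall>q\<in>N. lightlike g (\<psi> q) (H q) \<and> P (\<psi> q) (H q)) \<and> (\<exists>q\<in>N. H q \<noteq> zero_tangent)"


section \<open>Strict local extrema\<close>

definition strict_local_min :: "('n::topological_space \<Rightarrow> real) \<Rightarrow> 'n \<Rightarrow> bool" where
  "strict_local_min f q \<longleftrightarrow> (\<forall>\<^sub>F x in at q. f q < f x)"

definition strict_local_max :: "('n::topological_space \<Rightarrow> real) \<Rightarrow> 'n \<Rightarrow> bool" where
  "strict_local_max f q \<longleftrightarrow> (\<forall>\<^sub>F x in at q. f x < f q)"

end

theory Submission
  imports Defs
begin

text \<open>Let \<open>u\<close> be the time function \<open>\<tau>\<close> in a chart of the surface, let \<open>e\<^sub>k\<close> be an orthonormal frame at a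
  point and \<open>W\<^sub>k = d\<psi>(e\<^sub>k)\<close>. The time component of \<open>W\<^sub>k\<close> is \<open>Du(e\<^sub>k)\<close>. Splitting the covariant derivative of
  \<open>W\<^sub>k\<close> along \<open>e\<^sub>k\<close> into a tangential and a normal part and taking time components gives
  \<open>- dt(H) = \<Sum>\<^sub>k D\<^sup>2u(e\<^sub>k, e\<^sub>k) - Du(s\<^sub>k) + \<Gamma>\<^sup>t(W\<^sub>k, W\<^sub>k)\<close>,
  where \<open>s\<^sub>k\<close> is the Christoffel symbol of the induced metric at \<open>(e\<^sub>k, e\<^sub>k)\<close>, and the Koszul formula yields
  \<open>\<beta> \<Gamma>\<^sup>t(W, W) = d\<beta>(W) dt(W) - \<partial>\<^sub>t\<beta> dt(W)\<^sup>2 / 2 + (\<partial>\<^sub>tg)(W\<^sub>F, W\<^sub>F) / 2\<close>.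

  If \<open>H\<close> is causal and future pointing, then \<open>dt(H) \<ge> 0\<close>, and in a non-contracting spacetime the last
  term is non-negative as well. Apart from the second derivatives, all other terms contain a factor
  \<open>Du\<close>, so that near every point
  \<open>\<Sum>\<^sub>k D\<^sup>2u(e\<^sub>k, e\<^sub>k) \<le> C (|Du| + |Du|\<^sup>2)\<close>. The left-hand side is a uniformly elliptic operator without zeroth
  order term, hence a comparison with \<open>\<epsilon> exp(\<alpha> b\<cdot>z)\<close> excludes strict local minima. This is
  Hopf's argument for the weak minimum principle. The case of past pointing \<open>H\<close> is the same argument
  for \<open>- u\<close>. The two halves are the lemmas \<open>mean_curvature_time_component\<close> and
  \<open>no_strict_interior_minimum\<close>; \<open>no_strict_local_extremum\<close> joins them.

  The constant \<open>C\<close> has to be uniform, but the definitions of the metric and of directional derivatives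
  select a chart of the spacetime at each point separately. The proof therefore expresses the formula for
  \<open>dt(H)\<close> by quantities that do not refer to a chart of the spacetime: the induced metric, \<open>\<beta> \<circ> \<psi>\<close> and its
  derivative, and \<open>\<partial>\<^sub>t\<beta>\<close>. In this way the transformation law of Christoffel symbols is avoided.\<close>

section \<open>Calculus of smooth maps\<close>

lemma Ck_on_cong:
  assumes "open S" "\<And>x. x \<in> S \<Longrightarrow> f x = g x" "Ck_on k S f"
  shows "Ck_on k S g"
  using assms(2,3)
proof (induction k arbitrary: f g)
  case 0
  then show ?case by (simp cong: continuous_on_cong)
next
  case (Suc k)
  have D: "g differentiable (at x) \<and> frechet_derivative g (at x) = frechet_derivative f (at x)"
    if "x \<in> S" for x
  proof -
    have fx: "f differentiable (at x)" using Suc.prems that by simp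
    then have "(g has_derivative frechet_derivative f (at x)) (at x)"
      using has_derivative_transform_within_open[OF _ assms(1) that] Suc.prems(1) frechet_derivative_works
      by blast
    then show ?thesis using frechet_derivative_at differentiableI by metis
  qed
  have "Ck_on k S (\<lambda>x. frechet_derivative g (at x) v)" for v
    using Suc.IH[of "\<lambda>x. frechet_derivative f (at x) v" "\<lambda>x. frechet_derivative g (at x) v"] D Suc.prems(2)
    by simp
  with D show ?case by simp
qed

lemma Ck_on_SucD: "Ck_on (Suc k) S f \<Longrightarrow> Ck_on k S f"
proof (induction k arbitrary: f)
  case 0
  then show ?case
    by (simp add: continuous_at_imp_continuous_on differentiable_imp_continuous_within)
next
  case (Suc k)
  have "Ck_on k S (\<lambda>x. frechet_derivative f (at x) v)" for v
    using Suc.IH Suc.prems by simp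
  with Suc.prems show ?case by simp
qed

lemma Ck_on_SucI:
  assumes "open S" "\<And>x. x \<in> S \<Longrightarrow> (f has_derivative f' x) (at x)" "\<And>v. Ck_on k S (\<lambda>x. f' x v)"
  shows "Ck_on (Suc k) S f"
proof -
  have "Ck_on k S (\<lambda>x. frechet_derivative f (at x) v)" for v
  proof (rule Ck_on_cong[OF assms(1) _ assms(3)[of v]])
    show "f' x v = frechet_derivative f (at x) v" if "x \<in> S" for x
      by (simp add: frechet_derivative_at[OF assms(2)[OF that], symmetric])
  qed
  moreover have "\<forall>x\<in>S. f differentiable (at x)"
    using assms(2) differentiableI by blast
  ultimately show ?thesis by simp
qed

lemma Ck_on_has_derivative:
  "Ck_on (Suc k) S f \<Longrightarrow> x \<in> S \<Longrightarrow> (f has_derivative frechet_derivative f (at x)) (at x)"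
  by (simp add: frechet_derivative_works[symmetric])

lemma Ck_on_frechet_derivative: "Ck_on (Suc k) S f \<Longrightarrow> Ck_on k S (\<lambda>x. frechet_derivative f (at x) v)"
  by simp

lemma Ck_on_const:
  fixes a :: "'b::euclidean_space"
  assumes "open S"
  shows "Ck_on k S (\<lambda>x. a)"
proof (induction k arbitrary: a)
  case 0
  show ?case by simp
next
  case (Suc k)
  show ?case
    by (rule Ck_on_SucI[OF assms has_derivative_const Suc.IH])
qed

lemma Ck_on_bounded_linear:
  assumes "bounded_linear L" "open S"
  shows "Ck_on k S f \<Longrightarrow> Ck_on k S (\<lambda>x. L (f x))"
proof (induction k arbitrary: f)
  case 0
  then show ?case using assms(1) by (simp add: bounded_linear.continuous_on)
next
  case (Suc k)
  show ?case
  proof (rule Ck_on_SucI[OF assms(2)])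
    show "((\<lambda>x. L (f x)) has_derivative (\<lambda>v. L (frechet_derivative f (at x) v))) (at x)" if "x \<in> S" for x
      by (rule bounded_linear.has_derivative[OF assms(1) Ck_on_has_derivative[OF Suc.prems that]])
    show "Ck_on k S (\<lambda>x. L (frechet_derivative f (at x) v))" for v
      by (rule Suc.IH[OF Ck_on_frechet_derivative[OF Suc.prems]])
  qed
qed

lemma Ck_on_add:
  assumes "open S"
  shows "Ck_on k S f \<Longrightarrow> Ck_on k S g \<Longrightarrow> Ck_on k S (\<lambda>x. f x + g x)"
proof (induction k arbitrary: f g)
  case 0
  then show ?case by (simp add: continuous_on_add)
next
  case (Suc k)
  show ?case
  proof (rule Ck_on_SucI[OF assms])
    show "((\<lambda>x. f x + g x) has_derivative
        (\<lambda>v. frechet_derivative f (at x) v + frechet_derivative g (at x) v)) (at x)" if "x \<in> S" for x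
      by (rule has_derivative_add[OF Ck_on_has_derivative[OF Suc.prems(1) that]
            Ck_on_has_derivative[OF Suc.prems(2) that]])
    show "Ck_on k S (\<lambda>x. frechet_derivative f (at x) v + frechet_derivative g (at x) v)" for v
      by (rule Suc.IH[OF Ck_on_frechet_derivative[OF Suc.prems(1)] Ck_on_frechet_derivative[OF Suc.prems(2)]])
  qed
qed

lemma Ck_on_sum:
  assumes "open S" "\<And>i. i \<in> J \<Longrightarrow> Ck_on k S (f i)"
  shows "Ck_on k S (\<lambda>x. \<Sum>i\<in>J. f i x)"
  using assms(2)
proof (induction J rule: infinite_finite_induct)
  case (insert x F)
  have "Ck_on k S (\<lambda>y. f x y + (\<Sum>i\<in>F. f i y))"
    by (rule Ck_on_add[OF assms(1)]) (use insert in auto)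
  with insert.hyps show ?case by simp
qed (simp_all add: Ck_on_const assms(1))

lemma Ck_on_scaleR:
  assumes "open S"
  shows "Ck_on k S r \<Longrightarrow> Ck_on k S f \<Longrightarrow> Ck_on k S (\<lambda>x. r x *\<^sub>R f x)"
proof (induction k arbitrary: r f)
  case 0
  then show ?case by (simp add: continuous_on_scaleR)
next
  case (Suc k)
  show ?case
  proof (rule Ck_on_SucI[OF assms])
    show "((\<lambda>x. r x *\<^sub>R f x) has_derivative
        (\<lambda>v. r x *\<^sub>R frechet_derivative f (at x) v + frechet_derivative r (at x) v *\<^sub>R f x)) (at x)"
      if "x \<in> S" for x
      by (rule has_derivative_scaleR[OF Ck_on_has_derivative[OF Suc.prems(1) that]
            Ck_on_has_derivative[OF Suc.prems(2) that]])
    show "Ck_on k S (\<lambda>x. r x *\<^sub>R frechet_derivative f (at x) v + frechet_derivative r (at x) v *\<^sub>R f x)" for v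
      by (rule Ck_on_add[OF assms Suc.IH[OF Ck_on_SucD[OF Suc.prems(1)] Ck_on_frechet_derivative[OF Suc.prems(2)]]
            Suc.IH[OF Ck_on_frechet_derivative[OF Suc.prems(1)] Ck_on_SucD[OF Suc.prems(2)]]])
  qed
qed

lemma linear_Basis_expansion:
  fixes L :: "'a::euclidean_space \<Rightarrow> 'b::real_vector"
  assumes "linear L"
  shows "L v = (\<Sum>b\<in>Basis. (v \<bullet> b) *\<^sub>R L b)"
proof -
  have "L v = L (\<Sum>b\<in>Basis. (v \<bullet> b) *\<^sub>R b)" by (simp add: euclidean_representation)
  also have "\<dots> = (\<Sum>b\<in>Basis. (v \<bullet> b) *\<^sub>R L b)"
    by (simp add: linear_sum[OF assms] linear_cmul[OF assms])
  finally show ?thesis .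
qed

text \<open>The chain rule is written out in a basis. The derivative of a composition thereby becomes a finite sum
  of products of functions of class \<open>C\<^sup>k\<close>, to which the induction hypothesis and the product rule apply.\<close>

lemma Ck_on_compose:
  assumes "open S" "open T"
  shows "Ck_on k T f \<Longrightarrow> Ck_on k S g \<Longrightarrow> g ` S \<subseteq> T \<Longrightarrow> Ck_on k S (\<lambda>x. f (g x))"
proof (induction k arbitrary: f)
  case 0
  then show ?case using continuous_on_compose2 by auto
next
  case (Suc k)
  have D: "((\<lambda>x. f (g x)) has_derivative
      (\<lambda>v. \<Sum>b\<in>Basis. (frechet_derivative g (at x) v \<bullet> b) *\<^sub>R frechet_derivative f (at (g x)) b)) (at x)"
    if "x \<in> S" for x
  proof -
    have f: "(f has_derivative frechet_derivative f (at (g x))) (at (g x))"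
      using Ck_on_has_derivative[OF Suc.prems(1)] that Suc.prems(3) by blast
    have g: "(g has_derivative frechet_derivative g (at x)) (at x)"
      using Ck_on_has_derivative[OF Suc.prems(2)] that by blast
    have "(\<lambda>v. frechet_derivative f (at (g x)) (frechet_derivative g (at x) v)) =
        (\<lambda>v. \<Sum>b\<in>Basis. (frechet_derivative g (at x) v \<bullet> b) *\<^sub>R frechet_derivative f (at (g x)) b)"
      by (rule ext, rule linear_Basis_expansion[OF has_derivative_linear[OF f]])
    with has_derivative_compose[OF g f] show ?thesis by simp
  qed
  show ?case
  proof (rule Ck_on_SucI[OF assms(1) D])
    fix v
    show "Ck_on k S (\<lambda>x. \<Sum>b\<in>Basis. (frechet_derivative g (at x) v \<bullet> b) *\<^sub>R frechet_derivative f (at (g x)) b)"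
    proof (rule Ck_on_sum[OF assms(1)], rule Ck_on_scaleR[OF assms(1)])
      fix b
      show "Ck_on k S (\<lambda>x. frechet_derivative g (at x) v \<bullet> b)"
        by (rule Ck_on_bounded_linear[OF bounded_linear_inner_left assms(1) Ck_on_frechet_derivative[OF Suc.prems(2)]])
      show "Ck_on k S (\<lambda>x. frechet_derivative f (at (g x)) b)"
        by (rule Suc.IH[OF Ck_on_frechet_derivative[OF Suc.prems(1)] Ck_on_SucD[OF Suc.prems(2)] Suc.prems(3)])
    qed
  qed
qed

text \<open>The exponent is arbitrary because differentiation lowers it by one.\<close>

lemma Ck_on_powr: "Ck_on k {0<..} (\<lambda>x::real. x powr a)"
proof (induction k arbitrary: a)
  case 0
  show ?case by (auto intro!: continuous_intros)
next
  case (Suc k)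
  have "((\<lambda>x. x powr a) has_derivative (\<lambda>v. (a * v) *\<^sub>R (x powr (a - 1)))) (at x)" if "x \<in> {0<..}" for x
  proof -
    have "((\<lambda>x. x powr a) has_real_derivative a * x powr (a - 1)) (at x)"
      using that by (auto intro!: has_real_derivative_powr)
    moreover have "(*) (a * x powr (a - 1)) = (\<lambda>v. (a * v) *\<^sub>R (x powr (a - 1)))"
      by (simp add: fun_eq_iff)
    ultimately show ?thesis by (simp only: has_field_derivative_def)
  qed
  then show ?case
  proof (rule Ck_on_SucI[rotated])
    show "Ck_on k {0<..} (\<lambda>x. (a * v) *\<^sub>R (x powr (a - 1)))" for v
      by (rule Ck_on_scaleR[OF _ Ck_on_const Suc.IH]) auto
  qed auto
qed

lemma smooth_on_cong: "open S \<Longrightarrow> (\<And>x. x \<in> S \<Longrightarrow> f x = g x) \<Longrightarrow> smooth_on S f \<Longrightarrow> smooth_on S g"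
  unfolding smooth_on_def by (rule allI, rule Ck_on_cong[where f=f]) (assumption | simp)+

lemma smooth_on_const: "open S \<Longrightarrow> smooth_on S (\<lambda>x. a)"
  unfolding smooth_on_def by (rule allI, rule Ck_on_const) (assumption | erule spec)+

lemma smooth_on_bounded_linear:
  "bounded_linear L \<Longrightarrow> open S \<Longrightarrow> smooth_on S f \<Longrightarrow> smooth_on S (\<lambda>x. L (f x))"
  unfolding smooth_on_def by (rule allI, rule Ck_on_bounded_linear) (assumption | erule spec)+

lemma smooth_on_add:
  "open S \<Longrightarrow> smooth_on S f \<Longrightarrow> smooth_on S g \<Longrightarrow> smooth_on S (\<lambda>x. f x + g x)"
  unfolding smooth_on_def by (rule allI, rule Ck_on_add) (assumption | erule spec)+

lemma smooth_on_sum: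
  "open S \<Longrightarrow> (\<And>i. i \<in> J \<Longrightarrow> smooth_on S (f i)) \<Longrightarrow> smooth_on S (\<lambda>x. \<Sum>i\<in>J. f i x)"
  unfolding smooth_on_def by (rule allI, rule Ck_on_sum) simp_all

lemma smooth_on_scaleR:
  "open S \<Longrightarrow> smooth_on S r \<Longrightarrow> smooth_on S f \<Longrightarrow> smooth_on S (\<lambda>x. r x *\<^sub>R f x)"
  unfolding smooth_on_def by (rule allI, rule Ck_on_scaleR) (assumption | erule spec)+

lemma smooth_on_mult:
  fixes f g :: "'a::euclidean_space \<Rightarrow> real"
  shows "open S \<Longrightarrow> smooth_on S f \<Longrightarrow> smooth_on S g \<Longrightarrow> smooth_on S (\<lambda>x. f x * g x)"
  using smooth_on_scaleR[of S f g] by simp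

lemma smooth_on_minus:
  assumes "open S" "smooth_on S f" "smooth_on S g"
  shows "smooth_on S (\<lambda>x. f x - g x)"
  using smooth_on_add[OF assms(1,2) smooth_on_bounded_linear[OF bounded_linear_minus[OF bounded_linear_ident] assms(1,3)]]
  by simp

lemma smooth_on_compose:
  "open S \<Longrightarrow> open T \<Longrightarrow> smooth_on T f \<Longrightarrow> smooth_on S g \<Longrightarrow> g ` S \<subseteq> T \<Longrightarrow> smooth_on S (\<lambda>x. f (g x))"
  unfolding smooth_on_def by (rule allI, rule Ck_on_compose) (assumption | erule spec)+

lemma smooth_on_powr:
  fixes f :: "'a::euclidean_space \<Rightarrow> real"
  assumes "open S" "smooth_on S f" "\<And>x. x \<in> S \<Longrightarrow> 0 < f x"
  shows "smooth_on S (\<lambda>x. f x powr a)"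
proof (rule smooth_on_compose[OF assms(1) _ _ assms(2), where f="\<lambda>x. x powr a" and T="{0<..}"])
  show "open {0::real<..}" by simp
  show "smooth_on {0<..} (\<lambda>x::real. x powr a)" using Ck_on_powr by (simp add: smooth_on_def)
  show "f ` S \<subseteq> {0<..}" using assms(3) by auto
qed

lemma smooth_on_continuous: "smooth_on S f \<Longrightarrow> continuous_on S f"
  unfolding smooth_on_def by (drule spec[of _ 0]) simp

lemma smooth_on_has_derivative:
  "smooth_on S f \<Longrightarrow> x \<in> S \<Longrightarrow> (f has_derivative frechet_derivative f (at x)) (at x)"
  unfolding smooth_on_def by (blast intro: Ck_on_has_derivative[of 0])

lemma smooth_on_differentiable: "smooth_on S f \<Longrightarrow> x \<in> S \<Longrightarrow> f differentiable (at x)"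
  using smooth_on_has_derivative differentiableI by blast

lemma smooth_on_frechet_derivative:
  "smooth_on S f \<Longrightarrow> smooth_on S (\<lambda>x. frechet_derivative f (at x) v)"
  unfolding smooth_on_def by (blast intro: Ck_on_frechet_derivative)

text \<open>The second difference is a difference of \<open>a \<mapsto> f(x + a v + s w) - f(x + a v)\<close>. The mean value theorem in
  \<open>a\<close>, followed by the one in \<open>b\<close>, turns it into a mixed second derivative. Since the second difference
  is symmetric in \<open>v\<close> and \<open>w\<close>, this also represents it by the derivative in the opposite order.\<close>

lemma second_difference_mean_value:
  fixes f :: "'a::euclidean_space \<Rightarrow> real"
  assumes smooth: "smooth_on S f" and "0 < s"
    and S: "\<And>a b. \<lbrakk>0 \<le> a; a \<le> s; 0 \<le> b; b \<le> s\<rbrakk> \<Longrightarrow> x + a *\<^sub>R v + b *\<^sub>R w \<in> S"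
  obtains a b where "0 \<le> a" "a \<le> s" "0 \<le> b" "b \<le> s"
    "f (x + s *\<^sub>R v + s *\<^sub>R w) - f (x + s *\<^sub>R v) - f (x + s *\<^sub>R w) + f x =
     s * s * frechet_derivative (\<lambda>y. frechet_derivative f (at y) v) (at (x + a *\<^sub>R v + b *\<^sub>R w)) w"
proof -
  define Df where "Df = (\<lambda>y. frechet_derivative f (at y) v)"
  define D2 where "D2 = (\<lambda>y. frechet_derivative Df (at y) w)"
  have Dv: "((\<lambda>a. f (x + a *\<^sub>R v + b *\<^sub>R w)) has_real_derivative Df (x + a *\<^sub>R v + b *\<^sub>R w)) (at a)"
    if "0 \<le> a" "a \<le> s" "0 \<le> b" "b \<le> s" for a b
  proof -
    have f: "(f has_derivative frechet_derivative f (at (x + a *\<^sub>R v + b *\<^sub>R w))) (at (x + a *\<^sub>R v + b *\<^sub>R w))"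
      using smooth S[OF that] smooth_on_has_derivative by blast
    have "((\<lambda>a. x + a *\<^sub>R v + b *\<^sub>R w) has_derivative (\<lambda>t. t *\<^sub>R v)) (at a)"
      by (auto intro!: derivative_eq_intros)
    from has_derivative_compose[OF this f]
    have "((\<lambda>a. f (x + a *\<^sub>R v + b *\<^sub>R w)) has_derivative
        (\<lambda>t. frechet_derivative f (at (x + a *\<^sub>R v + b *\<^sub>R w)) (t *\<^sub>R v))) (at a)"
      .
    then show ?thesis
      unfolding has_field_derivative_def Df_def
      using linear_cmul[OF has_derivative_linear[OF f]] by (simp add: mult.commute[of _ "frechet_derivative f _ v"])
  qed
  have Dw: "((\<lambda>b. Df (x + a *\<^sub>R v + b *\<^sub>R w)) has_real_derivative D2 (x + a *\<^sub>R v + b *\<^sub>R w)) (at b)"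
    if "0 \<le> a" "a \<le> s" "0 \<le> b" "b \<le> s" for a b
  proof -
    have f: "(Df has_derivative frechet_derivative Df (at (x + a *\<^sub>R v + b *\<^sub>R w))) (at (x + a *\<^sub>R v + b *\<^sub>R w))"
      using smooth_on_frechet_derivative[OF smooth] S[OF that] smooth_on_has_derivative unfolding Df_def by blast
    have "((\<lambda>b. x + a *\<^sub>R v + b *\<^sub>R w) has_derivative (\<lambda>t. t *\<^sub>R w)) (at b)"
      by (auto intro!: derivative_eq_intros)
    from has_derivative_compose[OF this f]
    have "((\<lambda>b. Df (x + a *\<^sub>R v + b *\<^sub>R w)) has_derivative
        (\<lambda>t. frechet_derivative Df (at (x + a *\<^sub>R v + b *\<^sub>R w)) (t *\<^sub>R w))) (at b)"
      .
    then show ?thesis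
      unfolding has_field_derivative_def D2_def
      using linear_cmul[OF has_derivative_linear[OF f]] by (simp add: mult.commute[of _ "frechet_derivative Df _ w"])
  qed
  have "\<exists>a>0. a < s \<and> (f (x + s *\<^sub>R v + s *\<^sub>R w) - f (x + s *\<^sub>R v + 0 *\<^sub>R w)) -
      (f (x + 0 *\<^sub>R v + s *\<^sub>R w) - f (x + 0 *\<^sub>R v + 0 *\<^sub>R w)) =
      (s - 0) * (Df (x + a *\<^sub>R v + s *\<^sub>R w) - Df (x + a *\<^sub>R v + 0 *\<^sub>R w))"
    by (rule MVT2[OF \<open>0 < s\<close>], rule DERIV_diff[OF Dv Dv]) (use \<open>0 < s\<close> in auto)
  then obtain a where a: "a > 0" "a < s" and 1: "(f (x + s *\<^sub>R v + s *\<^sub>R w) - f (x + s *\<^sub>R v + 0 *\<^sub>R w)) -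
      (f (x + 0 *\<^sub>R v + s *\<^sub>R w) - f (x + 0 *\<^sub>R v + 0 *\<^sub>R w)) =
      (s - 0) * (Df (x + a *\<^sub>R v + s *\<^sub>R w) - Df (x + a *\<^sub>R v + 0 *\<^sub>R w))" by blast
  have "\<exists>b>0. b < s \<and> Df (x + a *\<^sub>R v + s *\<^sub>R w) - Df (x + a *\<^sub>R v + 0 *\<^sub>R w) =
      (s - 0) * D2 (x + a *\<^sub>R v + b *\<^sub>R w)"
    by (rule MVT2[OF \<open>0 < s\<close>], rule Dw) (use a in auto)
  then obtain b where b: "b > 0" "b < s" and 2: "Df (x + a *\<^sub>R v + s *\<^sub>R w) - Df (x + a *\<^sub>R v + 0 *\<^sub>R w) =
      (s - 0) * D2 (x + a *\<^sub>R v + b *\<^sub>R w)" by blast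
  have "f (x + s *\<^sub>R v + s *\<^sub>R w) - f (x + s *\<^sub>R v) - f (x + s *\<^sub>R w) + f x = s * s * D2 (x + a *\<^sub>R v + b *\<^sub>R w)"
    using 1 2 by simp
  then show ?thesis using that[of a b] a b unfolding D2_def Df_def by simp
qed

text \<open>Both orders of differentiation give the same second difference up to the choice of the
  intermediate point, and these points converge to \<open>x\<close> as the step width \<open>s\<close> tends to \<open>0\<close>.\<close>

lemma second_derivative_symmetric_real:
  fixes f :: "'a::euclidean_space \<Rightarrow> real"
  assumes smooth: "smooth_on S f" and "open S" "x \<in> S"
  shows "frechet_derivative (\<lambda>y. frechet_derivative f (at y) v) (at x) w =
         frechet_derivative (\<lambda>y. frechet_derivative f (at y) w) (at x) v"
proof -
  define P where "P = (\<lambda>y. frechet_derivative (\<lambda>y. frechet_derivative f (at y) v) (at y) w)"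
  define Q where "Q = (\<lambda>y. frechet_derivative (\<lambda>y. frechet_derivative f (at y) w) (at y) v)"
  have cont: "isCont P x" "isCont Q x"
    using smooth_on_continuous[OF smooth_on_frechet_derivative[OF smooth_on_frechet_derivative[OF smooth]]]
      assms(2,3) unfolding P_def Q_def by (auto simp: continuous_on_eq_continuous_at)
  have "\<bar>P x - Q x\<bar> < 2 * e" if "e > 0" for e
  proof -
    from cont(1) \<open>e > 0\<close> obtain d1 where d1: "d1 > 0" "\<And>y. dist y x < d1 \<Longrightarrow> dist (P y) (P x) < e"
      unfolding continuous_at_eps_delta by blast
    from cont(2) \<open>e > 0\<close> obtain d2 where d2: "d2 > 0" "\<And>y. dist y x < d2 \<Longrightarrow> dist (Q y) (Q x) < e"
      unfolding continuous_at_eps_delta by blast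
    obtain d3 where d3: "d3 > 0" "ball x d3 \<subseteq> S"
      using assms(2,3) open_contains_ball by blast
    define d where "d = min d1 (min d2 d3)"
    have d: "d > 0" using d1 d2 d3 by (simp add: d_def)
    define s where "s = d / (2 * (norm v + norm w + 1))"
    have s: "s > 0" using d by (simp add: s_def add_nonneg_pos)
    have near: "dist (x + a *\<^sub>R v + b *\<^sub>R w) x < d" if "0 \<le> a" "a \<le> s" "0 \<le> b" "b \<le> s" for a b
    proof -
      have "norm (a *\<^sub>R v + b *\<^sub>R w) \<le> a * norm v + b * norm w"
        using norm_triangle_ineq[of "a *\<^sub>R v" "b *\<^sub>R w"] that by simp
      also have "\<dots> \<le> s * norm v + s * norm w"
        using that by (intro add_mono mult_right_mono) auto
      also have "\<dots> \<le> s * (norm v + norm w + 1)" using s by (simp add: algebra_simps)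
      also have "\<dots> = d / 2"
      proof -
        have "norm v + norm w + 1 \<noteq> 0" using norm_ge_zero[of v] norm_ge_zero[of w] by linarith
        then show ?thesis unfolding s_def by (metis nonzero_mult_divide_mult_cancel_right times_divide_eq_left)
      qed
      also have "\<dots> < d" using d by simp
      finally show ?thesis by (simp add: dist_norm add.assoc)
    qed
    have S: "x + a *\<^sub>R v + b *\<^sub>R w \<in> S" "x + a *\<^sub>R w + b *\<^sub>R v \<in> S" if "0 \<le> a" "a \<le> s" "0 \<le> b" "b \<le> s" for a b
    proof -
      show "x + a *\<^sub>R v + b *\<^sub>R w \<in> S"
        using near[OF that] d3 by (force simp: d_def dist_commute)
      show "x + a *\<^sub>R w + b *\<^sub>R v \<in> S"
        using near[OF that(3,4,1,2)] d3 by (force simp: d_def dist_commute add_ac)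
    qed
    obtain a b where ab: "0 \<le> a" "a \<le> s" "0 \<le> b" "b \<le> s"
      "f (x + s *\<^sub>R v + s *\<^sub>R w) - f (x + s *\<^sub>R v) - f (x + s *\<^sub>R w) + f x = s * s * P (x + a *\<^sub>R v + b *\<^sub>R w)"
      unfolding P_def by (rule second_difference_mean_value[where x=x and v=v and w=w, OF smooth s S(1)])
    obtain a' b' where ab': "0 \<le> a'" "a' \<le> s" "0 \<le> b'" "b' \<le> s"
      "f (x + s *\<^sub>R w + s *\<^sub>R v) - f (x + s *\<^sub>R w) - f (x + s *\<^sub>R v) + f x = s * s * Q (x + a' *\<^sub>R w + b' *\<^sub>R v)"
      unfolding Q_def by (rule second_difference_mean_value[where x=x and v=w and w=v, OF smooth s S(2)])
    have "s * s * P (x + a *\<^sub>R v + b *\<^sub>R w) = s * s * Q (x + a' *\<^sub>R w + b' *\<^sub>R v)"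
    proof -
      have "x + s *\<^sub>R w + s *\<^sub>R v = x + s *\<^sub>R v + s *\<^sub>R w" by (simp add: add_ac)
      with ab(5) ab'(5) show ?thesis by (simp only:)
    qed
    then have "P (x + a *\<^sub>R v + b *\<^sub>R w) = Q (x + b' *\<^sub>R v + a' *\<^sub>R w)"
      using s by (simp add: add_ac)
    moreover have "dist (P (x + a *\<^sub>R v + b *\<^sub>R w)) (P x) < e"
      using d1(2) near[OF ab(1-4)] by (simp add: d_def)
    moreover have "dist (Q (x + b' *\<^sub>R v + a' *\<^sub>R w)) (Q x) < e"
      using d2(2) near[OF ab'(3,4,1,2)] by (simp add: d_def)
    ultimately show ?thesis unfolding dist_real_def by linarith
  qed
  from this[of "\<bar>P x - Q x\<bar> / 2"] have "P x = Q x" by auto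
  then show ?thesis by (simp add: P_def Q_def)
qed

lemma second_derivative_symmetric:
  fixes f :: "'a::euclidean_space \<Rightarrow> 'b::euclidean_space"
  assumes "smooth_on S f" "open S" "x \<in> S"
  shows "frechet_derivative (\<lambda>y. frechet_derivative f (at y) v) (at x) w =
         frechet_derivative (\<lambda>y. frechet_derivative f (at y) w) (at x) v"
proof (rule euclidean_eqI)
  fix b :: 'b
  have 1: "frechet_derivative (\<lambda>y. f y \<bullet> b) (at y) v = frechet_derivative f (at y) v \<bullet> b" if "y \<in> S" for y v
    using frechet_derivative_at[OF has_derivative_inner_left[OF smooth_on_has_derivative[OF assms(1) that]]]
    by metis
  have 2: "frechet_derivative (\<lambda>y. frechet_derivative (\<lambda>y. f y \<bullet> b) (at y) v) (at x) w =
      frechet_derivative (\<lambda>y. frechet_derivative f (at y) v) (at x) w \<bullet> b" for v w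
  proof -
    have "((\<lambda>y. frechet_derivative f (at y) v \<bullet> b) has_derivative
        (\<lambda>w. frechet_derivative (\<lambda>y. frechet_derivative f (at y) v) (at x) w \<bullet> b)) (at x)"
      by (rule has_derivative_inner_left[OF smooth_on_has_derivative[OF smooth_on_frechet_derivative[OF assms(1)] assms(3)]])
    then have "((\<lambda>y. frechet_derivative (\<lambda>y. f y \<bullet> b) (at y) v) has_derivative
        (\<lambda>w. frechet_derivative (\<lambda>y. frechet_derivative f (at y) v) (at x) w \<bullet> b)) (at x)"
      by (rule has_derivative_transform_within_open[OF _ assms(2,3)]) (simp add: 1)
    then show ?thesis using frechet_derivative_at by metis
  qed
  have "smooth_on S (\<lambda>y. f y \<bullet> b)"
    by (rule smooth_on_bounded_linear[OF bounded_linear_inner_left assms(2,1)])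
  from second_derivative_symmetric_real[OF this assms(2,3), of v w]
  show "frechet_derivative (\<lambda>y. frechet_derivative f (at y) v) (at x) w \<bullet> b =
        frechet_derivative (\<lambda>y. frechet_derivative f (at y) w) (at x) v \<bullet> b"
    by (simp add: 2)
qed

section \<open>A minimum principle\<close>

lemma second_derivative_test_real:
  fixes f f' :: "real \<Rightarrow> real"
  assumes "0 < d" "\<And>t. \<bar>t\<bar> < d \<Longrightarrow> (f has_real_derivative f' t) (at t)"
    "(f' has_real_derivative l) (at 0)" "\<And>t. \<bar>t\<bar> < d \<Longrightarrow> f 0 \<le> f t"
  shows "f' 0 = 0" "0 \<le> l"
proof -
  show f'0: "f' 0 = 0"
    by (rule DERIV_local_min[OF assms(2) \<open>0 < d\<close>]) (use assms in auto)
  show "0 \<le> l"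
  proof (rule ccontr)
    assume "\<not> 0 \<le> l"
    then obtain d' where d': "d' > 0" "\<And>h. 0 < h \<Longrightarrow> h < d' \<Longrightarrow> f' h < 0"
      using DERIV_neg_dec_right[OF assms(3)] f'0 by auto
    define h where "h = min d d' / 2"
    have h: "0 < h" "h < d" "h < d'" using d' assms(1) by (auto simp: h_def)
    have "\<exists>z>0. z < h \<and> f h - f 0 = (h - 0) * f' z"
      by (rule MVT2[OF h(1)], rule assms(2)) (use h in auto)
    then obtain z where z: "0 < z" "z < h" "f h - f 0 = h * f' z" by auto
    have "h * f' z < 0" using d'(2)[of z] z h by (simp add: mult_pos_neg)
    moreover have "f 0 \<le> f h" using assms(4)[of h] h by simp
    ultimately show False using z(3) by linarith
  qed
qed

text \<open>If \<open>\<epsilon>\<close> is small, then \<open>u - \<epsilon> \<phi>\<close> with \<open>\<phi>(y) = exp(\<alpha> b\<cdot>(y - z\<^sub>0))\<close> is still smaller at the centre than on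
  the sphere, so it has an interior minimum \<open>z\<close>. There \<open>Du = \<epsilon> D\<phi>\<close> and \<open>D\<^sup>2u \<ge> \<epsilon> D\<^sup>2\<phi>\<close>. The second derivative of \<open>\<phi>\<close>
  carries a factor \<open>\<alpha>\<^sup>2\<close> and the first only \<open>\<alpha>\<close>, which contradicts the differential inequality for large \<open>\<alpha>\<close>.

  The inequality is only required in the form of a bound by every \<open>M\<close> that dominates \<open>Du(z)\<close>. Ellipticity
  enters through the direction \<open>b\<close> alone, because \<open>\<phi>\<close> varies in this direction only.\<close>

theorem no_strict_interior_minimum:
  fixes u :: "'a::euclidean_space \<Rightarrow> real" and z\<^sub>0 b :: 'a and r c C :: real
  assumes "smooth_on S u" "cball z\<^sub>0 r \<subseteq> S" "0 < r" "norm b = 1" "0 < c" "0 \<le> C"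
    and strict: "\<And>y. y \<in> cball z\<^sub>0 r \<Longrightarrow> y \<noteq> z\<^sub>0 \<Longrightarrow> u z\<^sub>0 < u y"
    and elliptic: "\<And>z M. \<lbrakk>z \<in> ball z\<^sub>0 r; 0 \<le> M; \<And>v. \<bar>frechet_derivative u (at z) v\<bar> \<le> M * norm v\<rbrakk> \<Longrightarrow>
      \<exists>e :: 'k::finite \<Rightarrow> 'a. c \<le> (\<Sum>k\<in>UNIV. (b \<bullet> e k)\<^sup>2) \<and>
        (\<Sum>k\<in>UNIV. frechet_derivative (\<lambda>y. frechet_derivative u (at y) (e k)) (at z) (e k)) \<le> C * (M + M\<^sup>2)"
  shows False
proof -
  \<comment> \<open>the inequality at the minimum of the comparison function will read \<open>\<alpha> c \<le> 2 C\<close>\<close>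
  define \<alpha> where "\<alpha> = (2 * C + 1) / c"
  have \<alpha>: "0 < \<alpha>" using assms(5,6) by (simp add: \<alpha>_def)
  define \<phi> where "\<phi> = (\<lambda>y. exp (\<alpha> * (b \<bullet> (y - z\<^sub>0))))"
  have \<phi>_pos: "0 < \<phi> y" for y by (simp add: \<phi>_def)
  have \<phi>_le: "\<phi> y \<le> exp (\<alpha> * r)" if "y \<in> cball z\<^sub>0 r" for y
  proof -
    have "b \<bullet> (y - z\<^sub>0) \<le> norm b * norm (y - z\<^sub>0)" by (rule norm_cauchy_schwarz)
    also have "\<dots> \<le> r" using that \<open>norm b = 1\<close> by (simp add: dist_norm norm_minus_commute)
    finally show ?thesis using \<alpha> by (simp add: \<phi>_def)
  qed
  have contu: "continuous_on (cball z\<^sub>0 r) u"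
    using smooth_on_continuous[OF assms(1)] assms(2) by (rule continuous_on_subset)
  have "z\<^sub>0 + r *\<^sub>R b \<in> sphere z\<^sub>0 r" using \<open>norm b = 1\<close> \<open>0 < r\<close> by (simp add: dist_norm)
  then have ne: "sphere z\<^sub>0 r \<noteq> {}" by blast
  have "continuous_on (sphere z\<^sub>0 r) u"
    using contu by (rule continuous_on_subset) (simp add: sphere_cball)
  then obtain y\<^sub>0 where y0: "y\<^sub>0 \<in> sphere z\<^sub>0 r" "\<And>y. y \<in> sphere z\<^sub>0 r \<Longrightarrow> u y\<^sub>0 \<le> u y"
    using continuous_attains_inf[OF compact_sphere ne] by blast
  have gap: "u z\<^sub>0 < u y\<^sub>0"
    using strict[of y\<^sub>0] y0(1) \<open>0 < r\<close> by auto
  \<comment> \<open>the first entry keeps the minimum away from the sphere, the second makes \<open>|Du| \<le> 1\<close> at the minimum, so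
    that \<open>|Du|\<^sup>2 \<le> |Du|\<close> there\<close>
  define \<epsilon> where "\<epsilon> = min ((u y\<^sub>0 - u z\<^sub>0) / 2) (1 / \<alpha>) / exp (\<alpha> * r)"
  have \<epsilon>: "0 < \<epsilon>" using gap \<alpha> by (simp add: \<epsilon>_def)
  have \<epsilon>1: "\<epsilon> * exp (\<alpha> * r) < u y\<^sub>0 - u z\<^sub>0" and \<epsilon>2: "\<epsilon> * exp (\<alpha> * r) \<le> 1 / \<alpha>"
    using gap by (simp_all add: \<epsilon>_def min_def)
  define w where "w = (\<lambda>y. u y - \<epsilon> * \<phi> y)"
  have "continuous_on (cball z\<^sub>0 r) w"
    unfolding w_def \<phi>_def by (intro continuous_intros contu)
  then obtain z where z: "z \<in> cball z\<^sub>0 r" "\<And>y. y \<in> cball z\<^sub>0 r \<Longrightarrow> w z \<le> w y"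
    using continuous_attains_inf[OF compact_cball, of z\<^sub>0 r w] \<open>0 < r\<close> by fastforce
  have "z \<notin> sphere z\<^sub>0 r"
  proof
    assume "z \<in> sphere z\<^sub>0 r"
    then have "u y\<^sub>0 \<le> u z" by (rule y0(2))
    moreover have "\<epsilon> * \<phi> z \<le> \<epsilon> * exp (\<alpha> * r)" using \<phi>_le[OF z(1)] \<epsilon> by simp
    moreover have "w z \<le> w z\<^sub>0" using z(2) \<open>0 < r\<close> by simp
    moreover have "w z\<^sub>0 < u z\<^sub>0" using \<epsilon> by (simp add: w_def \<phi>_def)
    ultimately show False using \<epsilon>1 unfolding w_def by linarith
  qed
  then have zball: "z \<in> ball z\<^sub>0 r" using z(1) by (simp add: less_le)
  then obtain d where d: "0 < d" "ball z d \<subseteq> ball z\<^sub>0 r"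
    using open_contains_ball open_ball by blast
  define D2 where "D2 = (\<lambda>e. frechet_derivative (\<lambda>y. frechet_derivative u (at y) e) (at z) e)"
  define a where "a = \<epsilon> * \<phi> z"
  have a: "0 < a" "a * \<alpha> \<le> 1"
  proof -
    show "0 < a" using \<epsilon> \<phi>_pos by (simp add: a_def)
    have "a \<le> \<epsilon> * exp (\<alpha> * r)" using \<phi>_le[OF z(1)] \<epsilon> by (simp add: a_def)
    then have "a \<le> 1 / \<alpha>" using \<epsilon>2 by linarith
    then show "a * \<alpha> \<le> 1" using \<alpha> by (simp add: pos_le_divide_eq)
  qed
  have test: "frechet_derivative u (at z) e = a * \<alpha> * (b \<bullet> e)" "a * \<alpha>\<^sup>2 * (b \<bullet> e)\<^sup>2 \<le> D2 e" for e
  proof -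
    define \<delta> where "\<delta> = d / (norm e + 1)"
    have \<delta>: "0 < \<delta>" using d by (simp add: \<delta>_def add_nonneg_pos)
    have line: "z + t *\<^sub>R e \<in> ball z\<^sub>0 r" if "\<bar>t\<bar> < \<delta>" for t
    proof -
      have "\<bar>t\<bar> * norm e \<le> \<bar>t\<bar> * (norm e + 1)" by (simp add: mult_left_mono)
      also have "\<dots> < d"
        using that norm_ge_zero[of e] unfolding \<delta>_def by (simp add: pos_less_divide_eq add_nonneg_pos)
      finally have "z + t *\<^sub>R e \<in> ball z d" by (simp add: dist_norm)
      then show ?thesis using d(2) by blast
    qed
    have lineS: "z + t *\<^sub>R e \<in> S" if "\<bar>t\<bar> < \<delta>" for t
      using line[OF that] assms(2) ball_subset_cball by blast
    have dline: "((\<lambda>t. z + t *\<^sub>R e) has_derivative (\<lambda>s. s *\<^sub>R e)) (at t)" for t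
      by (auto intro!: derivative_eq_intros)
    have d\<phi>: "((\<lambda>t. \<phi> (z + t *\<^sub>R e)) has_real_derivative \<alpha> * (b \<bullet> e) * \<phi> (z + t *\<^sub>R e)) (at t)" for t
      unfolding \<phi>_def by (auto intro!: derivative_eq_intros simp: inner_add_right inner_diff_right)
    have du: "((\<lambda>t. u (z + t *\<^sub>R e)) has_real_derivative frechet_derivative u (at (z + t *\<^sub>R e)) e) (at t)"
      if "\<bar>t\<bar> < \<delta>" for t
    proof -
      have f: "(u has_derivative frechet_derivative u (at (z + t *\<^sub>R e))) (at (z + t *\<^sub>R e))"
        by (rule smooth_on_has_derivative[OF assms(1) lineS[OF that]])
      show ?thesis
        using has_derivative_compose[OF dline f] linear_cmul[OF has_derivative_linear[OF f]]
        by (simp add: has_field_derivative_def mult.commute[of _ "frechet_derivative u _ e"])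
    qed
    have ddu: "((\<lambda>t. frechet_derivative u (at (z + t *\<^sub>R e)) e) has_real_derivative D2 e) (at 0)"
    proof -
      have "z \<in> S" using zball assms(2) ball_subset_cball by blast
      then have f: "((\<lambda>y. frechet_derivative u (at y) e) has_derivative
          frechet_derivative (\<lambda>y. frechet_derivative u (at y) e) (at z)) (at (z + 0 *\<^sub>R e))"
        using smooth_on_has_derivative[OF smooth_on_frechet_derivative[OF assms(1)]] by simp
      show ?thesis
        using has_derivative_compose[OF dline f] linear_cmul[OF has_derivative_linear[OF f]]
        by (simp add: has_field_derivative_def D2_def mult.commute[of _ "frechet_derivative _ _ e"])
    qed
    let ?f' = "\<lambda>t. frechet_derivative u (at (z + t *\<^sub>R e)) e - \<epsilon> * (\<alpha> * (b \<bullet> e) * \<phi> (z + t *\<^sub>R e))"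
    have 1: "((\<lambda>t. w (z + t *\<^sub>R e)) has_real_derivative ?f' t) (at t)" if "\<bar>t\<bar> < \<delta>" for t
      unfolding w_def by (intro DERIV_diff du[OF that] DERIV_cmult d\<phi>)
    have 2: "(?f' has_real_derivative D2 e - \<epsilon> * (\<alpha> * (b \<bullet> e) * (\<alpha> * (b \<bullet> e) * \<phi> (z + 0 *\<^sub>R e)))) (at 0)"
      by (intro DERIV_diff ddu DERIV_cmult d\<phi>)
    have 3: "w (z + 0 *\<^sub>R e) \<le> w (z + t *\<^sub>R e)" if "\<bar>t\<bar> < \<delta>" for t
      using z(2)[of "z + t *\<^sub>R e"] line[OF that] by simp
    show "frechet_derivative u (at z) e = a * \<alpha> * (b \<bullet> e)" "a * \<alpha>\<^sup>2 * (b \<bullet> e)\<^sup>2 \<le> D2 e"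
      using second_derivative_test_real[OF \<delta> 1 2 3]
      by (simp_all add: a_def power2_eq_square mult_ac)
  qed
  have "\<bar>frechet_derivative u (at z) v\<bar> \<le> a * \<alpha> * norm v" for v
    using test(1)[of v] Cauchy_Schwarz_ineq2[of b v] \<open>norm b = 1\<close> a \<alpha>
    by (simp add: abs_mult)
  from elliptic[OF zball _ this] obtain e :: "'k \<Rightarrow> 'a"
    where e: "c \<le> (\<Sum>k\<in>UNIV. (b \<bullet> e k)\<^sup>2)" "(\<Sum>k\<in>UNIV. D2 (e k)) \<le> C * (a * \<alpha> + (a * \<alpha>)\<^sup>2)"
    using a \<alpha> unfolding D2_def by auto
  have "a * \<alpha>\<^sup>2 * c \<le> a * \<alpha>\<^sup>2 * (\<Sum>k\<in>UNIV. (b \<bullet> e k)\<^sup>2)"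
    using e(1) a by (intro mult_left_mono) auto
  also have "\<dots> \<le> (\<Sum>k\<in>UNIV. D2 (e k))"
    unfolding sum_distrib_left by (intro sum_mono test(2))
  also have "\<dots> \<le> C * (a * \<alpha> + (a * \<alpha>)\<^sup>2)" by (rule e(2))
  also have "\<dots> \<le> C * (2 * (a * \<alpha>))"
    using a \<alpha> \<open>0 \<le> C\<close> by (intro mult_left_mono) (auto simp: power2_eq_square mult_left_le)
  finally have "(a * \<alpha>) * (\<alpha> * c) \<le> (a * \<alpha>) * (2 * C)"
    by (simp add: power2_eq_square mult_ac)
  then have "\<alpha> * c \<le> 2 * C" using a \<alpha> by (simp add: mult_le_cancel_left)
  then show False using \<open>0 < c\<close> by (simp add: \<alpha>_def)
qed

section \<open>The Levi-Civita connection of a field of bilinear forms\<close>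

text \<open>The components of a metric in one chart. Being nondegenerate is the only requirement on the
  signature, so that the locale covers the Lorentzian metric of the spacetime and the Riemannian metric
  of the surface.\<close>

locale metric_field =
  fixes S :: "'e::euclidean_space set" and m :: "'e \<Rightarrow> 'e \<Rightarrow> 'e \<Rightarrow> real"
  assumes open_S: "open S"
    and bilin: "z \<in> S \<Longrightarrow> bilinear (m z)"
    and sym: "z \<in> S \<Longrightarrow> m z u v = m z v u"
    and nondegenerate: "z \<in> S \<Longrightarrow> (\<And>v. m z u v = 0) \<Longrightarrow> u = 0"
    and differentiable: "z \<in> S \<Longrightarrow> (\<lambda>y. m y u v) differentiable (at z)"
begin

definition dm :: "'e \<Rightarrow> 'e \<Rightarrow> 'e \<Rightarrow> 'e \<Rightarrow> real" where
  "dm z u v w = frechet_derivative (\<lambda>y. m y v w) (at z) u"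

lemma dm_has_derivative: "z \<in> S \<Longrightarrow> ((\<lambda>y. m y v w) has_derivative (\<lambda>u. dm z u v w)) (at z)"
  unfolding dm_def by (simp only: frechet_derivative_works[symmetric] differentiable)

lemma dm_eqI:
  assumes "z \<in> S" "\<And>y. y \<in> S \<Longrightarrow> m y v w = f y" "(f has_derivative f') (at z)"
  shows "dm z u v w = f' u"
proof -
  have "((\<lambda>y. m y v w) has_derivative f') (at z)"
    by (rule has_derivative_transform_within_open[OF assms(3) open_S assms(1)]) (simp add: assms(2))
  from has_derivative_unique[OF this dm_has_derivative[OF assms(1)]] show ?thesis by simp
qed

lemma m_linear:
  assumes "z \<in> S"
  shows "m z (x + y) w = m z x w + m z y w" "m z w (x + y) = m z w x + m z w y"
    "m z (x - y) w = m z x w - m z y w" "m z w (x - y) = m z w x - m z w y"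
    "m z (r *\<^sub>R x) w = r * m z x w" "m z w (r *\<^sub>R x) = r * m z w x"
  using bilinear_ladd[OF bilin[OF assms]] bilinear_radd[OF bilin[OF assms]]
    bilinear_lsub[OF bilin[OF assms]] bilinear_rsub[OF bilin[OF assms]]
    bilinear_lmul[OF bilin[OF assms]] bilinear_rmul[OF bilin[OF assms]]
  by simp_all

lemma m_eqI:
  assumes "z \<in> S" "\<And>w. m z x w = m z y w"
  shows "x = y"
proof -
  have "x - y = 0"
    by (rule nondegenerate[OF assms(1)]) (simp add: m_linear assms)
  then show ?thesis by simp
qed

lemma m_Basis:
  assumes "z \<in> S"
  shows "m z a b = (\<Sum>i\<in>Basis. \<Sum>j\<in>Basis. (a \<bullet> i) * (b \<bullet> j) * m z i j)"
proof -
  have 1: "linear (\<lambda>a. m z a b)" "linear (\<lambda>b. m z a b)" for a b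
    using bilin[OF assms] by (auto simp: bilinear_def)
  have "m z a b = (\<Sum>i\<in>Basis. (a \<bullet> i) *\<^sub>R m z i b)"
    by (rule linear_Basis_expansion[OF 1(1)])
  also have "\<dots> = (\<Sum>i\<in>Basis. (a \<bullet> i) *\<^sub>R (\<Sum>j\<in>Basis. (b \<bullet> j) *\<^sub>R m z i j))"
    by (intro sum.cong refl arg_cong[where f="\<lambda>x. _ *\<^sub>R x"]) (rule linear_Basis_expansion[OF 1(2)])
  finally show ?thesis by (simp add: sum_distrib_left mult_ac)
qed

lemma dm_add:
  assumes "z \<in> S"
  shows "dm z (x + y) v w = dm z x v w + dm z y v w"
    "dm z u (x + y) w = dm z u x w + dm z u y w"
    "dm z u w (x + y) = dm z u w x + dm z u w y"
proof -
  show "dm z (x + y) v w = dm z x v w + dm z y v w"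
    using linear_add[OF has_derivative_linear[OF dm_has_derivative[OF assms]]] .
  show "dm z u (x + y) w = dm z u x w + dm z u y w"
    by (rule dm_eqI[OF assms m_linear(1)]) (auto intro: has_derivative_add dm_has_derivative[OF assms])
  show "dm z u w (x + y) = dm z u w x + dm z u w y"
    by (rule dm_eqI[OF assms m_linear(2)]) (auto intro: has_derivative_add dm_has_derivative[OF assms])
qed

lemma dm_scale:
  assumes "z \<in> S"
  shows "dm z (r *\<^sub>R x) v w = r * dm z x v w"
    "dm z u (r *\<^sub>R x) w = r * dm z u x w"
    "dm z u w (r *\<^sub>R x) = r * dm z u w x"
proof -
  show "dm z (r *\<^sub>R x) v w = r * dm z x v w"
    using linear_cmul[OF has_derivative_linear[OF dm_has_derivative[OF assms]]] by simp
  show "dm z u (r *\<^sub>R x) w = r * dm z u x w"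
    by (rule dm_eqI[OF assms m_linear(5)]) (auto intro: has_derivative_mult_right dm_has_derivative[OF assms])
  show "dm z u w (r *\<^sub>R x) = r * dm z u w x"
    by (rule dm_eqI[OF assms m_linear(6)]) (auto intro: has_derivative_mult_right dm_has_derivative[OF assms])
qed

lemma dm_sym: "z \<in> S \<Longrightarrow> dm z u v w = dm z u w v"
  by (rule dm_eqI[OF _ sym dm_has_derivative])

lemma dm_Basis:
  assumes "z \<in> S"
  shows "dm z u a b = (\<Sum>i\<in>Basis. \<Sum>j\<in>Basis. (a \<bullet> i) * (b \<bullet> j) * dm z u i j)"
  by (rule dm_eqI[OF assms m_Basis])
     (auto intro!: has_derivative_sum has_derivative_mult_right dm_has_derivative[OF assms])

definition levi_civita :: "'e \<Rightarrow> ('e \<Rightarrow> 'e \<Rightarrow> 'e) \<Rightarrow> bool" where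
  "levi_civita z \<Gamma> \<longleftrightarrow> bilinear \<Gamma> \<and> (\<forall>u v. \<Gamma> u v = \<Gamma> v u) \<and>
     (\<forall>u v w. dm z u v w = m z (\<Gamma> u v) w + m z v (\<Gamma> u w))"

lemma koszul:
  assumes "z \<in> S" "levi_civita z \<Gamma>"
  shows "2 * m z (\<Gamma> u v) w = dm z u v w + dm z v u w - dm z w u v"
proof -
  have "dm z u v w = m z (\<Gamma> u v) w + m z v (\<Gamma> u w)"
    "dm z v u w = m z (\<Gamma> v u) w + m z u (\<Gamma> v w)"
    "dm z w u v = m z (\<Gamma> w u) v + m z u (\<Gamma> w v)"
    "\<Gamma> v u = \<Gamma> u v" "\<Gamma> w u = \<Gamma> u w" "\<Gamma> w v = \<Gamma> v w"
    using assms(2) by (auto simp: levi_civita_def)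
  then show ?thesis using sym[OF assms(1), of v "\<Gamma> u w"] by simp
qed

text \<open>Nondegeneracy makes \<open>x \<mapsto> m z x\<close> an injective linear map into the dual space, which has the same
  dimension.\<close>

lemma riesz:
  assumes "z \<in> S" "linear f"
  shows "\<exists>x. \<forall>w. m z x w = f w"
proof -
  define L where "L = (\<lambda>x. \<Sum>b\<in>Basis. m z x b *\<^sub>R b)"
  have L_inner: "L x \<bullet> b = m z x b" if "b \<in> Basis" for x b
    using that by (simp add: L_def inner_sum_left_Basis)
  have eq: "m z x w = f w" if "\<And>b. b \<in> Basis \<Longrightarrow> m z x b = f b" "linear f"
    for x w and f :: "'e \<Rightarrow> real"
  proof -
    have "linear (m z x)" using bilin[OF assms(1)] by (simp add: bilinear_def)
    from linear_Basis_expansion[OF this, of w] linear_Basis_expansion[OF \<open>linear f\<close>, of w]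
    show ?thesis using that by simp
  qed
  have "linear L"
    by (rule linearI) (simp_all add: L_def m_linear assms(1) algebra_simps sum.distrib scaleR_sum_right)
  moreover have "inj L"
    unfolding linear_injective_0[OF \<open>linear L\<close>]
  proof (intro allI impI)
    fix x assume "L x = 0"
    then have "m z x b = 0" if "b \<in> Basis" for b using L_inner[OF that, of x] by simp
    then have "m z x w = 0" for w using eq[where x=x and f="\<lambda>_. 0" and w=w] linear_zero by simp
    then show "x = 0" by (rule nondegenerate[OF assms(1)])
  qed
  ultimately have "surj L" by (rule linear_inj_imp_surj)
  then obtain x where "(\<Sum>b\<in>Basis. f b *\<^sub>R b) = L x" by (rule surjE)
  note x = this[symmetric]
  have "m z x b = f b" if "b \<in> Basis" for b
    using L_inner[OF that, of x] that by (simp add: x inner_sum_left_Basis)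
  then have "m z x w = f w" for w by (rule eq[OF _ assms(2)])
  then show ?thesis by (intro exI allI)
qed

text \<open>The Koszul formula prescribes \<open>m z (\<Gamma> u v)\<close> as a functional that is built from derivatives of \<open>m\<close>. By
  nondegeneracy every functional has this form for exactly one vector. Hence the definite description in
  the definition of the Christoffel symbols refers to an actual object.\<close>

lemma levi_civita_exists:
  assumes z: "z \<in> S"
  shows "\<exists>!\<Gamma>. levi_civita z \<Gamma>"
proof -
  define K where "K = (\<lambda>u v w. (dm z u v w + dm z v u w - dm z w u v) / 2)"
  have "\<exists>x. \<forall>w. m z x w = K u v w" for u v
    by (rule riesz[OF z], rule linearI) (simp_all add: K_def dm_add dm_scale z field_simps)
  then obtain \<Gamma> where \<Gamma>: "m z (\<Gamma> u v) w = K u v w" for u v w by metis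
  have "\<Gamma> u v = \<Gamma> v u" for u v
    by (rule m_eqI[OF z]) (simp add: \<Gamma> K_def dm_sym[OF z, of _ u v])
  moreover have "linear (\<lambda>v. \<Gamma> u v)" for u
    by (rule linearI; rule m_eqI[OF z]) (simp_all add: m_linear z \<Gamma> K_def dm_add dm_scale field_simps)
  moreover have "dm z u v w = m z (\<Gamma> u v) w + m z v (\<Gamma> u w)" for u v w
    using sym[OF z, of v] dm_sym[OF z, of u v w] dm_sym[OF z, of v u w] dm_sym[OF z, of w u v]
    by (simp add: \<Gamma> K_def field_simps)
  ultimately have "levi_civita z \<Gamma>" by (simp add: levi_civita_def bilinear_def)
  moreover have "\<Gamma>' = \<Gamma>" if "levi_civita z \<Gamma>'" for \<Gamma>'
  proof (intro ext m_eqI[OF z])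
    fix u v w
    show "m z (\<Gamma>' u v) w = m z (\<Gamma> u v) w"
      using koszul[OF z that, of u v w] koszul[OF z \<open>levi_civita z \<Gamma>\<close>, of u v w] by simp
  qed
  ultimately show ?thesis by blast
qed

text \<open>The product rule for a bilinear form whose coefficients vary. The form is expanded in a basis because
  it is only differentiable in its base point for fixed arguments.\<close>

lemma m_compose_has_derivative:
  fixes \<Psi> :: "'d::euclidean_space \<Rightarrow> 'e"
  assumes "open T" "z \<in> T" "\<Psi> ` T \<subseteq> S"
    and \<Psi>: "(\<Psi> has_derivative \<Psi>') (at z)"
    and A: "(A has_derivative A') (at z)"
    and B: "(B has_derivative B') (at z)"
  shows "((\<lambda>y. m (\<Psi> y) (A y) (B y)) has_derivative
    (\<lambda>x. m (\<Psi> z) (A' x) (B z) + m (\<Psi> z) (A z) (B' x) + dm (\<Psi> z) (\<Psi>' x) (A z) (B z))) (at z)"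
proof -
  have S: "\<Psi> y \<in> S" if "y \<in> T" for y using that assms(3) by blast
  have dm: "((\<lambda>y. m (\<Psi> y) i j) has_derivative (\<lambda>x. dm (\<Psi> z) (\<Psi>' x) i j)) (at z)" for i j
    using has_derivative_compose[OF \<Psi> dm_has_derivative[OF S[OF assms(2)]]] .
  have "((\<lambda>y. \<Sum>i\<in>Basis. \<Sum>j\<in>Basis. (A y \<bullet> i) * (B y \<bullet> j) * m (\<Psi> y) i j) has_derivative
      (\<lambda>x. \<Sum>i\<in>Basis. \<Sum>j\<in>Basis. (A z \<bullet> i) * (B z \<bullet> j) * dm (\<Psi> z) (\<Psi>' x) i j +
         ((A z \<bullet> i) * (B' x \<bullet> j) + (A' x \<bullet> i) * (B z \<bullet> j)) * m (\<Psi> z) i j)) (at z)"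
    by (intro has_derivative_sum has_derivative_mult has_derivative_inner_left A B dm)
  also have "(\<lambda>x. \<Sum>i\<in>Basis. \<Sum>j\<in>Basis. (A z \<bullet> i) * (B z \<bullet> j) * dm (\<Psi> z) (\<Psi>' x) i j +
         ((A z \<bullet> i) * (B' x \<bullet> j) + (A' x \<bullet> i) * (B z \<bullet> j)) * m (\<Psi> z) i j) =
    (\<lambda>x. m (\<Psi> z) (A' x) (B z) + m (\<Psi> z) (A z) (B' x) + dm (\<Psi> z) (\<Psi>' x) (A z) (B z))"
    by (subst (1 2) m_Basis[OF S[OF assms(2)]], subst dm_Basis[OF S[OF assms(2)]])
       (simp add: sum.distrib distrib_right add_ac)
  finally show ?thesis
    by (rule has_derivative_transform_within_open[OF _ assms(1,2)])
       (simp add: m_Basis[OF S, symmetric])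
qed

text \<open>The Christoffel symbols of a pulled back metric are the tangential part of \<open>D\<^sup>2\<Psi> + \<Gamma>(D\<Psi>, D\<Psi>)\<close>. Both sides are
  Koszul expressions, and the terms with second derivatives of \<open>\<Psi>\<close> agree by their symmetry. The right-hand
  side refers to \<open>h\<close> alone, and this makes it independent of the coordinates in the target.\<close>

lemma pullback_koszul:
  fixes \<Psi> :: "'d::euclidean_space \<Rightarrow> 'e"
  assumes T: "open T" "z \<in> T" "\<Psi> ` T \<subseteq> S" and smooth: "smooth_on T \<Psi>"
    and h: "\<And>y u v. y \<in> T \<Longrightarrow> h y u v = m (\<Psi> y) (frechet_derivative \<Psi> (at y) u) (frechet_derivative \<Psi> (at y) v)"
    and \<Gamma>: "levi_civita (\<Psi> z) \<Gamma>"
  shows "m (\<Psi> z) (frechet_derivative (\<lambda>y. frechet_derivative \<Psi> (at y) e) (at z) e +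
      \<Gamma> (frechet_derivative \<Psi> (at z) e) (frechet_derivative \<Psi> (at z) e)) (frechet_derivative \<Psi> (at z) w) =
    frechet_derivative (\<lambda>y. h y e w) (at z) e - frechet_derivative (\<lambda>y. h y e e) (at z) w / 2"
proof -
  define P where "P = frechet_derivative \<Psi> (at z)"
  define D2 where "D2 = (\<lambda>u x. frechet_derivative (\<lambda>y. frechet_derivative \<Psi> (at y) u) (at z) x)"
  have D2_app: "frechet_derivative (\<lambda>y. frechet_derivative \<Psi> (at y) u) (at z) x = D2 u x" for u x
    by (simp add: D2_def)
  have S: "\<Psi> z \<in> S" using T by blast
  have D2: "((\<lambda>y. frechet_derivative \<Psi> (at y) u) has_derivative D2 u) (at z)" for u
    unfolding D2_def by (rule smooth_on_has_derivative[OF smooth_on_frechet_derivative[OF smooth] T(2)])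
  have H: "((\<lambda>y. h y u v) has_derivative
      (\<lambda>x. m (\<Psi> z) (D2 u x) (P v) + m (\<Psi> z) (P u) (D2 v x) + dm (\<Psi> z) (P x) (P u) (P v))) (at z)" for u v
    using m_compose_has_derivative[OF T smooth_on_has_derivative[OF smooth T(2)] D2 D2, folded P_def]
    by (rule has_derivative_transform_within_open[OF _ T(1,2)]) (simp add: h)
  have dh: "frechet_derivative (\<lambda>y. h y u v) (at z) x =
      m (\<Psi> z) (D2 u x) (P v) + m (\<Psi> z) (P u) (D2 v x) + dm (\<Psi> z) (P x) (P u) (P v)" for u v x
    by (simp add: frechet_derivative_at[OF H, symmetric])
  have "D2 w e = D2 e w"
    unfolding D2_def by (rule second_derivative_symmetric[OF smooth T(1,2)])
  moreover have "2 * m (\<Psi> z) (\<Gamma> (P e) (P e)) (P w) =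
      2 * dm (\<Psi> z) (P e) (P e) (P w) - dm (\<Psi> z) (P w) (P e) (P e)"
    using koszul[OF S \<Gamma>] by simp
  moreover have "m (\<Psi> z) (D2 e w) (P e) = m (\<Psi> z) (P e) (D2 e w)"
    by (rule sym[OF S])
  ultimately show ?thesis
    unfolding P_def[symmetric] D2_app dh by (simp add: m_linear(1)[OF S] field_simps)
qed

end

section \<open>Tangent vectors and differentials in charts\<close>

text \<open>The properties of a smooth atlas that tangent vectors depend on. They pass to the product atlas of
  \<open>I \<times> F\<close> without reference to the topology of the manifold.\<close>

locale atlas =
  fixes A :: "('m, 'e::euclidean_space) chart set"
  assumes inj_coord: "c \<in> A \<Longrightarrow> inj_on (coord c) (chart_dom c)"
    and open_overlap: "c \<in> A \<Longrightarrow> c' \<in> A \<Longrightarrow> open (coord c ` (chart_dom c \<inter> chart_dom c'))"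
    and transition_differentiable: "c \<in> A \<Longrightarrow> c' \<in> A \<Longrightarrow> z \<in> coord c ` (chart_dom c \<inter> chart_dom c') \<Longrightarrow>
      (coord c' \<circ> param c) differentiable (at z)"
begin

lemma param_coord: "c \<in> A \<Longrightarrow> x \<in> chart_dom c \<Longrightarrow> param c (coord c x) = x"
  by (simp add: param_def inj_coord inv_into_f_f)

lemma open_chart_img: "c \<in> A \<Longrightarrow> open (chart_img c)"
  using open_overlap[of c c] by simp

lemma charts_atD:
  assumes "c \<in> charts_at A p"
  shows "c \<in> A" "p \<in> chart_dom c" "coord c p \<in> chart_img c" "param c (coord c p) = p"
  using assms param_coord[of c p] by (simp_all add: charts_at_def)

lemma chart_change_has_derivative:
  assumes c: "c \<in> charts_at A p" and c': "c' \<in> charts_at A p"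
    and f: "(f \<circ> param c) differentiable (at (coord c p))"
  shows "((f \<circ> param c') has_derivative
      (\<lambda>v. frechet_derivative (f \<circ> param c) (at (coord c p))
             (frechet_derivative (coord c \<circ> param c') (at (coord c' p)) v))) (at (coord c' p))"
proof -
  note c = charts_atD[OF c] and c' = charts_atD[OF c']
  let ?U = "coord c' ` (chart_dom c' \<inter> chart_dom c)"
  have U: "open ?U" "coord c' p \<in> ?U"
    using open_overlap c c' by auto
  have 1: "((coord c \<circ> param c') has_derivative frechet_derivative (coord c \<circ> param c') (at (coord c' p)))
      (at (coord c' p))"
    using transition_differentiable[OF c'(1) c(1) U(2)] by (simp only: frechet_derivative_works)
  have "((f \<circ> param c) has_derivative frechet_derivative (f \<circ> param c) (at (coord c p)))
      (at ((coord c \<circ> param c') (coord c' p)))"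
    using f c'(4) by (simp add: frechet_derivative_works[symmetric])
  from has_derivative_compose[OF 1 this]
  show ?thesis
    by (rule has_derivative_transform_within_open[OF _ U]) (auto simp: param_coord c(1) c'(1))
qed

lemma chart_change_derivative:
  assumes "c \<in> charts_at A p" "c' \<in> charts_at A p" "(f \<circ> param c) differentiable (at (coord c p))"
  shows "frechet_derivative (f \<circ> param c') (at (coord c' p)) v =
    frechet_derivative (f \<circ> param c) (at (coord c p))
      (frechet_derivative (coord c \<circ> param c') (at (coord c' p)) v)"
  by (rule fun_cong[OF frechet_derivative_at[OF chart_change_has_derivative[OF assms]], symmetric])

lemma transition_differentiable_at:
  "c \<in> charts_at A p \<Longrightarrow> c' \<in> charts_at A p \<Longrightarrow> (coord c' \<circ> param c) differentiable (at (coord c p))"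
  by (rule transition_differentiable) (auto simp: charts_at_def)

text \<open>The chart that Hilbert's choice selects in the definition may be replaced by any other chart.\<close>

lemma directional_derivative_eq:
  assumes v: "v \<in> tangent_space A p" and c: "c \<in> charts_at A p"
    and f: "(f \<circ> param c) differentiable (at (coord c p))"
  shows "directional_derivative A f p v = frechet_derivative (f \<circ> param c) (at (coord c p)) (v c)"
proof -
  define c\<^sub>0 where "c\<^sub>0 = (SOME c. c \<in> charts_at A p)"
  have c0: "c\<^sub>0 \<in> charts_at A p" unfolding c\<^sub>0_def by (rule someI[of _ c], rule c)
  have "v c = frechet_derivative (coord c \<circ> param c\<^sub>0) (at (coord c\<^sub>0 p)) (v c\<^sub>0)"
    using v c c0 unfolding tangent_space_def by blast
  then show ?thesis
    unfolding directional_derivative_def Let_def c\<^sub>0_def[symmetric]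
    by (simp add: chart_change_derivative[OF c c0 f])
qed

lemma tangent_of_self:
  assumes "c \<in> charts_at A p"
  shows "tangent_of A c p e c = e"
proof -
  note c = charts_atD[OF assms]
  have "((coord c \<circ> param c) has_derivative (\<lambda>v. v)) (at (coord c p))"
    by (rule has_derivative_transform_within_open[OF has_derivative_ident open_chart_img[OF c(1)] c(3)])
       (auto simp: param_coord c(1))
  from frechet_derivative_at[OF this] show ?thesis
    using assms by (simp add: tangent_of_def fun_eq_iff)
qed

lemma tangent_of_in_tangent_space:
  assumes c: "c \<in> charts_at A p"
  shows "tangent_of A c p e \<in> tangent_space A p"
  unfolding tangent_space_def
proof (intro CollectI conjI ballI allI impI)
  fix c' c'' assume *: "c' \<in> charts_at A p" "c'' \<in> charts_at A p"
  show "tangent_of A c p e c'' =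
      frechet_derivative (coord c'' \<circ> param c') (at (coord c' p)) (tangent_of A c p e c')"
    using * chart_change_derivative[OF *(1) c transition_differentiable_at[OF *]]
    by (simp add: tangent_of_def)
qed (simp add: tangent_of_def)

lemma tangent_of_coordinates:
  assumes "v \<in> tangent_space A p" "c \<in> charts_at A p"
  shows "tangent_of A c p (v c) = v"
proof
  fix c'
  have "c' \<in> charts_at A p \<Longrightarrow> v c' = frechet_derivative (coord c' \<circ> param c) (at (coord c p)) (v c)"
    "c' \<notin> charts_at A p \<Longrightarrow> v c' = 0"
    using assms unfolding tangent_space_def by blast+
  then show "tangent_of A c p (v c) c' = v c'" by (simp add: tangent_of_def)
qed

lemma tangent_of_linear:
  assumes "c \<in> charts_at A p"
  shows "tangent_of A c p (r *\<^sub>R u + s *\<^sub>R v) = (\<lambda>c'. r *\<^sub>R tangent_of A c p u c' + s *\<^sub>R tangent_of A c p v c')"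
proof
  fix c'
  show "tangent_of A c p (r *\<^sub>R u + s *\<^sub>R v) c' = r *\<^sub>R tangent_of A c p u c' + s *\<^sub>R tangent_of A c p v c'"
  proof (cases "c' \<in> charts_at A p")
    case True
    have "(coord c' \<circ> param c has_derivative frechet_derivative (coord c' \<circ> param c) (at (coord c p))) (at (coord c p))"
      using transition_differentiable_at[OF assms True] by (simp only: frechet_derivative_works)
    from has_derivative_linear[OF this] show ?thesis
      using True by (simp add: tangent_of_def linear_add linear_cmul)
  qed (simp add: tangent_of_def)
qed

lemma tangent_of_eq_zero_iff:
  assumes "c \<in> charts_at A p"
  shows "tangent_of A c p e = zero_tangent \<longleftrightarrow> e = 0"
proof
  assume "tangent_of A c p e = zero_tangent"
  then have "tangent_of A c p e c = 0" by (simp add: zero_tangent_def)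
  then show "e = 0" using tangent_of_self[OF assms] by simp
next
  assume "e = 0"
  then show "tangent_of A c p e = zero_tangent"
    using tangent_of_linear[OF assms, of 0 e 0 e] by (simp add: zero_tangent_def)
qed

lemma tangent_space_charts_eqI:
  assumes "u \<in> tangent_space A p" "v \<in> tangent_space A p" "c \<in> charts_at A p" "u c = v c"
  shows "u = v"
proof -
  have "u = tangent_of A c p (u c)" by (rule tangent_of_coordinates[OF assms(1,3), symmetric])
  also have "\<dots> = tangent_of A c p (v c)" by (simp only: assms(4))
  also have "\<dots> = v" by (rule tangent_of_coordinates[OF assms(2,3)])
  finally show ?thesis .
qed

lemma bilinear_metric_comp:
  assumes c: "c \<in> charts_at A p" and g: "symmetric_bilinear_on (tangent_space A p) (g p)"
  shows "bilinear (metric_comp A g c (coord c p))"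
    "metric_comp A g c (coord c p) u v = metric_comp A g c (coord c p) v u"
proof -
  note cp = charts_atD(4)[OF c]
  note T = tangent_of_in_tangent_space[OF c]
  show sym: "metric_comp A g c (coord c p) u v = metric_comp A g c (coord c p) v u" for u v
    using g T unfolding metric_comp_def cp symmetric_bilinear_on_def by blast
  have "g p (\<lambda>c'. r *\<^sub>R tangent_of A c p u c' + s *\<^sub>R tangent_of A c p v c') (tangent_of A c p w) =
      r * g p (tangent_of A c p u) (tangent_of A c p w) + s * g p (tangent_of A c p v) (tangent_of A c p w)"
    for u v w r s
    using g T unfolding symmetric_bilinear_on_def by blast
  then have lin: "metric_comp A g c (coord c p) (r *\<^sub>R u + s *\<^sub>R v) w =
      r * metric_comp A g c (coord c p) u w + s * metric_comp A g c (coord c p) v w" for u v w r s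
    unfolding metric_comp_def cp tangent_of_linear[OF c] .
  have l: "linear (\<lambda>u. metric_comp A g c (coord c p) u w)" for w
    using lin[of 1 _ 1 _ w] lin[of _ _ 0 0 w] by (intro linearI) simp_all
  have eq: "metric_comp A g c (coord c p) v = (\<lambda>u. metric_comp A g c (coord c p) u v)" for v
    by (rule ext, rule sym)
  have r: "linear (metric_comp A g c (coord c p) v)" for v
    by (rule ssubst[OF eq, where P=linear], rule l)
  show "bilinear (metric_comp A g c (coord c p))"
    unfolding bilinear_def
  proof (intro conjI allI)
    show "linear (\<lambda>y. metric_comp A g c (coord c p) x y)" for x by (rule r)
    show "linear (\<lambda>x. metric_comp A g c (coord c p) x y)" for y by (rule l)
  qed
qed

end

lemma atlas_smooth_manifold:
  assumes "smooth_manifold M A"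
  shows "atlas A"
proof
  have *: "openin (top_of_set M) (chart_dom c)" "open (chart_img c)"
    "homeomorphism (chart_dom c) (chart_img c) (coord c) (param c)" if "c \<in> A" for c
    using assms that unfolding smooth_manifold_def by blast+
  show "inj_on (coord c) (chart_dom c)" if "c \<in> A" for c
    using *(3)[OF that] by (metis homeomorphism_apply1 inj_on_inverseI)
  show o: "open (coord c ` (chart_dom c \<inter> chart_dom c'))" if "c \<in> A" "c' \<in> A" for c c'
  proof -
    have "openin (top_of_set M) (chart_dom c \<inter> chart_dom c')"
      using *(1) that by (simp add: openin_Int)
    then have "openin (top_of_set (chart_dom c)) (chart_dom c \<inter> chart_dom c')"
      using openin_subset_trans[of M "chart_dom c \<inter> chart_dom c'" "chart_dom c"] openin_imp_subset[OF *(1)[OF that(1)]] by simp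
    from homeomorphism_imp_open_map[OF *(3)[OF that(1)] this]
    show ?thesis using *(2)[OF that(1)] by (meson openin_open_trans)
  qed
  show "(coord c' \<circ> param c) differentiable (at z)"
    if "c \<in> A" "c' \<in> A" "z \<in> coord c ` (chart_dom c \<inter> chart_dom c')" for c c' z
    by (rule smooth_on_differentiable[OF _ that(3)])
       (use assms that(1,2) in \<open>simp add: smooth_manifold_def\<close>)
qed

text \<open>In each chart \<open>c'\<close> of the target this is the chain rule for the coordinate change from \<open>c\<close> to \<open>c'\<close>. The set
  \<open>T\<close> ensures that the coordinates \<open>c\<close> are available in a neighbourhood of the point.\<close>

lemma differential_eq:
  assumes "atlas B" "atlas A" and d: "d \<in> charts_at B q" and c: "c \<in> charts_at A (\<psi> q)"
    and T: "open T" "coord d q \<in> T" "\<And>z. z \<in> T \<Longrightarrow> \<psi> (param d z) \<in> chart_dom c"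
    and diff: "(coord c \<circ> \<psi> \<circ> param d) differentiable (at (coord d q))"
    and v: "v \<in> tangent_space B q"
  shows "differential B A \<psi> q v =
    tangent_of A c (\<psi> q) (frechet_derivative (coord c \<circ> \<psi> \<circ> param d) (at (coord d q)) (v d))"
proof
  interpret B: atlas B by fact
  interpret A: atlas A by fact
  fix c'
  show "differential B A \<psi> q v c' =
    tangent_of A c (\<psi> q) (frechet_derivative (coord c \<circ> \<psi> \<circ> param d) (at (coord d q)) (v d)) c'"
  proof (cases "c' \<in> charts_at A (\<psi> q)")
    case c': True
    let ?P = "coord c \<circ> \<psi> \<circ> param d"
    have P: "(?P has_derivative frechet_derivative ?P (at (coord d q))) (at (coord d q))"
      using diff by (simp only: frechet_derivative_works)
    have "(coord c' \<circ> param c has_derivative frechet_derivative (coord c' \<circ> param c) (at (coord c (\<psi> q))))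
        (at (?P (coord d q)))"
      using A.transition_differentiable_at[OF c c'] B.charts_atD(4)[OF d]
      by (simp add: frechet_derivative_works[symmetric])
    from has_derivative_compose[OF P this]
    have der: "((coord c' \<circ> \<psi> \<circ> param d) has_derivative
        (\<lambda>v. frechet_derivative (coord c' \<circ> param c) (at (coord c (\<psi> q))) (frechet_derivative ?P (at (coord d q)) v)))
        (at (coord d q))"
      by (rule has_derivative_transform_within_open[OF _ T(1,2)])
         (simp add: A.param_coord[OF A.charts_atD(1)[OF c] T(3)])
    from frechet_derivative_at[OF this] B.directional_derivative_eq[OF v d differentiableI[OF der]]
    show ?thesis using c' by (simp add: differential_def tangent_of_def fun_eq_iff)
  qed (simp add: differential_def tangent_of_def)
qed

lemma smooth_map_chart:
  assumes B: "smooth_manifold UNIV B" and \<psi>: "smooth_map UNIV B M A \<psi>"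
    and d: "d \<in> B" and c: "c \<in> A" "open (chart_dom c)"
  shows "open (coord d ` (chart_dom d \<inter> \<psi> -` chart_dom c))"
    "smooth_on (coord d ` (chart_dom d \<inter> \<psi> -` chart_dom c)) (coord c \<circ> \<psi> \<circ> param d)"
proof -
  have *: "open (chart_img d)" "homeomorphism (chart_dom d) (chart_img d) (coord d) (param d)"
    using B d unfolding smooth_manifold_def by blast+
  have "continuous_on UNIV \<psi>" using \<psi> by (simp add: smooth_map_def)
  then have "open (\<psi> -` chart_dom c)" using c(2) by (simp add: open_vimage)
  then have "openin (top_of_set (chart_dom d)) (chart_dom d \<inter> \<psi> -` chart_dom c)"
    by (simp add: openin_open_Int)
  from homeomorphism_imp_open_map[OF *(2) this] *(1)
  show "open (coord d ` (chart_dom d \<inter> \<psi> -` chart_dom c))" by (meson openin_open_trans)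
  show "smooth_on (coord d ` (chart_dom d \<inter> \<psi> -` chart_dom c)) (coord c \<circ> \<psi> \<circ> param d)"
    using \<psi> d c(1) by (simp add: smooth_map_def)
qed

section \<open>Split metrics and their Christoffel symbols\<close>

lemma metric_field_riemannian:
  assumes "atlas A" "riemannian_metric M A g" "c \<in> A" "chart_dom c \<subseteq> M"
  shows "metric_field (chart_img c) (metric_comp A g c)"
    and "z \<in> chart_img c \<Longrightarrow> v \<noteq> 0 \<Longrightarrow> 0 < metric_comp A g c z v v"
proof -
  interpret atlas A by fact
  have c: "c \<in> charts_at A (param c z)" "coord c (param c z) = z" "param c z \<in> M" if "z \<in> chart_img c" for z
    using that assms(3,4) param_coord[OF assms(3)] by (auto simp: charts_at_def)
  have g: "symmetric_bilinear_on (tangent_space A p) (g p)"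
    "v \<in> tangent_space A p \<Longrightarrow> v \<noteq> zero_tangent \<Longrightarrow> 0 < g p v v" if "p \<in> M" for p v
    using assms(2) that unfolding riemannian_metric_def by blast+
  show pos: "0 < metric_comp A g c z v v" if "z \<in> chart_img c" "v \<noteq> 0" for z v
    using g(2)[OF c(3)[OF that(1)] tangent_of_in_tangent_space[OF c(1)[OF that(1)]]]
      tangent_of_eq_zero_iff[OF c(1)[OF that(1)]] that(2)
    unfolding metric_comp_def by blast
  show "metric_field (chart_img c) (metric_comp A g c)"
  proof
    show "open (chart_img c)" by (rule open_chart_img[OF assms(3)])
    show "bilinear (metric_comp A g c z)" if "z \<in> chart_img c" for z
      using bilinear_metric_comp(1)[where g=g, OF c(1)[OF that] g(1)[OF c(3)[OF that]]] c(2)[OF that] by simp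
    show "metric_comp A g c z u v = metric_comp A g c z v u" if "z \<in> chart_img c" for z u v
      using bilinear_metric_comp(2)[where g=g and u=u and v=v, OF c(1)[OF that] g(1)[OF c(3)[OF that]]] c(2)[OF that] by simp
    show "u = 0" if "z \<in> chart_img c" "\<And>v. metric_comp A g c z u v = 0" for z u
      using pos[OF that(1), of u] that(2)[of u] by (cases "u = 0") simp_all
    show "(\<lambda>y. metric_comp A g c y u v) differentiable at z" if "z \<in> chart_img c" for z u v
      by (rule smooth_on_differentiable[OF _ that])
         (use assms(2,3) in \<open>simp add: riemannian_metric_def\<close>)
  qed
qed

definition split_chart :: "real set \<Rightarrow> ('f, 'e) chart \<Rightarrow> (real \<times> 'f, real \<times> 'e) chart" where
  "split_chart I c = (I \<times> chart_dom c, \<lambda>(t, x). (t, coord c x))"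

lemma split_atlas_eq: "split_atlas I A = split_chart I ` A"
  by (simp add: split_atlas_def split_chart_def)

locale split = atlas A for A :: "('f, 'e::euclidean_space) chart set" +
  fixes I :: "real set"
  assumes open_I: "open I"
begin

lemma split_chart_simps [simp]:
  "chart_dom (split_chart I c) = I \<times> chart_dom c"
  "coord (split_chart I c) (t, x) = (t, coord c x)"
  by (simp_all add: split_chart_def)

lemma split_chart_img [simp]: "coord (split_chart I c) ` (I \<times> D) = I \<times> coord c ` D"
  by (force simp: split_chart_def)

lemma inj_split_coord: "c \<in> A \<Longrightarrow> inj_on (coord (split_chart I c)) (I \<times> chart_dom c)"
  using inj_coord[of c] by (auto simp: inj_on_def split_chart_def)

lemma param_split_chart:
  assumes "c \<in> A" "t \<in> I" "z \<in> chart_img c"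
  shows "param (split_chart I c) (t, z) = (t, param c z)"
proof -
  obtain x where x: "x \<in> chart_dom c" "z = coord c x" using assms(3) by blast
  have "param (split_chart I c) (coord (split_chart I c) (t, x)) = (t, x)"
    unfolding param_def split_chart_simps(1)
    by (rule inv_into_f_f[OF inj_split_coord[OF assms(1)]]) (use assms x in auto)
  then show ?thesis using x param_coord[OF assms(1)] by simp
qed

lemma atlas_split_atlas: "atlas (split_atlas I A)"
proof
  fix C assume "C \<in> split_atlas I A"
  then obtain c where c: "c \<in> A" "C = split_chart I c" by (auto simp: split_atlas_eq)
  show "inj_on (coord C) (chart_dom C)" using inj_split_coord[OF c(1)] c(2) by simp
  fix C' assume "C' \<in> split_atlas I A"
  then obtain c' where c': "c' \<in> A" "C' = split_chart I c'" by (auto simp: split_atlas_eq)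
  let ?U = "coord c ` (chart_dom c \<inter> chart_dom c')"
  have img: "coord C ` (chart_dom C \<inter> chart_dom C') = I \<times> ?U"
  proof -
    have "chart_dom C \<inter> chart_dom C' = I \<times> (chart_dom c \<inter> chart_dom c')" using c c' by auto
    then show ?thesis using c by simp
  qed
  have U: "open (I \<times> ?U)" using open_overlap[OF c(1) c'(1)] open_I by (rule open_Times[rotated])
  show "open (coord C ` (chart_dom C \<inter> chart_dom C'))" unfolding img by (rule U)
  fix p assume "p \<in> coord C ` (chart_dom C \<inter> chart_dom C')"
  then have p: "p \<in> I \<times> ?U" by (simp only: img)
  let ?t = "coord c' \<circ> param c"
  have "(?t has_derivative frechet_derivative ?t (at (snd p))) (at (snd p))"
    using transition_differentiable[OF c(1) c'(1), of "snd p"] p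
    by (simp add: frechet_derivative_works[symmetric] mem_Times_iff)
  from has_derivative_compose[OF has_derivative_snd[OF has_derivative_ident] this]
  have "((\<lambda>y. (fst y, ?t (snd y))) has_derivative (\<lambda>v. (fst v, frechet_derivative ?t (at (snd p)) (snd v)))) (at p)"
    by (intro has_derivative_Pair has_derivative_fst has_derivative_ident)
  then have "(coord C' \<circ> param C has_derivative (\<lambda>v. (fst v, frechet_derivative ?t (at (snd p)) (snd v)))) (at p)"
    by (rule has_derivative_transform_within_open[OF _ U p])
       (use c c' in \<open>auto simp: param_split_chart param_coord\<close>)
  then show "(coord C' \<circ> param C) differentiable (at p)" by (rule differentiableI)
qed

lemma charts_at_split_atlas:
  assumes "C \<in> charts_at (split_atlas I A) p"
  obtains c where "c \<in> charts_at A (snd p)" "C = split_chart I c" "fst p \<in> I"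
proof -
  from assms obtain c where "c \<in> A" "C = split_chart I c" "p \<in> chart_dom C"
    unfolding charts_at_def split_atlas_eq by blast
  then show ?thesis by (intro that[of c]) (auto simp: charts_at_def)
qed

lemma split_chart_in_charts_at:
  "c \<in> charts_at A x \<Longrightarrow> t \<in> I \<Longrightarrow> split_chart I c \<in> charts_at (split_atlas I A) (t, x)"
  by (simp add: charts_at_def split_atlas_eq)

text \<open>In the product chart the projections to \<open>I\<close> and to \<open>F\<close> are the coordinate projections, hence so are their
  differentials.\<close>

lemma split_metric_comp:
  assumes c: "c \<in> A" and t: "t \<in> I" and z: "z \<in> chart_img c"
  shows "metric_comp (split_atlas I A) (split_metric I A \<beta> g) (split_chart I c) (t, z) u w =
    - \<beta> (t, param c z) * fst u * fst w + metric_comp A (g t) c z (snd u) (snd w)"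
proof -
  interpret M: atlas "split_atlas I A" by (rule atlas_split_atlas)
  let ?C = "split_chart I c"
  define x where "x = param c z"
  have x: "c \<in> charts_at A x" "coord c x = z"
    using z param_coord[OF c] c by (auto simp: x_def charts_at_def)
  note C = split_chart_in_charts_at[OF x(1) t]
  have T: "open (I \<times> chart_img c)" "(t, z) \<in> I \<times> chart_img c"
    using open_I open_chart_img[OF c] t z by (auto intro: open_Times)
  have fst: "(fst \<circ> param ?C has_derivative fst) (at (t, z))"
    by (rule has_derivative_transform_within_open[OF has_derivative_fst[OF has_derivative_ident] T])
       (auto simp: param_split_chart c)
  have snd: "(coord c \<circ> snd \<circ> param ?C has_derivative snd) (at (t, z))"
    by (rule has_derivative_transform_within_open[OF has_derivative_snd[OF has_derivative_ident] T])
       (auto simp: param_split_chart c param_coord)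
  have 1: "directional_derivative (split_atlas I A) fst (t, x) (tangent_of (split_atlas I A) ?C (t, x) v) = fst v" for v
  proof -
    have "directional_derivative (split_atlas I A) fst (t, x) (tangent_of (split_atlas I A) ?C (t, x) v) =
        frechet_derivative (fst \<circ> param ?C) (at (coord ?C (t, x))) (tangent_of (split_atlas I A) ?C (t, x) v ?C)"
      by (rule M.directional_derivative_eq[OF M.tangent_of_in_tangent_space[OF C] C])
         (use fst x(2) in \<open>auto intro: differentiableI\<close>)
    then show ?thesis
      by (simp add: M.tangent_of_self[OF C] x(2) frechet_derivative_at[OF fst, symmetric])
  qed
  have 2: "differential (split_atlas I A) A snd (t, x) (tangent_of (split_atlas I A) ?C (t, x) v) =
      tangent_of A c x (snd v)" for v
  proof -
    have "differential (split_atlas I A) A snd (t, x) (tangent_of (split_atlas I A) ?C (t, x) v) =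
      tangent_of A c (snd (t, x)) (frechet_derivative (coord c \<circ> snd \<circ> param ?C) (at (coord ?C (t, x)))
        (tangent_of (split_atlas I A) ?C (t, x) v ?C))"
      by (rule differential_eq[OF atlas_split_atlas atlas_axioms C _ T(1) _ _ _ M.tangent_of_in_tangent_space[OF C]])
         (use x T(2) snd in \<open>auto simp: param_split_chart c param_coord intro: differentiableI\<close>)
    then show ?thesis
      by (simp add: M.tangent_of_self[OF C] x(2) frechet_derivative_at[OF snd, symmetric])
  qed
  show ?thesis
    unfolding metric_comp_def param_split_chart[OF c t z] x_def[symmetric] split_metric_def
    by (simp add: 1 2)
qed

text \<open>The metric of the spacetime only looks at the coordinates of its arguments in the chart that
  Hilbert's choice selects, so in that chart it is given by its components even for arguments that
  are not known to transform like tangent vectors.\<close>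

lemma split_metric_chosen_chart:
  assumes C: "C = (SOME C. C \<in> charts_at (split_atlas I A) p)" "C \<in> charts_at (split_atlas I A) p"
  shows "split_metric I A \<beta> g p a b =
    metric_comp (split_atlas I A) (split_metric I A \<beta> g) C (coord C p) (a C) (b C)"
proof -
  interpret M: atlas "split_atlas I A" by (rule atlas_split_atlas)
  have dd: "directional_derivative (split_atlas I A) f p (tangent_of (split_atlas I A) C p (v C)) =
      directional_derivative (split_atlas I A) f p v" for f :: "real \<times> 'f \<Rightarrow> 'b::euclidean_space" and v
    unfolding directional_derivative_def Let_def C(1)[symmetric] M.tangent_of_self[OF C(2)] ..
  have d: "differential (split_atlas I A) A snd p (tangent_of (split_atlas I A) C p (v C)) =
      differential (split_atlas I A) A snd p v" for v
    unfolding differential_def dd ..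
  show ?thesis
    unfolding metric_comp_def M.charts_atD(4)[OF C(2)] by (simp add: split_metric_def dd d)
qed

end

lemma deriv_eq_frechet_derivative_time:
  fixes f :: "real \<times> 'e::euclidean_space \<Rightarrow> real"
  assumes "f differentiable at (t, z)"
  shows "deriv (\<lambda>s. f (s, z)) t = frechet_derivative f (at (t, z)) (1, 0)"
proof -
  have f: "(f has_derivative frechet_derivative f (at (t, z))) (at (t, z))"
    using assms by (simp only: frechet_derivative_works)
  have "((\<lambda>s. (s, z)) has_derivative (\<lambda>s. (s, 0))) (at t)"
    by (intro has_derivative_Pair has_derivative_ident has_derivative_const)
  from has_derivative_compose[OF this f]
  have "((\<lambda>s. f (s, z)) has_derivative (\<lambda>s. frechet_derivative f (at (t, z)) (s, 0))) (at t)" .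
  moreover have "(\<lambda>s. frechet_derivative f (at (t, z)) (s, 0)) = (*) (frechet_derivative f (at (t, z)) (1, 0))"
  proof
    fix s :: real
    have "frechet_derivative f (at (t, z)) (s *\<^sub>R (1, 0)) = s *\<^sub>R frechet_derivative f (at (t, z)) (1, 0)"
      by (rule linear_cmul[OF has_derivative_linear[OF f]])
    then show "frechet_derivative f (at (t, z)) (s, 0) = frechet_derivative f (at (t, z)) (1, 0) * s"
      by (simp only: scaleR_Pair real_scaleR_def mult_1_left mult_1_right scaleR_zero_right mult.commute)
  qed
  ultimately have "((\<lambda>s. f (s, z)) has_real_derivative frechet_derivative f (at (t, z)) (1, 0)) (at t)"
    by (simp only: has_field_derivative_def)
  then show ?thesis by (rule DERIV_imp_deriv)
qed

locale splitted_spacetime =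
  fixes I :: "real set" and A :: "('f::{t2_space, second_countable_topology}, 'e::euclidean_space) chart set"
    and \<beta> :: "real \<times> 'f \<Rightarrow> real" and g :: "real \<Rightarrow> ('f, 'e) metric"
  assumes spacetime: "orthogonally_splitted_spacetime I A \<beta> g"
begin

sublocale split A I
  using spacetime unfolding orthogonally_splitted_spacetime_def
  by (intro split.intro atlas_smooth_manifold[where M=UNIV] split_axioms.intro) auto

abbreviation "AM \<equiv> split_atlas I A"
abbreviation "G \<equiv> split_metric I A \<beta> g"

lemma \<beta>_pos: "t \<in> I \<Longrightarrow> 0 < \<beta> (t, x)"
  using spacetime by (simp add: orthogonally_splitted_spacetime_def)

lemma \<beta>_smooth: "c \<in> A \<Longrightarrow> smooth_on (I \<times> chart_img c) (\<beta> \<circ> param (split_chart I c))"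
  using spacetime by (simp add: orthogonally_splitted_spacetime_def smooth_real_function_def split_atlas_eq)

lemma \<beta>_time_derivative:
  assumes c: "c \<in> A" and t: "t \<in> I" and z: "z \<in> chart_img c"
  shows "deriv (\<lambda>s. \<beta> (s, param c z)) t = frechet_derivative (\<beta> \<circ> param (split_chart I c)) (at (t, z)) (1, 0)"
proof -
  have "\<forall>\<^sub>F s in nhds t. s \<in> I" using open_I t by (rule eventually_nhds_in_open)
  then have "\<forall>\<^sub>F s in nhds t. \<beta> (s, param c z) = (\<beta> \<circ> param (split_chart I c)) (s, z)"
    by eventually_elim (simp add: param_split_chart[OF c _ z])
  then have "deriv (\<lambda>s. \<beta> (s, param c z)) t = deriv (\<lambda>s. (\<beta> \<circ> param (split_chart I c)) (s, z)) t"
    by (rule deriv_cong_ev) (rule refl)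
  also have "\<dots> = frechet_derivative (\<beta> \<circ> param (split_chart I c)) (at (t, z)) (1, 0)"
    by (rule deriv_eq_frechet_derivative_time, rule smooth_on_differentiable[OF \<beta>_smooth[OF c]]) (use t z in simp)
  finally show ?thesis .
qed

lemma g_riemannian: "t \<in> I \<Longrightarrow> riemannian_metric UNIV A (g t)"
  using spacetime by (simp add: orthogonally_splitted_spacetime_def smooth_family_of_riemannian_metrics_def)

lemma g_smooth: "c \<in> A \<Longrightarrow> smooth_on (I \<times> chart_img c) (\<lambda>y. metric_comp A (g (fst y)) c (snd y) u v)"
  using spacetime
  by (simp add: orthogonally_splitted_spacetime_def smooth_family_of_riemannian_metrics_def case_prod_unfold)

lemma g_metric_field:
  assumes "c \<in> A" "t \<in> I"
  shows "metric_field (chart_img c) (metric_comp A (g t) c)"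
    and "z \<in> chart_img c \<Longrightarrow> v \<noteq> 0 \<Longrightarrow> 0 < metric_comp A (g t) c z v v"
  using metric_field_riemannian[OF atlas_axioms g_riemannian assms(1)] assms(2) by simp_all

text \<open>Nondegeneracy: pairing \<open>u\<close> with \<open>\<partial>\<^sub>t\<close> gives \<open>- \<beta> dt(u)\<close>, and pairing it with its own \<open>F\<close>-component gives
  \<open>g\<^sub>t(u\<^sub>F, u\<^sub>F)\<close>.\<close>

lemma metric_field_spacetime:
  assumes c: "c \<in> A"
  shows "metric_field (I \<times> chart_img c) (metric_comp AM G (split_chart I c))"
proof
  let ?m = "metric_comp AM G (split_chart I c)"
  show open_T: "open (I \<times> chart_img c)" using open_I open_chart_img[OF c] by (rule open_Times)
  fix y assume y: "y \<in> I \<times> chart_img c"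
  then obtain t z where tz: "y = (t, z)" "t \<in> I" "z \<in> chart_img c" by auto
  interpret g: metric_field "chart_img c" "metric_comp A (g t) c" by (rule g_metric_field[OF c tz(2)])
  note m = split_metric_comp[OF c tz(2,3), of \<beta> g]
  show "bilinear (?m y)"
    unfolding bilinear_def tz(1)
    by (intro conjI allI linearI) (simp_all add: m g.m_linear[OF tz(3)] algebra_simps)
  show "?m y u v = ?m y v u" for u v
    unfolding tz(1) m using g.sym[OF tz(3), of "snd u" "snd v"] by simp
  show "u = 0" if "\<And>v. ?m y u v = 0" for u
  proof -
    have zero: "metric_comp A (g t) c z (snd u) 0 = 0" using g.m_linear(6)[OF tz(3), of "snd u" 0 0] by simp
    have "?m y u (1, 0) = 0" "?m y u (0, snd u) = 0" by (rule that)+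
    then have "fst u = 0" "metric_comp A (g t) c z (snd u) (snd u) = 0"
      using \<beta>_pos[OF tz(2), of "param c z"] unfolding tz(1) m by (simp_all add: zero)
    then show ?thesis
      using g_metric_field(2)[OF c tz(2,3), of "snd u"] by (metis less_irrefl prod_eqI fst_zero snd_zero)
  qed
  show "(\<lambda>y. ?m y u v) differentiable at y" for u v
  proof -
    have "((\<lambda>y. - (\<beta> \<circ> param (split_chart I c)) y * fst u * fst v + metric_comp A (g (fst y)) c (snd y) (snd u) (snd v))
        has_derivative (\<lambda>h. - frechet_derivative (\<beta> \<circ> param (split_chart I c)) (at y) h * fst u * fst v +
          frechet_derivative (\<lambda>y. metric_comp A (g (fst y)) c (snd y) (snd u) (snd v)) (at y) h)) (at y)"
      by (intro has_derivative_add has_derivative_mult_left has_derivative_minus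
          smooth_on_has_derivative[OF \<beta>_smooth[OF c] y] smooth_on_has_derivative[OF g_smooth[OF c] y])
    then have "((\<lambda>y. ?m y u v)
        has_derivative (\<lambda>h. - frechet_derivative (\<beta> \<circ> param (split_chart I c)) (at y) h * fst u * fst v +
          frechet_derivative (\<lambda>y. metric_comp A (g (fst y)) c (snd y) (snd u) (snd v)) (at y) h)) (at y)"
      by (rule has_derivative_transform_within_open[OF _ open_T y])
         (auto simp: split_metric_comp[OF c] param_split_chart[OF c])
    then show ?thesis by (rule differentiableI)
  qed
qed

lemma christoffel_levi_civita:
  assumes c: "c \<in> A" and y: "y \<in> I \<times> chart_img c"
  shows "metric_field.levi_civita (metric_comp AM G (split_chart I c)) y
    (christoffel AM G (split_chart I c) y)"
proof -
  interpret m: metric_field "I \<times> chart_img c" "metric_comp AM G (split_chart I c)"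
    by (rule metric_field_spacetime[OF c])
  show ?thesis
    using theI'[OF m.levi_civita_exists[OF y]]
    unfolding m.levi_civita_def m.dm_def christoffel_def .
qed

text \<open>The Koszul formula paired with \<open>\<partial>\<^sub>t\<close>, where \<open>G(\<Gamma>, \<partial>\<^sub>t) = - \<beta> dt(\<Gamma>)\<close> and \<open>G(w, \<partial>\<^sub>t) = - \<beta> dt(w)\<close>.\<close>

lemma christoffel_time_component:
  assumes c: "c \<in> A" and t: "t \<in> I" and z: "z \<in> chart_img c"
  shows "\<beta> (t, param c z) * fst (christoffel AM G (split_chart I c) (t, z) w w) =
    frechet_derivative (\<beta> \<circ> param (split_chart I c)) (at (t, z)) w * fst w
    - deriv (\<lambda>s. \<beta> (s, param c z)) t * (fst w)\<^sup>2 / 2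
    + deriv (\<lambda>s. g s (param c z) (tangent_of A c (param c z) (snd w)) (tangent_of A c (param c z) (snd w))) t / 2"
proof -
  let ?C = "split_chart I c"
  let ?m = "metric_comp AM G ?C"
  let ?b = "\<beta> \<circ> param ?C"
  let ?g = "\<lambda>y. metric_comp A (g (fst y)) c (snd y) (snd w) (snd w)"
  let ?T = "I \<times> chart_img c"
  interpret m: metric_field ?T ?m by (rule metric_field_spacetime[OF c])
  have y: "(t, z) \<in> ?T" using t z by simp
  have b: "(?b has_derivative frechet_derivative ?b (at (t, z))) (at (t, z))"
    by (rule smooth_on_has_derivative[OF \<beta>_smooth[OF c] y])
  have g: "(?g has_derivative frechet_derivative ?g (at (t, z))) (at (t, z))"
    by (rule smooth_on_has_derivative[OF g_smooth[OF c] y])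
  have zero: "metric_comp A (g s) c x v 0 = 0" if "s \<in> I" "x \<in> chart_img c" for s x v
    using metric_field.m_linear(6)[OF g_metric_field(1)[OF c that(1)] that(2), of v 0 0] by simp
  have m0: "?m (s, x) v (1, 0) = - ?b (s, x) * fst v" if "s \<in> I" "x \<in> chart_img c" for s x v
    using that by (simp add: split_metric_comp[OF c] zero param_split_chart[OF c])
  have 1: "m.dm (t, z) w w (1, 0) = - frechet_derivative ?b (at (t, z)) w * fst w"
  proof (rule m.dm_eqI[OF y, where f'="\<lambda>v. - frechet_derivative ?b (at (t, z)) v * fst w"])
    show "?m y w (1, 0) = - ?b y * fst w" if "y \<in> ?T" for y
      using m0 that by (cases y) auto
    show "((\<lambda>y. - ?b y * fst w) has_derivative (\<lambda>v. - frechet_derivative ?b (at (t, z)) v * fst w)) (at (t, z))"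
      by (intro has_derivative_mult_left has_derivative_minus b)
  qed
  have 2: "m.dm (t, z) (1, 0) w w =
      - frechet_derivative ?b (at (t, z)) (1, 0) * (fst w)\<^sup>2 + frechet_derivative ?g (at (t, z)) (1, 0)"
  proof (rule m.dm_eqI[OF y, where f'="\<lambda>v. - frechet_derivative ?b (at (t, z)) v * (fst w)\<^sup>2 + frechet_derivative ?g (at (t, z)) v"])
    show "?m y w w = - ?b y * (fst w)\<^sup>2 + ?g y" if "y \<in> ?T" for y
      using that by (cases y) (auto simp: split_metric_comp[OF c] param_split_chart[OF c] power2_eq_square)
    show "((\<lambda>y. - ?b y * (fst w)\<^sup>2 + ?g y) has_derivative
        (\<lambda>v. - frechet_derivative ?b (at (t, z)) v * (fst w)\<^sup>2 + frechet_derivative ?g (at (t, z)) v)) (at (t, z))"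
      by (intro has_derivative_add has_derivative_mult_left has_derivative_minus b g)
  qed
  note 3 = \<beta>_time_derivative[OF c t z]
  have 4: "deriv (\<lambda>s. g s (param c z) (tangent_of A c (param c z) (snd w)) (tangent_of A c (param c z) (snd w))) t =
      frechet_derivative ?g (at (t, z)) (1, 0)"
    using deriv_eq_frechet_derivative_time[OF differentiableI[OF g]] by (simp add: metric_comp_def)
  have "2 * ?m (t, z) (christoffel AM G ?C (t, z) w w) (1, 0) = 2 * m.dm (t, z) w w (1, 0) - m.dm (t, z) (1, 0) w w"
    using m.koszul[OF y christoffel_levi_civita[OF c y]] by simp
  then show ?thesis
    unfolding 1 2 3 4 m0[OF t z] by (simp add: param_split_chart[OF c t z] field_simps)
qed

end

section \<open>Local orthonormal frames on surfaces\<close>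

text \<open>In another chart the components are \<open>D\<rho>(F)\<close> for the coordinate change \<open>\<rho>\<close>, written out in a basis as a sum of
  products of smooth functions.\<close>

lemma smooth_vector_field_of_coordinates:
  assumes B: "smooth_manifold M B" and d: "d \<in> B" and F: "smooth_on (chart_img d) F"
  shows "smooth_vector_field_on B (chart_dom d) (\<lambda>x. tangent_of B d x (F (coord d x)))"
proof -
  interpret atlas B by (rule atlas_smooth_manifold[OF B])
  have smooth: "smooth_on (coord c ` (chart_dom c \<inter> chart_dom c')) (coord c' \<circ> param c)"
    if "c \<in> B" "c' \<in> B" for c c'
    using B that by (simp add: smooth_manifold_def)
  show ?thesis
    unfolding smooth_vector_field_on_def
  proof (intro conjI ballI)
    fix p assume "p \<in> chart_dom d"
    then show "tangent_of B d p (F (coord d p)) \<in> tangent_space B p"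
      by (intro tangent_of_in_tangent_space) (simp add: charts_at_def d)
  next
    fix c assume c: "c \<in> B"
    let ?V = "coord c ` (chart_dom c \<inter> chart_dom d)"
    let ?V' = "coord d ` (chart_dom d \<inter> chart_dom c)"
    let ?\<sigma> = "coord d \<circ> param c"
    let ?\<rho> = "coord c \<circ> param d"
    have V: "open ?V" "open ?V'" using open_overlap c d by blast+
    have img: "?\<sigma> ` ?V \<subseteq> ?V'" "?\<sigma> ` ?V \<subseteq> chart_img d"
      using param_coord[OF c] by auto
    have eq: "(\<Sum>b\<in>Basis. (F (?\<sigma> z) \<bullet> b) *\<^sub>R frechet_derivative ?\<rho> (at (?\<sigma> z)) b) =
        tangent_of B d (param c z) (F (coord d (param c z))) c" if z: "z \<in> ?V" for z
    proof -
      obtain x where x: "x \<in> chart_dom c" "x \<in> chart_dom d" "z = coord c x" using z by blast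
      then have px: "param c z = x" using param_coord[OF c] by simp
      have "(?\<rho> has_derivative frechet_derivative ?\<rho> (at (coord d x))) (at (coord d x))"
        by (rule smooth_on_has_derivative[OF smooth[OF d c]]) (use x in blast)
      from linear_Basis_expansion[OF has_derivative_linear[OF this], of "F (coord d x)"]
      show ?thesis using x(1,2) c by (simp add: px tangent_of_def charts_at_def x(3) param_coord[OF c x(1)])
    qed
    have "smooth_on ?V (\<lambda>z. \<Sum>b\<in>Basis. (F (?\<sigma> z) \<bullet> b) *\<^sub>R frechet_derivative ?\<rho> (at (?\<sigma> z)) b)"
    proof (rule smooth_on_sum[OF V(1)], rule smooth_on_scaleR[OF V(1)])
      fix b
      have "smooth_on ?V (\<lambda>z. F (?\<sigma> z))"
        by (rule smooth_on_compose[OF V(1) open_chart_img[OF d] F smooth[OF c d] img(2)])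
      then show "smooth_on ?V (\<lambda>z. F (?\<sigma> z) \<bullet> b)"
        by (rule smooth_on_bounded_linear[OF bounded_linear_inner_left V(1)])
      show "smooth_on ?V (\<lambda>z. frechet_derivative ?\<rho> (at (?\<sigma> z)) b)"
        by (rule smooth_on_compose[OF V smooth_on_frechet_derivative[OF smooth[OF d c]] smooth[OF c d] img(1)])
    qed
    then show "smooth_on ?V (\<lambda>z. tangent_of B d (param c z) (F (coord d (param c z))) c)"
      by (rule smooth_on_cong[OF V(1) eq, rotated])
  qed
qed

lemma powr_neg_half_squared: "0 < x \<Longrightarrow> x powr (- 1 / 2) * (x powr (- 1 / 2) * x) = (1::real)"
proof -
  assume x: "0 < x"
  have "x powr (- 1 / 2) * x powr (- 1 / 2) = x powr (- 1)" by (simp flip: powr_add)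
  then show ?thesis using x by (simp add: powr_minus mult.assoc[symmetric])
qed

text \<open>Gram-Schmidt applied to the coordinate vectors of a chart. Without intermediate division the second vector
  is \<open>w = a e\<^sub>2 - b e\<^sub>1\<close> of squared length \<open>D = a (a m(e\<^sub>2, e\<^sub>2) - b\<^sup>2)\<close>. The normalisation uses real powers of
  positive smooth functions and is therefore smooth. The frame is what gives a meaning to the choice
  in the definition of the mean curvature vector.\<close>

lemma local_orthonormal_frame_exists:
  fixes B :: "('n::{t2_space, second_countable_topology}, real^2) chart set"
  assumes B: "smooth_manifold UNIV B" and h: "riemannian_metric UNIV B h"
  shows "\<exists>E. local_orthonormal_frame B h q E"
proof -
  interpret atlas B by (rule atlas_smooth_manifold[OF B])
  have "q \<in> (\<Union>c\<in>B. chart_dom c)" using B by (simp add: smooth_manifold_def)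
  then obtain d where d: "d \<in> B" "q \<in> chart_dom d" by blast
  have open_d: "open (chart_dom d)"
    using B d(1) by (simp add: smooth_manifold_def)
  let ?R = "chart_img d"
  let ?m = "metric_comp B h d"
  interpret m: metric_field ?R ?m by (rule metric_field_riemannian(1)[OF atlas_axioms h d(1)]) simp
  have pos: "0 < ?m z v v" if "z \<in> ?R" "v \<noteq> 0" for z v
    by (rule metric_field_riemannian(2)[OF atlas_axioms h d(1) _ that]) simp
  define e\<^sub>1 where "e\<^sub>1 = (axis 1 1 :: real^2)"
  define e\<^sub>2 where "e\<^sub>2 = (axis 2 1 :: real^2)"
  define a where "a = (\<lambda>z. ?m z e\<^sub>1 e\<^sub>1)"
  define b where "b = (\<lambda>z. ?m z e\<^sub>1 e\<^sub>2)"
  define D where "D = (\<lambda>z. a z * (a z * ?m z e\<^sub>2 e\<^sub>2 - b z * b z))"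
  define w where "w = (\<lambda>z. a z *\<^sub>R e\<^sub>2 - b z *\<^sub>R e\<^sub>1)"
  have a: "0 < a z" if "z \<in> ?R" for z
    unfolding a_def by (rule pos[OF that]) (simp add: e\<^sub>1_def axis_eq_0_iff)
  have ww: "?m z (w z) (w z) = D z" and ew: "?m z e\<^sub>1 (w z) = 0" if "z \<in> ?R" for z
    using m.sym[OF that, of e\<^sub>2 e\<^sub>1]
    by (simp_all add: w_def D_def m.m_linear[OF that] a_def b_def algebra_simps)
  have D: "0 < D z" if "z \<in> ?R" for z
  proof -
    have "w z $ 2 = a z" by (simp add: w_def e\<^sub>1_def e\<^sub>2_def axis_def)
    then have "w z \<noteq> 0" using a[OF that] by auto
    then show ?thesis using pos[OF that] ww[OF that] by metis
  qed
  define F where "F = (\<lambda>(i::2) z. if i = 1 then a z powr (- 1 / 2) *\<^sub>R e\<^sub>1 else D z powr (- 1 / 2) *\<^sub>R w z)"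
  have orth: "?m z (F i z) (F j z) = (if i = j then 1 else 0)" if z: "z \<in> ?R" for i j z
  proof -
    have "?m z (w z) e\<^sub>1 = 0" using ew[OF z] m.sym[OF z] by metis
    moreover have "i \<noteq> j \<Longrightarrow> i \<noteq> 1 \<Longrightarrow> j = 1" using exhaust_2[of i] exhaust_2[of j] by metis
    ultimately show ?thesis
      using powr_neg_half_squared[OF a[OF z]] powr_neg_half_squared[OF D[OF z]] exhaust_2[of i] exhaust_2[of j]
      by (auto simp: F_def m.m_linear[OF z] ww[OF z] ew[OF z] a_def[symmetric] fun_cong[OF a_def, symmetric])
  qed
  have m_smooth: "smooth_on ?R (\<lambda>z. ?m z u v)" for u v
    using h d(1) by (simp add: riemannian_metric_def)
  have R: "open ?R" by (rule open_chart_img[OF d(1)])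
  have smooth_ab: "smooth_on ?R a" "smooth_on ?R b" "smooth_on ?R D"
    unfolding a_def b_def D_def
    by (rule m_smooth, rule m_smooth, rule smooth_on_mult[OF R m_smooth],
        rule smooth_on_minus[OF R smooth_on_mult[OF R m_smooth m_smooth] smooth_on_mult[OF R m_smooth m_smooth]])
  have "smooth_on ?R w"
    unfolding w_def
    by (rule smooth_on_minus[OF R smooth_on_scaleR[OF R smooth_ab(1) smooth_on_const[OF R]]
          smooth_on_scaleR[OF R smooth_ab(2) smooth_on_const[OF R]]])
  then have F_smooth: "smooth_on ?R (F i)" for i
    unfolding F_def
    using smooth_on_scaleR[OF R smooth_on_powr[OF R smooth_ab(1) a] smooth_on_const[OF R]]
      smooth_on_scaleR[OF R smooth_on_powr[OF R smooth_ab(3) D]]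
    by (cases "i = 1") simp_all
  have "local_orthonormal_frame B h q (\<lambda>i x. tangent_of B d x (F i (coord d x)))"
    unfolding local_orthonormal_frame_def
  proof (intro exI[of _ "chart_dom d"] conjI allI ballI)
    show "smooth_vector_field_on B (chart_dom d) (\<lambda>x. tangent_of B d x (F i (coord d x)))" for i
      by (rule smooth_vector_field_of_coordinates[OF B d(1) F_smooth])
    show "h x (tangent_of B d x (F i (coord d x))) (tangent_of B d x (F j (coord d x))) = (if i = j then 1 else 0)"
      if "x \<in> chart_dom d" for x i j
      using orth[of "coord d x" i j] param_coord[OF d(1) that] that by (simp add: metric_comp_def)
  qed (use open_d d(2) in auto)
  then show ?thesis by blast
qed

section \<open>The normal part of the covariant derivative\<close>

lemma frechet_derivative_along_field:
  fixes \<Psi> :: "'a::euclidean_space \<Rightarrow> 'b::euclidean_space"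
  assumes \<Psi>: "smooth_on T \<Psi>" and T: "open T" "z \<in> T" and X: "(X has_derivative X') (at z)"
  shows "((\<lambda>y. frechet_derivative \<Psi> (at y) (X y)) has_derivative
    (\<lambda>v. frechet_derivative (\<lambda>y. frechet_derivative \<Psi> (at y) (X z)) (at z) v + frechet_derivative \<Psi> (at z) (X' v))) (at z)"
proof -
  define P where "P = (\<lambda>y. frechet_derivative \<Psi> (at y))"
  define D2 where "D2 = (\<lambda>b. frechet_derivative (\<lambda>y. P y b) (at z))"
  have P: "P y v = (\<Sum>b\<in>Basis. (v \<bullet> b) *\<^sub>R P y b)" if "y \<in> T" for y v
    unfolding P_def
    by (rule linear_Basis_expansion[OF has_derivative_linear[OF smooth_on_has_derivative[OF \<Psi> that]]])
  have D2: "((\<lambda>y. P y b) has_derivative D2 b) (at z)" for b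
    unfolding P_def D2_def by (rule smooth_on_has_derivative[OF smooth_on_frechet_derivative[OF \<Psi>] T(2)])
  have "((\<lambda>y. \<Sum>b\<in>Basis. (X z \<bullet> b) *\<^sub>R P y b) has_derivative (\<lambda>v. \<Sum>b\<in>Basis. (X z \<bullet> b) *\<^sub>R D2 b v)) (at z)"
    by (intro has_derivative_sum has_derivative_scaleR_right D2)
  then have "((\<lambda>y. P y (X z)) has_derivative (\<lambda>v. \<Sum>b\<in>Basis. (X z \<bullet> b) *\<^sub>R D2 b v)) (at z)"
    by (rule has_derivative_transform_within_open[OF _ T]) (rule P[symmetric])
  then have 1: "(\<lambda>v. \<Sum>b\<in>Basis. (X z \<bullet> b) *\<^sub>R D2 b v) = D2 (X z)"
    by (rule has_derivative_unique[OF _ D2])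
  have "((\<lambda>y. \<Sum>b\<in>Basis. (X y \<bullet> b) *\<^sub>R P y b) has_derivative
      (\<lambda>v. \<Sum>b\<in>Basis. (X z \<bullet> b) *\<^sub>R D2 b v + (X' v \<bullet> b) *\<^sub>R P z b)) (at z)"
    by (intro has_derivative_sum has_derivative_scaleR has_derivative_inner_left X D2)
  moreover have "(\<lambda>v. \<Sum>b\<in>Basis. (X z \<bullet> b) *\<^sub>R D2 b v + (X' v \<bullet> b) *\<^sub>R P z b) = (\<lambda>v. D2 (X z) v + P z (X' v))"
    by (simp only: sum.distrib fun_cong[OF 1] P[OF T(2), symmetric])
  ultimately have "((\<lambda>y. P y (X y)) has_derivative (\<lambda>v. D2 (X z) v + P z (X' v))) (at z)"
    by (simp only:) (rule has_derivative_transform_within_open[OF _ T], assumption, rule P[symmetric])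
  then show ?thesis unfolding D2_def P_def .
qed

lemma linear_compose_derivatives:
  fixes \<Psi> :: "'a::euclidean_space \<Rightarrow> 'b::euclidean_space" and L :: "'b \<Rightarrow> 'c::euclidean_space"
  assumes L: "bounded_linear L" and \<Psi>: "smooth_on T \<Psi>" and T: "open T" and u: "\<And>y. y \<in> T \<Longrightarrow> u y = L (\<Psi> y)"
  shows "smooth_on T u"
    and "y \<in> T \<Longrightarrow> frechet_derivative u (at y) v = L (frechet_derivative \<Psi> (at y) v)"
    and "y \<in> T \<Longrightarrow> frechet_derivative (\<lambda>x. frechet_derivative u (at x) v) (at y) w =
      L (frechet_derivative (\<lambda>x. frechet_derivative \<Psi> (at x) v) (at y) w)"
proof -
  note has_derivative_L = bounded_linear.has_derivative[OF L]
  show "smooth_on T u"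
    by (rule smooth_on_cong[OF T _ smooth_on_bounded_linear[OF L T \<Psi>]]) (simp add: u)
  show 1: "frechet_derivative u (at y) v = L (frechet_derivative \<Psi> (at y) v)" if "y \<in> T" for y v
  proof -
    have "(u has_derivative (\<lambda>v. L (frechet_derivative \<Psi> (at y) v))) (at y)"
      by (rule has_derivative_transform_within_open[OF has_derivative_L[OF smooth_on_has_derivative[OF \<Psi> that]] T that])
         (simp add: u)
    from fun_cong[OF frechet_derivative_at[OF this]] show ?thesis by (rule sym)
  qed
  show "frechet_derivative (\<lambda>x. frechet_derivative u (at x) v) (at y) w =
      L (frechet_derivative (\<lambda>x. frechet_derivative \<Psi> (at x) v) (at y) w)" if "y \<in> T"
  proof -
    have "((\<lambda>x. frechet_derivative u (at x) v) has_derivative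
        (\<lambda>w. L (frechet_derivative (\<lambda>x. frechet_derivative \<Psi> (at x) v) (at y) w))) (at y)"
      by (rule has_derivative_transform_within_open[OF
            has_derivative_L[OF smooth_on_has_derivative[OF smooth_on_frechet_derivative[OF \<Psi>] that]] T that])
         (simp add: 1)
    from fun_cong[OF frechet_derivative_at[OF this]] show ?thesis by (rule sym)
  qed
qed

locale spacelike_submanifold = splitted_spacetime I A \<beta> g
  for I and A :: "('f::{t2_space, second_countable_topology}, 'e::euclidean_space) chart set" and \<beta> g +
  fixes B :: "('s::{t2_space, second_countable_topology}, real^'k) chart set" and \<psi> :: "'s \<Rightarrow> real \<times> 'f"
  assumes B: "smooth_manifold UNIV B"
    and immersed: "spacelike_immersion UNIV B (I \<times> UNIV) AM G \<psi>"
begin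

sublocale S: atlas B by (rule atlas_smooth_manifold[OF B])
sublocale M: atlas AM by (rule atlas_split_atlas)

abbreviation "h \<equiv> induced_metric B AM G \<psi>"

abbreviation patch :: "('s, real^'k) chart \<Rightarrow> ('f, 'e) chart \<Rightarrow> (real^'k) set" where
  "patch d c \<equiv> coord d ` (chart_dom d \<inter> \<psi> -` (I \<times> chart_dom c))"

abbreviation rep :: "('s, real^'k) chart \<Rightarrow> ('f, 'e) chart \<Rightarrow> real^'k \<Rightarrow> real \<times> 'e" where
  "rep d c \<equiv> coord (split_chart I c) \<circ> \<psi> \<circ> param d"

lemma h_riemannian: "riemannian_metric UNIV B h"
  using immersed by (simp add: spacelike_immersion_def)

lemma \<psi>_in: "fst (\<psi> x) \<in> I"
proof -
  have "range \<psi> \<subseteq> I \<times> UNIV" using immersed unfolding spacelike_immersion_def smooth_map_def by blast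
  then have "\<psi> x \<in> I \<times> UNIV" by blast
  then show ?thesis by (simp add: mem_Times_iff)
qed

lemma open_coord_image:
  assumes "d \<in> B" "open U"
  shows "open (coord d ` (chart_dom d \<inter> U))"
proof -
  have "homeomorphism (chart_dom d) (chart_img d) (coord d) (param d)"
    using B assms(1) by (simp add: smooth_manifold_def)
  moreover have "openin (top_of_set (chart_dom d)) (chart_dom d \<inter> U)" using assms(2) by (rule openin_open_Int)
  ultimately have "openin (top_of_set (chart_img d)) (coord d ` (chart_dom d \<inter> U))"
    by (rule homeomorphism_imp_open_map)
  then show ?thesis using S.open_chart_img[OF assms(1)] by (rule openin_open_trans)
qed

lemma open_chart_dom: "c \<in> A \<Longrightarrow> open (chart_dom c)"
  using spacetime by (simp add: orthogonally_splitted_spacetime_def smooth_manifold_def)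

lemma
  assumes "d \<in> B" "c \<in> A"
  shows open_patch: "open (patch d c)" and smooth_rep: "smooth_on (patch d c) (rep d c)"
proof -
  have "smooth_map UNIV B (I \<times> UNIV) AM \<psi>" using immersed by (simp add: spacelike_immersion_def)
  note * = smooth_map_chart[OF B this assms(1), of "split_chart I c"]
  have "split_chart I c \<in> AM" using assms(2) by (simp add: split_atlas_eq)
  moreover have "open (I \<times> chart_dom c)" by (rule open_Times[OF open_I open_chart_dom[OF assms(2)]])
  ultimately show "open (patch d c)" "smooth_on (patch d c) (rep d c)" using * by simp_all
qed

lemma patchD:
  assumes "d \<in> B" "c \<in> A" "y \<in> patch d c"
  shows "d \<in> charts_at B (param d y)" "coord d (param d y) = y"
    "split_chart I c \<in> charts_at AM (\<psi> (param d y))" "c \<in> charts_at A (snd (\<psi> (param d y)))"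
    "rep d c y \<in> I \<times> chart_img c" "param (split_chart I c) (rep d c y) = \<psi> (param d y)"
proof -
  from assms(3) obtain x where "x \<in> chart_dom d \<inter> \<psi> -` (I \<times> chart_dom c)" and yx: "y = coord d x" by (rule imageE)
  then have x: "x \<in> chart_dom d" "\<psi> x \<in> I \<times> chart_dom c" "y = coord d x" by simp_all
  have p: "param d y = x" using S.param_coord[OF assms(1) x(1)] x(3) by simp
  show "d \<in> charts_at B (param d y)" "coord d (param d y) = y"
    using assms(1) x p by (auto simp: charts_at_def)
  show c: "c \<in> charts_at A (snd (\<psi> (param d y)))"
    using assms(2) x p by (auto simp: charts_at_def)
  show C: "split_chart I c \<in> charts_at AM (\<psi> (param d y))"
    using split_chart_in_charts_at[OF c, of "fst (\<psi> (param d y))"] x(2) p by (simp add: mem_Times_iff)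
  show "rep d c y \<in> I \<times> chart_img c"
    using x(2) p by (cases "\<psi> x") auto
  show "param (split_chart I c) (rep d c y) = \<psi> (param d y)"
    using M.charts_atD(4)[OF C] by simp
qed

lemma in_patch:
  assumes "d \<in> charts_at B q" "c \<in> charts_at A (snd (\<psi> q))"
  shows "coord d q \<in> patch d c"
  using assms \<psi>_in[of q] by (auto simp: charts_at_def mem_Times_iff)

lemma differential_rep:
  assumes dc: "d \<in> B" "c \<in> A" and y: "y \<in> patch d c" and v: "v \<in> tangent_space B (param d y)"
  shows "differential B AM \<psi> (param d y) v =
    tangent_of AM (split_chart I c) (\<psi> (param d y)) (frechet_derivative (rep d c) (at y) (v d))"
proof -
  note p = patchD[OF dc y]
  have "\<psi> (param d x) \<in> chart_dom (split_chart I c)" if "x \<in> patch d c" for x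
    using M.charts_atD(2)[OF patchD(3)[OF dc that]] .
  from differential_eq[where \<psi>=\<psi> and c="split_chart I c" and d=d and q="param d y" and T="patch d c" and v=v,
      OF S.atlas_axioms M.atlas_axioms p(1,3) open_patch[OF dc] _ this _ v, unfolded p(2)]
  show ?thesis using y smooth_on_differentiable[OF smooth_rep[OF dc] y] by blast
qed

lemma induced_metric_rep:
  assumes dc: "d \<in> B" "c \<in> A" and y: "y \<in> patch d c"
  shows "metric_comp B h d y u v = metric_comp AM G (split_chart I c) (rep d c y)
    (frechet_derivative (rep d c) (at y) u) (frechet_derivative (rep d c) (at y) v)"
proof -
  note p = patchD[OF dc y]
  have "differential B AM \<psi> (param d y) (tangent_of B d (param d y) u) =
      tangent_of AM (split_chart I c) (\<psi> (param d y)) (frechet_derivative (rep d c) (at y) u)" for u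
    using differential_rep[OF dc y S.tangent_of_in_tangent_space[OF p(1)]] S.tangent_of_self[OF p(1)] by simp
  then show ?thesis
    unfolding metric_comp_def induced_metric_def p(6) by simp
qed

lemma h_metric_field:
  assumes "d \<in> B"
  shows "metric_field (chart_img d) (metric_comp B h d)"
    and "z \<in> chart_img d \<Longrightarrow> v \<noteq> 0 \<Longrightarrow> 0 < metric_comp B h d z v v"
  using metric_field_riemannian[OF S.atlas_axioms h_riemannian assms] by simp_all

text \<open>The value of the covariant derivative in the chosen chart \<open>C\<close> is \<open>N = D\<^sup>2\<Psi>(e, e) + D\<Psi>(X' e) + \<Gamma>(D\<Psi> e, D\<Psi> e)\<close>, where
  \<open>X'\<close> is the derivative of the coordinates of the field. A vector \<open>v\<close> is its tangential part iff
  \<open>h(s + X' e - v, w) = 0\<close> for all \<open>w\<close>, where \<open>s\<close> represents the Koszul expression of \<open>h\<close>. As \<open>h\<close> is positive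
  definite, this means \<open>v = s + X' e\<close>. The term \<open>X' e\<close> cancels in the normal part, which thus depends
  on the field only through its value at the point.

  All orthogonality conditions are evaluated in the chart \<open>C\<close>, where the metric is given by its components
  even for the family \<open>N\<close>, whose behaviour under coordinate changes is left open.\<close>

lemma normal_part_covariant_derivative:
  assumes d: "d \<in> charts_at B q"
    and c: "c \<in> charts_at A (snd (\<psi> q))" "split_chart I c = (SOME C. C \<in> charts_at AM (\<psi> q))"
    and U: "open U" "q \<in> U" and X: "smooth_vector_field_on B U X"
  defines "z \<equiv> coord d q" and "e \<equiv> X q d"
  obtains s where
    "\<And>w. metric_comp B h d z s w = frechet_derivative (\<lambda>y. metric_comp B h d y e w) (at z) e
        - frechet_derivative (\<lambda>y. metric_comp B h d y e e) (at z) w / 2"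
    "normal_part B AM G \<psi> q (covariant_derivative_along B AM G \<psi> q (X q) (\<lambda>x. differential B AM \<psi> x (X x)))
        (split_chart I c) =
      frechet_derivative (\<lambda>y. frechet_derivative (rep d c) (at y) e) (at z) e
      + christoffel AM G (split_chart I c) (rep d c z)
          (frechet_derivative (rep d c) (at z) e) (frechet_derivative (rep d c) (at z) e)
      - frechet_derivative (rep d c) (at z) s"
proof -
  let ?C = "split_chart I c"
  have dc: "d \<in> B" "c \<in> A" using S.charts_atD(1)[OF d] charts_atD(1)[OF c(1)] .
  have z: "z \<in> patch d c" unfolding z_def by (rule in_patch[OF d c(1)])
  have q: "param d z = q" unfolding z_def by (rule S.charts_atD(4)[OF d])
  note p = patchD[OF dc z, unfolded q]
  have zd: "z \<in> chart_img d" unfolding z_def by (rule S.charts_atD(3)[OF d])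
  define \<Psi> where "\<Psi> = rep d c"
  define P where "P = frechet_derivative \<Psi> (at z)"
  define \<Gamma> where "\<Gamma> = christoffel AM G ?C (\<Psi> z)"
  define Q where "Q = frechet_derivative (\<lambda>y. frechet_derivative \<Psi> (at y) e) (at z) e"
  let ?m = "metric_comp AM G ?C (\<Psi> z)"
  let ?h = "metric_comp B h d"
  interpret m: metric_field "I \<times> chart_img c" "metric_comp AM G ?C" by (rule metric_field_spacetime[OF dc(2)])
  interpret h: metric_field "chart_img d" ?h by (rule h_metric_field(1)[OF dc(1)])
  have \<Psi>z: "\<Psi> z \<in> I \<times> chart_img c" unfolding \<Psi>_def by (rule p(5))
  have \<Psi>z': "\<Psi> z = coord ?C (\<psi> q)" by (simp add: \<Psi>_def q)
  have smooth: "smooth_on (patch d c) \<Psi>" unfolding \<Psi>_def by (rule smooth_rep[OF dc])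
  have linP: "linear P"
    unfolding P_def by (rule has_derivative_linear[OF smooth_on_has_derivative[OF smooth z]])
  have hP: "?h z u v = ?m (P u) (P v)" for u v
    unfolding P_def \<Psi>_def by (rule induced_metric_rep[OF dc z])
  have tan: "X q \<in> tangent_space B q" using X U(2) by (simp add: smooth_vector_field_on_def)
  let ?V = "coord d ` (chart_dom d \<inter> U)"
  let ?Xd = "\<lambda>y. X (param d y) d"
  have V: "open ?V" by (rule open_coord_image[OF dc(1) U(1)])
  have zV: "z \<in> ?V" unfolding z_def using S.charts_atD(2)[OF d] U(2) by blast
  have "smooth_on ?V ?Xd" using X dc(1) by (simp add: smooth_vector_field_on_def)
  note Xd' = smooth_on_has_derivative[OF this zV]
  define X' where "X' = frechet_derivative ?Xd (at z)"
  have X': "(?Xd has_derivative X') (at z)" unfolding X'_def by (rule Xd')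
  let ?T = "patch d c \<inter> ?V"
  have T: "open ?T" "z \<in> ?T" using open_patch[OF dc] V z zV by auto
  have field: "differential B AM \<psi> (param d y) (X (param d y)) ?C = frechet_derivative \<Psi> (at y) (?Xd y)"
    if "y \<in> ?T" for y
  proof -
    have y: "y \<in> patch d c" using that by blast
    from that obtain x where "x \<in> chart_dom d" "x \<in> U" "y = coord d x" by blast
    then have "param d y \<in> U" using S.param_coord[OF dc(1)] by simp
    then have "X (param d y) \<in> tangent_space B (param d y)" using X by (simp add: smooth_vector_field_on_def)
    from differential_rep[OF dc y this] show ?thesis
      using M.tangent_of_self[OF patchD(3)[OF dc y]] by (simp add: \<Psi>_def)
  qed
  have Xdz: "?Xd z = e" by (simp add: q e_def)
  \<comment> \<open>the product rule in \<open>y \<mapsto> D\<Psi>(y)(X y)\<close> produces the term \<open>D\<Psi>(X' e)\<close>\<close>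
  have der: "(((\<lambda>x. differential B AM \<psi> x (X x) ?C) \<circ> param d) has_derivative
      (\<lambda>v. frechet_derivative (\<lambda>y. frechet_derivative \<Psi> (at y) e) (at z) v + P (X' v))) (at z)"
    using frechet_derivative_along_field[OF smooth open_patch[OF dc] z X'] unfolding Xdz P_def[symmetric]
    by (rule has_derivative_transform_within_open[OF _ T]) (simp add: field)
  define N where "N = covariant_derivative_along B AM G \<psi> q (X q) (\<lambda>x. differential B AM \<psi> x (X x))"
  have "directional_derivative B (\<lambda>x. differential B AM \<psi> x (X x) ?C) q (X q) = Q + P (X' e)"
    using S.directional_derivative_eq[OF tan d, folded z_def e_def, OF differentiableI[OF der]]
      fun_cong[OF frechet_derivative_at[OF der], of e] unfolding Q_def by (simp only:)
  moreover have "differential B AM \<psi> q (X q) ?C = P e"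
    using field[OF T(2)] by (simp add: q e_def P_def)
  ultimately have N: "N ?C = Q + P (X' e) + \<Gamma> (P e) (P e)"
    unfolding N_def covariant_derivative_along_def using p(3) by (simp add: \<Psi>z'[symmetric] \<Gamma>_def)
  have lc: "m.levi_civita (\<Psi> z) \<Gamma>" unfolding \<Gamma>_def by (rule christoffel_levi_civita[OF dc(2) \<Psi>z])
  have img: "\<Psi> ` patch d c \<subseteq> I \<times> chart_img c" unfolding \<Psi>_def using patchD(5)[OF dc] by blast
  have koszul: "?m (Q + \<Gamma> (P e) (P e)) (P w) = h.dm z e e w - h.dm z w e e / 2" for w
    using m.pullback_koszul[OF open_patch[OF dc] z img smooth _ lc, of ?h e w] induced_metric_rep[OF dc]
    unfolding h.dm_def Q_def P_def \<Psi>_def by blast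
  have "linear (\<lambda>w. h.dm z e e w - h.dm z w e e / 2)"
    by (rule linearI) (simp_all add: h.dm_add[OF zd] h.dm_scale[OF zd] field_simps)
  then obtain s where s: "\<And>w. ?h z s w = h.dm z e e w - h.dm z w e e / 2"
    using h.riesz[OF zd] by blast
  have Gq: "G (\<psi> q) a b = ?m (a ?C) (b ?C)" for a b
    unfolding \<Psi>z' by (rule split_metric_chosen_chart[OF c(2) p(3)])
  have dq: "differential B AM \<psi> q v ?C = P (v d)" if "v \<in> tangent_space B q" for v
    using differential_rep[OF dc z, unfolded q, OF that] M.tangent_of_self[OF p(3)] by (simp add: P_def \<Psi>_def)
  define v\<^sub>0 where "v\<^sub>0 = tangent_of B d q (s + X' e)"
  have v0: "v\<^sub>0 \<in> tangent_space B q" "v\<^sub>0 d = s + X' e"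
    unfolding v\<^sub>0_def using S.tangent_of_in_tangent_space[OF d] S.tangent_of_self[OF d] by simp_all
  have normal_iff: "(\<forall>w\<in>tangent_space B q. G (\<psi> q) (\<lambda>c'. N c' - differential B AM \<psi> q v c') (differential B AM \<psi> q w) = 0)
      \<longleftrightarrow> v = v\<^sub>0" if v: "v \<in> tangent_space B q" for v
  proof -
    have "G (\<psi> q) (\<lambda>c'. N c' - differential B AM \<psi> q v c') (differential B AM \<psi> q w) = ?h z (s + X' e - v d) (w d)"
      if w: "w \<in> tangent_space B q" for w
      unfolding Gq dq[OF w] dq[OF v] N hP linear_diff[OF linP] linear_add[OF linP]
      using koszul[of "w d"] s[of "w d"] hP[of s "w d"]
      by (simp add: m.m_linear[OF \<Psi>z])
    moreover have "(\<forall>w\<in>tangent_space B q. ?h z (s + X' e - v d) (w d) = 0) \<longleftrightarrow> s + X' e - v d = 0"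
    proof
      assume *: "\<forall>w\<in>tangent_space B q. ?h z (s + X' e - v d) (w d) = 0"
      have "?h z (s + X' e - v d) w = 0" for w
        using *[rule_format, OF S.tangent_of_in_tangent_space[OF d, of w]] S.tangent_of_self[OF d, of w] by simp
      then show "s + X' e - v d = 0" by (rule h.nondegenerate[OF zd])
    next
      assume *: "s + X' e - v d = 0"
      show "\<forall>w\<in>tangent_space B q. ?h z (s + X' e - v d) (w d) = 0"
        unfolding * using h.m_linear(5)[OF zd, of 0 0] by simp
    qed
    moreover have "s + X' e - v d = 0 \<longleftrightarrow> v = v\<^sub>0"
      using v0 S.tangent_space_charts_eqI[OF v v0(1) d] by auto
    ultimately show ?thesis by simp
  qed
  have "normal_part B AM G \<psi> q N = (\<lambda>c'. N c' - differential B AM \<psi> q v\<^sub>0 c')"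
    unfolding normal_part_def
  proof (rule the_equality)
    show "(\<forall>v\<in>tangent_space B q. G (\<psi> q) (\<lambda>c'. N c' - differential B AM \<psi> q v\<^sub>0 c') (differential B AM \<psi> q v) = 0) \<and>
        (\<exists>v\<in>tangent_space B q. (\<lambda>c'. N c' - differential B AM \<psi> q v\<^sub>0 c') = (\<lambda>c. N c - differential B AM \<psi> q v c))"
      using normal_iff[OF v0(1)] v0(1) by blast
    fix n assume n: "(\<forall>v\<in>tangent_space B q. G (\<psi> q) n (differential B AM \<psi> q v) = 0) \<and>
        (\<exists>v\<in>tangent_space B q. n = (\<lambda>c. N c - differential B AM \<psi> q v c))"
    then obtain v where v: "v \<in> tangent_space B q" "n = (\<lambda>c. N c - differential B AM \<psi> q v c)" by blast
    with n normal_iff[OF v(1)] have "v = v\<^sub>0" by simp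
    with v(2) show "n = (\<lambda>c'. N c' - differential B AM \<psi> q v\<^sub>0 c')" by simp
  qed
  then have "normal_part B AM G \<psi> q N ?C = Q + \<Gamma> (P e) (P e) - P s"
    by (simp add: N dq[OF v0(1)] v0(2) linear_add[OF linP])
  with that[of s] s show ?thesis
    unfolding h.dm_def N_def Q_def \<Gamma>_def P_def \<Psi>_def by blast
qed

end

section \<open>The time component of the mean curvature vector\<close>

lemma continuous_on_compact_bound:
  fixes f :: "'a::topological_space \<Rightarrow> real"
  assumes "compact K" "continuous_on K f"
  obtains C where "0 \<le> C" "\<And>x. x \<in> K \<Longrightarrow> \<bar>f x\<bar> \<le> C"
proof -
  have "bounded (f ` K)"
    using assms compact_continuous_image compact_imp_bounded by blast
  then obtain C where "\<And>x. x \<in> K \<Longrightarrow> \<bar>f x\<bar> \<le> C"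
    unfolding bounded_iff by auto
  then show ?thesis by (intro that[of "max C 0"]) (auto simp: le_max_iff_disj)
qed

lemma linear_compact_bound:
  fixes L :: "'y::topological_space \<Rightarrow> 'a::euclidean_space \<Rightarrow> real"
  assumes "compact K" "\<And>y. y \<in> K \<Longrightarrow> linear (L y)" "\<And>b. b \<in> Basis \<Longrightarrow> continuous_on K (\<lambda>y. L y b)"
  obtains C where "0 \<le> C" "\<And>y v. y \<in> K \<Longrightarrow> \<bar>L y v\<bar> \<le> C * norm v"
proof -
  have "\<exists>C. 0 \<le> C \<and> (\<forall>y\<in>K. \<bar>L y b\<bar> \<le> C)" if "b \<in> Basis" for b
    using continuous_on_compact_bound[OF assms(1) assms(3)[OF that]] by metis
  then obtain C where C: "\<And>b. b \<in> Basis \<Longrightarrow> 0 \<le> C b" "\<And>b y. b \<in> Basis \<Longrightarrow> y \<in> K \<Longrightarrow> \<bar>L y b\<bar> \<le> C b"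
    by metis
  have "\<bar>L y v\<bar> \<le> (\<Sum>b\<in>Basis. C b) * norm v" if "y \<in> K" for y v
  proof -
    have "\<bar>L y v\<bar> = \<bar>\<Sum>b\<in>Basis. (v \<bullet> b) * L y b\<bar>"
      using linear_Basis_expansion[OF assms(2)[OF that], of v] by simp
    also have "\<dots> \<le> (\<Sum>b\<in>Basis. \<bar>(v \<bullet> b) * L y b\<bar>)" by (rule sum_abs)
    also have "\<dots> \<le> (\<Sum>b\<in>Basis. norm v * C b)"
      by (intro sum_mono) (auto simp: abs_mult intro!: mult_mono Basis_le_norm C(2)[OF _ that])
    finally show ?thesis unfolding sum_distrib_right by (simp add: mult.commute)
  qed
  then show ?thesis by (intro that[of "\<Sum>b\<in>Basis. C b"]) (auto intro: sum_nonneg C(1))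
qed

context metric_field
begin

text \<open>The minimum over the compact set \<open>K \<times> sphere 0 1\<close> is positive; the general case follows by homogeneity.\<close>

lemma uniform_lower_bound:
  assumes K: "compact K" "K \<subseteq> S"
    and cont: "\<And>u v. continuous_on K (\<lambda>y. m y u v)"
    and pos: "\<And>y v. y \<in> K \<Longrightarrow> v \<noteq> 0 \<Longrightarrow> 0 < m y v v"
  obtains c where "0 < c" "\<And>y v. y \<in> K \<Longrightarrow> c * (norm v)\<^sup>2 \<le> m y v v"
proof (cases "K = {}")
  case True
  then show ?thesis by (intro that[of 1]) auto
next
  case False
  let ?P = "K \<times> sphere (0::'e) 1"
  let ?f = "\<lambda>p. m (fst p) (snd p) (snd p)"
  have "continuous_on ?P (\<lambda>p. \<Sum>i\<in>Basis. \<Sum>j\<in>Basis. (snd p \<bullet> i) * (snd p \<bullet> j) * m (fst p) i j)"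
    by (intro continuous_intros continuous_on_compose2[OF cont continuous_on_fst]) auto
  then have "continuous_on ?P ?f"
    by (rule continuous_on_eq) (use K(2) in \<open>auto intro!: m_Basis[symmetric]\<close>)
  moreover have "compact ?P" by (intro compact_Times K compact_sphere)
  moreover have "?P \<noteq> {}" using False by simp
  ultimately obtain p where p: "p \<in> ?P" "\<And>p'. p' \<in> ?P \<Longrightarrow> ?f p \<le> ?f p'"
    using continuous_attains_inf[of ?P ?f] by blast
  show ?thesis
  proof (rule that[of "?f p"])
    show "0 < ?f p" using p(1) by (intro pos) auto
    show "?f p * (norm v)\<^sup>2 \<le> m y v v" if y: "y \<in> K" for y v
    proof (cases "v = 0")
      case True
      then show ?thesis using m_linear(5)[of y 0 v] y K(2) by auto
    next
      case False
      have S: "y \<in> S" using y K(2) by blast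
      have "(y, (1 / norm v) *\<^sub>R v) \<in> ?P" using y False by simp
      from p(2)[OF this] have "?f p \<le> m y v v / (norm v)\<^sup>2"
        by (simp add: m_linear(5,6)[OF S] power2_eq_square)
      then show ?thesis using False by (simp add: pos_le_divide_eq)
    qed
  qed
qed

lemma dm_uniform_bound:
  assumes K: "compact K" "K \<subseteq> S"
    and cont: "\<And>u v w. continuous_on K (\<lambda>y. dm y u v w)"
  obtains C where "0 \<le> C" "\<And>y u v w. y \<in> K \<Longrightarrow> \<bar>dm y u v w\<bar> \<le> C * norm u * norm v * norm w"
proof -
  have S: "y \<in> S" if "y \<in> K" for y using that K(2) by blast
  have "\<exists>C. 0 \<le> C \<and> (\<forall>y\<in>K. \<forall>u. \<bar>dm y u i j\<bar> \<le> C * norm u)" for i j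
  proof -
    have "linear (\<lambda>u. dm y u i j)" if "y \<in> K" for y
      by (rule linearI) (simp_all add: dm_add[OF S[OF that]] dm_scale[OF S[OF that]])
    from linear_compact_bound[OF K(1) this cont] show ?thesis by metis
  qed
  then obtain C where C: "\<And>i j. 0 \<le> C i j" "\<And>i j y u. y \<in> K \<Longrightarrow> \<bar>dm y u i j\<bar> \<le> C i j * norm u"
    by metis
  have "\<bar>dm y u v w\<bar> \<le> (\<Sum>i\<in>Basis. \<Sum>j\<in>Basis. C i j) * norm u * norm v * norm w" if y: "y \<in> K" for y u v w
  proof -
    have "\<bar>dm y u v w\<bar> \<le> (\<Sum>i\<in>Basis. \<Sum>j\<in>Basis. \<bar>(v \<bullet> i) * (w \<bullet> j) * dm y u i j\<bar>)"
      unfolding dm_Basis[OF S[OF y], of u v w] by (intro order_trans[OF sum_abs] sum_mono sum_abs)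
    also have "\<dots> \<le> (\<Sum>i\<in>Basis. \<Sum>j\<in>Basis. (norm v * norm w) * (C i j * norm u))"
      by (intro sum_mono) (auto simp: abs_mult intro!: mult_mono Basis_le_norm C y)
    also have "\<dots> = (\<Sum>i\<in>Basis. \<Sum>j\<in>Basis. C i j) * norm u * norm v * norm w"
      by (simp add: sum_distrib_left sum_distrib_right mult_ac)
    finally show ?thesis .
  qed
  then show ?thesis by (intro that[of "\<Sum>i\<in>Basis. \<Sum>j\<in>Basis. C i j"]) (auto intro: sum_nonneg C(1))
qed

end

text \<open>Expanding \<open>b = \<Sum>\<^sub>k x\<^sub>k e\<^sub>k\<close> gives \<open>m(b, b) = \<Sum>\<^sub>k x\<^sub>k\<^sup>2\<close> and \<open>b\<cdot>b = \<Sum>\<^sub>k x\<^sub>k (b\<cdot>e\<^sub>k)\<close>, so this is the Cauchy-Schwarz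
  inequality. It yields ellipticity: an orthonormal frame of a metric that is bounded above cannot be
  nearly perpendicular to \<open>b\<close>.\<close>

lemma orthonormal_frame_transverse:
  fixes m :: "real^'k \<Rightarrow> real^'k \<Rightarrow> real" and e :: "'k \<Rightarrow> real^'k"
  assumes m: "bilinear m" and orth: "\<And>i j. m (e i) (e j) = (if i = j then 1 else 0)"
  shows "(b \<bullet> b)\<^sup>2 \<le> m b b * (\<Sum>k\<in>UNIV. (b \<bullet> e k)\<^sup>2)"
proof -
  define L where "L = (\<lambda>x::real^'k. \<Sum>k\<in>UNIV. (x $ k) *\<^sub>R e k)"
  have "linear L"
    by (rule linearI) (simp_all add: L_def algebra_simps sum.distrib scaleR_sum_right)
  have mL: "m (L x) v = (\<Sum>k\<in>UNIV. x $ k * m (e k) v)" for x v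
  proof -
    have lin: "linear (\<lambda>u. m u v)" using m by (simp add: bilinear_def)
    show ?thesis unfolding L_def linear_sum[OF lin] linear_cmul[OF lin] by simp
  qed
  have coeff: "m (L x) (e j) = x $ j" for x j
    by (simp add: mL orth if_distrib cong: if_cong)
  have "inj L"
    unfolding linear_injective_0[OF \<open>linear L\<close>]
  proof (intro allI impI)
    fix x assume "L x = 0"
    then have "x $ j = 0" for j using coeff[of x j] bilinear_lzero[OF m] by simp
    then show "x = 0" by (simp add: vec_eq_iff)
  qed
  then have "surj L" by (rule linear_inj_imp_surj[OF \<open>linear L\<close>])
  then obtain x where x: "b = L x" by (rule surjE)
  have "m (L x) (L x) = (\<Sum>k\<in>UNIV. x $ k * x $ k)"
  proof -
    have lin: "linear (\<lambda>u. m v u)" for v using m by (simp add: bilinear_def)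
    have "m (e k) (L x) = x $ k" for k
      unfolding L_def linear_sum[OF lin] linear_cmul[OF lin] by (simp add: orth if_distrib cong: if_cong)
    then show ?thesis by (simp add: mL)
  qed
  then have mbb: "m b b = (\<Sum>k\<in>UNIV. (x $ k)\<^sup>2)" by (simp add: x power2_eq_square)
  have "b \<bullet> b = b \<bullet> L x" by (simp only: x)
  also have "\<dots> = (\<Sum>k\<in>UNIV. x $ k * (b \<bullet> e k))" by (simp add: L_def inner_sum_right)
  finally have "(b \<bullet> b)\<^sup>2 = (\<Sum>k\<in>UNIV. x $ k * (b \<bullet> e k))\<^sup>2" by simp
  also have "\<dots> \<le> (\<Sum>k\<in>UNIV. (x $ k)\<^sup>2) * (\<Sum>k\<in>UNIV. (b \<bullet> e k)\<^sup>2)"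
    by (rule Cauchy_Schwarz_ineq_sum)
  finally show ?thesis by (simp add: mbb)
qed

context spacelike_submanifold
begin

abbreviation chosen :: "'s \<Rightarrow> (real \<times> 'f, real \<times> 'e) chart" where
  "chosen q \<equiv> SOME C. C \<in> charts_at AM (\<psi> q)"

lemma chosen_chart:
  obtains c where "c \<in> charts_at A (snd (\<psi> q))" "split_chart I c = chosen q" "chosen q \<in> charts_at AM (\<psi> q)"
proof -
  have "snd (\<psi> q) \<in> (\<Union>c\<in>A. chart_dom c)"
    using spacetime by (simp add: orthogonally_splitted_spacetime_def smooth_manifold_def)
  then obtain c where "c \<in> charts_at A (snd (\<psi> q))" unfolding charts_at_def by blast
  from split_chart_in_charts_at[OF this \<psi>_in[of q]] have "split_chart I c \<in> charts_at AM (\<psi> q)" by simp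
  then have C: "chosen q \<in> charts_at AM (\<psi> q)" by (rule someI)
  from charts_at_split_atlas[OF this] obtain c' where "c' \<in> charts_at A (snd (\<psi> q))" "chosen q = split_chart I c'"
    by metis
  with C show ?thesis by (intro that[of c']) simp_all
qed

text \<open>The time orientation of a normal vector is thereby read off from its first coordinate in the chosen
  chart.\<close>

lemma metric_coordinate_time_field:
  "G (\<psi> q) v (coordinate_time_field I A (\<psi> q)) = - \<beta> (\<psi> q) * fst (v (chosen q))"
proof -
  obtain c where c: "c \<in> charts_at A (snd (\<psi> q))" "split_chart I c = chosen q" "chosen q \<in> charts_at AM (\<psi> q)"
    by (rule chosen_chart)
  let ?t = "fst (\<psi> q)" and ?x = "snd (\<psi> q)"
  note cA = charts_atD[OF c(1)]
  have "coord (chosen q) (\<psi> q) = (?t, coord c ?x)"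
    unfolding c(2)[symmetric] using split_chart_simps(2)[of c ?t ?x] by simp
  then have "G (\<psi> q) v (coordinate_time_field I A (\<psi> q)) =
      metric_comp AM G (split_chart I c) (?t, coord c ?x) (v (chosen q)) (1, 0)"
    unfolding split_metric_chosen_chart[OF refl c(3)] c(2)
    using c(3) by (simp add: coordinate_time_field_def)
  also have "\<dots> = - \<beta> (\<psi> q) * fst (v (chosen q)) + metric_comp A (g ?t) c (coord c ?x) (snd (v (chosen q))) 0"
    by (simp add: split_metric_comp[OF cA(1) \<psi>_in cA(3)] cA(4))
  also have "metric_comp A (g ?t) c (coord c ?x) (snd (v (chosen q))) 0 = 0"
    using metric_field.m_linear(6)[OF g_metric_field(1)[OF cA(1) \<psi>_in[of q]] cA(3), of "snd (v (chosen q))" 0 0] by simp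
  finally show ?thesis by simp
qed

lemma rep_time:
  assumes "y \<in> patch d c"
  shows "(fst \<circ> \<psi> \<circ> param d) y = fst (rep d c y)"
  by (cases "\<psi> (param d y)") simp

text \<open>The trace formula for the time component. Here \<open>s k\<close> is the Christoffel symbol of the induced metric,
  and the fraction is the time component of the Christoffel symbol of the spacetime at
  \<open>(d\<psi>(e k), d\<psi>(e k))\<close>; \<open>V k\<close> is the \<open>F\<close>-component of \<open>d\<psi>(e k)\<close>. The minus sign on the left comes from the sign
  convention for the second fundamental form. No chart of the spacetime occurs on the right-hand side.\<close>

lemma mean_curvature_time_component:
  fixes q d
  assumes d: "d \<in> charts_at B q" and frame: "\<exists>E. local_orthonormal_frame B h q E"
  defines "z \<equiv> coord d q" and "u \<equiv> fst \<circ> \<psi> \<circ> param d"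
    and "t \<equiv> fst (\<psi> q)" and "x \<equiv> snd (\<psi> q)"
  obtains e s :: "'k \<Rightarrow> real^'k" and V :: "'k \<Rightarrow> ('f, 'e) tangent" where
    "\<And>i j. metric_comp B h d z (e i) (e j) = (if i = j then 1 else 0)"
    "\<And>k w. metric_comp B h d z (s k) w = frechet_derivative (\<lambda>y. metric_comp B h d y (e k) w) (at z) (e k)
        - frechet_derivative (\<lambda>y. metric_comp B h d y (e k) (e k)) (at z) w / 2"
    "\<And>k. V k \<in> tangent_space A x"
    "- fst (mean_curvature_vector B AM G \<psi> q (chosen q)) = (\<Sum>k\<in>UNIV.
      frechet_derivative (\<lambda>y. frechet_derivative u (at y) (e k)) (at z) (e k) - frechet_derivative u (at z) (s k)
      + (frechet_derivative (\<beta> \<circ> \<psi> \<circ> param d) (at z) (e k) * frechet_derivative u (at z) (e k)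
         - deriv (\<lambda>r. \<beta> (r, x)) t * (frechet_derivative u (at z) (e k))\<^sup>2 / 2
         + deriv (\<lambda>r. g r x (V k) (V k)) t / 2) / \<beta> (\<psi> q))"
proof -
  obtain c where c: "c \<in> charts_at A x" "split_chart I c = chosen q" "chosen q \<in> charts_at AM (\<psi> q)"
    unfolding x_def by (rule chosen_chart)
  have dc: "d \<in> B" "c \<in> A" using S.charts_atD(1)[OF d] charts_atD(1)[OF c(1)] .
  have z: "z \<in> patch d c" unfolding z_def by (rule in_patch[OF d c(1)[unfolded x_def]])
  have q: "param d z = q" unfolding z_def by (rule S.charts_atD(4)[OF d])
  let ?C = "split_chart I c"
  define \<Psi> where "\<Psi> = rep d c"
  have smooth: "smooth_on (patch d c) \<Psi>" unfolding \<Psi>_def by (rule smooth_rep[OF dc])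
  have T: "open (patch d c)" by (rule open_patch[OF dc])
  have u: "u y = fst (\<Psi> y)" if "y \<in> patch d c" for y
    using rep_time[OF that] by (simp add: u_def \<Psi>_def)
  have du: "frechet_derivative u (at z) v = fst (frechet_derivative \<Psi> (at z) v)" for v
    by (rule linear_compose_derivatives(2)[OF bounded_linear_fst smooth T u z])
  have ddu: "frechet_derivative (\<lambda>x. frechet_derivative u (at x) v) (at z) w =
      fst (frechet_derivative (\<lambda>x. frechet_derivative \<Psi> (at x) v) (at z) w)" for v w
    by (rule linear_compose_derivatives(3)[OF bounded_linear_fst smooth T u z])
  have t: "t \<in> I" unfolding t_def by (rule \<psi>_in)
  note cx = charts_atD(2,3,4)[OF c(1)]
  have \<psi>q: "\<psi> q = (t, x)" by (simp add: t_def x_def)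
  have \<Psi>z: "\<Psi> z = (t, coord c x)" by (simp add: \<Psi>_def q \<psi>q)
  define E where "E = (SOME E. local_orthonormal_frame B h q E)"
  have "local_orthonormal_frame B h q E" unfolding E_def using frame by (rule someI_ex)
  then obtain U where U: "open U" "q \<in> U" and EU: "\<And>i. smooth_vector_field_on B U (E i)"
    and orth: "\<And>y i j. y \<in> U \<Longrightarrow> h y (E i y) (E j y) = (if i = j then 1 else 0)"
    unfolding local_orthonormal_frame_def by blast
  define e where "e = (\<lambda>k. E k q d)"
  define n where "n = (\<lambda>k. normal_part B AM G \<psi> q
    (covariant_derivative_along B AM G \<psi> q (E k q) (\<lambda>x. differential B AM \<psi> x (E k x))) ?C)"
  have "\<exists>s. (\<forall>w. metric_comp B h d z s w = frechet_derivative (\<lambda>y. metric_comp B h d y (e k) w) (at z) (e k)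
        - frechet_derivative (\<lambda>y. metric_comp B h d y (e k) (e k)) (at z) w / 2) \<and>
      n k = frechet_derivative (\<lambda>y. frechet_derivative \<Psi> (at y) (e k)) (at z) (e k)
      + christoffel AM G ?C (\<Psi> z) (frechet_derivative \<Psi> (at z) (e k)) (frechet_derivative \<Psi> (at z) (e k))
      - frechet_derivative \<Psi> (at z) s" for k
    unfolding n_def e_def z_def \<Psi>_def
    by (rule normal_part_covariant_derivative[OF d c(1)[unfolded x_def] c(2) U EU[of k]]) blast
  then obtain s where s: "\<And>k w. metric_comp B h d z (s k) w =
        frechet_derivative (\<lambda>y. metric_comp B h d y (e k) w) (at z) (e k)
        - frechet_derivative (\<lambda>y. metric_comp B h d y (e k) (e k)) (at z) w / 2"
    and n: "\<And>k. n k = frechet_derivative (\<lambda>y. frechet_derivative \<Psi> (at y) (e k)) (at z) (e k)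
      + christoffel AM G ?C (\<Psi> z) (frechet_derivative \<Psi> (at z) (e k)) (frechet_derivative \<Psi> (at z) (e k))
      - frechet_derivative \<Psi> (at z) (s k)"
    by metis
  define V where "V = (\<lambda>k. tangent_of A c x (snd (frechet_derivative \<Psi> (at z) (e k))))"
  have b: "frechet_derivative (\<beta> \<circ> \<psi> \<circ> param d) (at z) v =
      frechet_derivative (\<beta> \<circ> param ?C) (at (\<Psi> z)) (frechet_derivative \<Psi> (at z) v)" for v
  proof -
    have "\<Psi> z \<in> I \<times> chart_img c" unfolding \<Psi>_def by (rule patchD(5)[OF dc z])
    from has_derivative_compose[OF smooth_on_has_derivative[OF smooth z] smooth_on_has_derivative[OF \<beta>_smooth[OF dc(2)] this]]
    have "((\<beta> \<circ> \<psi> \<circ> param d) has_derivative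
        (\<lambda>v. frechet_derivative (\<beta> \<circ> param ?C) (at (\<Psi> z)) (frechet_derivative \<Psi> (at z) v))) (at z)"
    proof (rule has_derivative_transform_within_open[OF _ T z])
      show "(\<beta> \<circ> param ?C) (\<Psi> y) = (\<beta> \<circ> \<psi> \<circ> param d) y" if "y \<in> patch d c" for y
        using patchD(6)[OF dc that] by (simp only: \<Psi>_def o_apply)
    qed
    from fun_cong[OF frechet_derivative_at[OF this]] show ?thesis by (rule HOL.sym)
  qed
  have fst_n: "fst (n k) = frechet_derivative (\<lambda>y. frechet_derivative u (at y) (e k)) (at z) (e k)
      - frechet_derivative u (at z) (s k)
      + (frechet_derivative (\<beta> \<circ> \<psi> \<circ> param d) (at z) (e k) * frechet_derivative u (at z) (e k)
         - deriv (\<lambda>r. \<beta> (r, x)) t * (frechet_derivative u (at z) (e k))\<^sup>2 / 2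
         + deriv (\<lambda>r. g r x (V k) (V k)) t / 2) / \<beta> (\<psi> q)" for k
  proof -
    have "0 < \<beta> (t, x)" by (rule \<beta>_pos[OF t])
    then have "fst (christoffel AM G ?C (\<Psi> z) (frechet_derivative \<Psi> (at z) (e k)) (frechet_derivative \<Psi> (at z) (e k))) =
      (frechet_derivative (\<beta> \<circ> \<psi> \<circ> param d) (at z) (e k) * frechet_derivative u (at z) (e k)
         - deriv (\<lambda>r. \<beta> (r, x)) t * (frechet_derivative u (at z) (e k))\<^sup>2 / 2
         + deriv (\<lambda>r. g r x (V k) (V k)) t / 2) / \<beta> (\<psi> q)"
      using christoffel_time_component[OF dc(2) t cx(2), of "frechet_derivative \<Psi> (at z) (e k)"]
      unfolding cx(3) b du \<Psi>z \<psi>q V_def by (simp add: nonzero_eq_divide_eq mult.commute)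
    then show ?thesis unfolding n by (simp add: du ddu)
  qed
  have "mean_curvature_vector B AM G \<psi> q (chosen q) = (\<Sum>k\<in>UNIV. - n k)"
    unfolding mean_curvature_vector_def Let_def E_def[symmetric] second_fundamental_form_def n_def c(2) ..
  then have H: "- fst (mean_curvature_vector B AM G \<psi> q (chosen q)) = (\<Sum>k\<in>UNIV. fst (n k))"
    by (simp add: fst_sum sum_negf)
  show ?thesis
  proof (rule that[of e s V])
    show "metric_comp B h d z (e i) (e j) = (if i = j then 1 else 0)" for i j
    proof -
      have "tangent_of B d q (e k) = E k q" for k
        unfolding e_def using EU[of k] U(2)
        by (intro S.tangent_of_coordinates[OF _ d]) (simp add: smooth_vector_field_on_def)
      then show ?thesis using orth[OF U(2)] by (simp add: metric_comp_def q)
    qed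
    show "V k \<in> tangent_space A x" for k unfolding V_def by (rule tangent_of_in_tangent_space[OF c(1)])
  qed (use s in blast, simp only: H fst_n)
qed

end

section \<open>Strict local extrema of the time function\<close>

context spacelike_submanifold
begin

text \<open>The factor \<open>\<sigma> = \<plusminus>1\<close> treats minima and maxima together. The trace formula turns the two sign conditions into
  \<open>\<Sum>\<^sub>k D\<^sup>2w(e\<^sub>k, e\<^sub>k) \<le> C (M + M\<^sup>2)\<close> for \<open>w = \<sigma> u\<close> and every bound \<open>M\<close> on \<open>Dw\<close>. The constant \<open>C\<close> is uniform on a
  compact coordinate ball because the frame is bounded in terms of the lower bound \<open>c\<^sub>1\<close> of the induced
  metric, and because the induced metric, \<open>\<beta>\<close> and their first derivatives are bounded there.\<close>

theorem no_strict_local_extremum: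
  fixes \<sigma> :: real
  assumes \<sigma>: "\<bar>\<sigma>\<bar> = 1"
    and frames: "\<And>q. \<exists>E. local_orthonormal_frame B h q E"
    and H: "\<And>q. 0 \<le> \<sigma> * fst (mean_curvature_vector B AM G \<psi> q (chosen q))"
    and g: "\<And>t x v. t \<in> I \<Longrightarrow> v \<in> tangent_space A x \<Longrightarrow> 0 \<le> \<sigma> * deriv (\<lambda>r. g r x v v) t"
  shows "\<not> strict_local_min (\<lambda>x. \<sigma> * fst (\<psi> x)) q"
proof
  assume "strict_local_min (\<lambda>x. \<sigma> * fst (\<psi> x)) q"
  then obtain N where N: "open N" "q \<in> N" "\<And>x. x \<in> N \<Longrightarrow> x \<noteq> q \<Longrightarrow> \<sigma> * fst (\<psi> q) < \<sigma> * fst (\<psi> x)"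
    unfolding strict_local_min_def eventually_at_topological by blast
  have "q \<in> (\<Union>d\<in>B. chart_dom d)" using B by (simp add: smooth_manifold_def)
  then obtain d where d: "d \<in> charts_at B q" unfolding charts_at_def by blast
  obtain c where c: "c \<in> charts_at A (snd (\<psi> q))" by (rule chosen_chart)
  have dc: "d \<in> B" "c \<in> A" using S.charts_atD(1)[OF d] charts_atD(1)[OF c] .
  let ?C = "split_chart I c"
  let ?T = "patch d c"
  let ?m = "metric_comp B h d"
  define z\<^sub>0 where "z\<^sub>0 = coord d q"
  define \<Psi> where "\<Psi> = rep d c"
  define u where "u = fst \<circ> \<psi> \<circ> param d"
  define w where "w = (\<lambda>y. \<sigma> * u y)"
  define b where "b = \<beta> \<circ> \<psi> \<circ> param d"
  define \<beta>t where "\<beta>t = (\<lambda>y. deriv (\<lambda>r. \<beta> (r, snd (\<psi> (param d y)))) (fst (\<psi> (param d y))))"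
  interpret m: metric_field "chart_img d" ?m by (rule h_metric_field(1)[OF dc(1)])
  have T: "open ?T" by (rule open_patch[OF dc])
  have \<Psi>: "smooth_on ?T \<Psi>" unfolding \<Psi>_def by (rule smooth_rep[OF dc])
  have img: "\<Psi> ` ?T \<subseteq> I \<times> chart_img c" unfolding \<Psi>_def using patchD(5)[OF dc] by blast
  have TI: "open (I \<times> chart_img c)" by (rule open_Times[OF open_I open_chart_img[OF dc(2)]])
  have u_rep: "u y = fst (\<Psi> y)" if "y \<in> ?T" for y
    unfolding u_def \<Psi>_def by (rule rep_time[OF that])
  have u: "smooth_on ?T u" by (rule linear_compose_derivatives(1)[OF bounded_linear_fst \<Psi> T u_rep])
  have w: "smooth_on ?T w"
    by (rule linear_compose_derivatives(1)[OF bounded_linear_mult_right[of \<sigma>] u T]) (simp add: w_def)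
  have dw: "frechet_derivative w (at y) v = \<sigma> * frechet_derivative u (at y) v"
    "frechet_derivative (\<lambda>y. frechet_derivative w (at y) v) (at y) v' =
      \<sigma> * frechet_derivative (\<lambda>y. frechet_derivative u (at y) v) (at y) v'" if "y \<in> ?T" for y v v'
    by (rule linear_compose_derivatives(2,3)[OF bounded_linear_mult_right[of \<sigma>] u T _ that], simp add: w_def)+
  have "smooth_on ?T (\<lambda>y. (\<beta> \<circ> param ?C) (\<Psi> y))"
    by (rule smooth_on_compose[OF T TI \<beta>_smooth[OF dc(2)] \<Psi> img])
  then have b: "smooth_on ?T b"
  proof (rule smooth_on_cong[OF T, rotated])
    show "(\<beta> \<circ> param ?C) (\<Psi> y) = b y" if "y \<in> ?T" for y
      using patchD(6)[OF dc that] by (simp only: \<Psi>_def b_def o_apply)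
  qed
  have b_pos: "0 < b y" for y
    using \<beta>_pos[OF \<psi>_in, of "param d y" "snd (\<psi> (param d y))"] by (simp add: b_def)
  \<comment> \<open>in the chart \<open>?C\<close> the derivative \<open>\<partial>\<^sub>t\<beta>\<close> is a directional derivative in the direction \<open>(1, 0)\<close>, hence continuous\<close>
  have "continuous_on ?T (\<lambda>y. frechet_derivative (\<beta> \<circ> param ?C) (at (\<Psi> y)) (1, 0))"
    by (rule continuous_on_compose2[OF smooth_on_continuous[OF smooth_on_frechet_derivative[OF \<beta>_smooth[OF dc(2)]]]
          smooth_on_continuous[OF \<Psi>] img])
  then have \<beta>t: "continuous_on ?T \<beta>t"
  proof (rule continuous_on_eq)
    fix y assume y: "y \<in> ?T"
    obtain t x where tx: "\<psi> (param d y) = (t, x)" by (cases "\<psi> (param d y)")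
    have t: "t \<in> I" using \<psi>_in[of "param d y"] tx by simp
    have x: "c \<in> charts_at A x" using patchD(4)[OF dc y] tx by simp
    have "\<Psi> y = (t, coord c x)" by (simp add: \<Psi>_def tx)
    then show "frechet_derivative (\<beta> \<circ> param ?C) (at (\<Psi> y)) (1, 0) = \<beta>t y"
      using \<beta>_time_derivative[OF dc(2) t charts_atD(3)[OF x]] charts_atD(4)[OF x] by (simp add: \<beta>t_def tx)
  qed
  have m_smooth: "smooth_on (chart_img d) (\<lambda>y. ?m y v v')" for v v'
    using h_riemannian dc(1) by (simp add: riemannian_metric_def)
  have z0: "z\<^sub>0 \<in> ?T" unfolding z\<^sub>0_def by (rule in_patch[OF d c])
  have "z\<^sub>0 \<in> coord d ` (chart_dom d \<inter> N)" unfolding z\<^sub>0_def using S.charts_atD(2)[OF d] N(2) by blast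
  then have "open (?T \<inter> coord d ` (chart_dom d \<inter> N))" "z\<^sub>0 \<in> ?T \<inter> coord d ` (chart_dom d \<inter> N)"
    using T open_coord_image[OF dc(1) N(1)] z0 by auto
  then obtain r where r: "0 < r" "cball z\<^sub>0 r \<subseteq> ?T \<inter> coord d ` (chart_dom d \<inter> N)"
    using open_contains_cball by blast
  define K where "K = cball z\<^sub>0 r"
  have K: "compact K" "K \<subseteq> ?T" "K \<subseteq> chart_img d" "z\<^sub>0 \<in> K"
    using r by (auto simp: K_def)
  have strict: "w z\<^sub>0 < w y" if "y \<in> K" "y \<noteq> z\<^sub>0" for y
  proof -
    from that(1) r(2) obtain x where x: "x \<in> chart_dom d" "x \<in> N" "y = coord d x" unfolding K_def by blast
    have "x \<noteq> q" using x(3) that(2) z\<^sub>0_def by blast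
    from N(3)[OF x(2) this] show ?thesis
      by (simp add: w_def u_def x(3) S.param_coord[OF dc(1) x(1)] z\<^sub>0_def S.charts_atD(4)[OF d])
  qed
  have cont_m: "continuous_on K (\<lambda>y. ?m y v v')" for v v'
    by (rule continuous_on_subset[OF smooth_on_continuous[OF m_smooth] K(3)])
  have cont_dm: "continuous_on K (\<lambda>y. m.dm y v v' v'')" for v v' v''
    unfolding m.dm_def
    by (rule continuous_on_subset[OF smooth_on_continuous[OF smooth_on_frechet_derivative[OF m_smooth]] K(3)])
  have pos: "0 < ?m y v v" if "y \<in> K" "v \<noteq> 0" for y v
    using h_metric_field(2)[OF dc(1)] K(3) that by blast
  obtain c\<^sub>1 where c1: "0 < c\<^sub>1" "\<And>y v. y \<in> K \<Longrightarrow> c\<^sub>1 * (norm v)\<^sup>2 \<le> ?m y v v"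
    by (rule m.uniform_lower_bound[OF K(1,3) cont_m pos]) blast+
  obtain C\<^sub>3 where C3: "0 \<le> C\<^sub>3" "\<And>y v v' v''. y \<in> K \<Longrightarrow> \<bar>m.dm y v v' v''\<bar> \<le> C\<^sub>3 * norm v * norm v' * norm v''"
    by (rule m.dm_uniform_bound[OF K(1,3) cont_dm]) blast+
  obtain C\<^sub>4 where C4: "0 \<le> C\<^sub>4" "\<And>y v. y \<in> K \<Longrightarrow> \<bar>frechet_derivative b (at y) v / b y\<bar> \<le> C\<^sub>4 * norm v"
  proof (rule linear_compact_bound[of K "\<lambda>y v. frechet_derivative b (at y) v / b y"])
    show "compact K" by (rule K(1))
    show "linear (\<lambda>v. frechet_derivative b (at y) v / b y)" if "y \<in> K" for y
    proof -
      have "linear (frechet_derivative b (at y))"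
        by (rule has_derivative_linear[OF smooth_on_has_derivative[OF b]]) (use that K(2) in blast)
      then show ?thesis
        by (intro linearI) (simp_all add: linear_add linear_cmul add_divide_distrib)
    qed
    show "continuous_on K (\<lambda>y. frechet_derivative b (at y) v / b y)" for v
      using continuous_on_subset[OF smooth_on_continuous[OF b] K(2)]
        continuous_on_subset[OF smooth_on_continuous[OF smooth_on_frechet_derivative[OF b]] K(2)] b_pos
      by (intro continuous_on_divide) (auto simp: less_imp_neq[symmetric])
  qed blast
  obtain C\<^sub>5 where C5: "0 \<le> C\<^sub>5" "\<And>y. y \<in> K \<Longrightarrow> \<bar>\<beta>t y / (2 * b y)\<bar> \<le> C\<^sub>5"
  proof (rule continuous_on_compact_bound[OF K(1), of "\<lambda>y. \<beta>t y / (2 * b y)"])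
    show "continuous_on K (\<lambda>y. \<beta>t y / (2 * b y))"
      using continuous_on_subset[OF smooth_on_continuous[OF b] K(2)] continuous_on_subset[OF \<beta>t K(2)] b_pos
      by (intro continuous_on_divide continuous_on_mult_left) (auto simp: less_imp_neq[symmetric])
  qed blast
  define b\<^sub>0 where "b\<^sub>0 = (SOME b. b \<in> (Basis :: (real^'k) set))"
  have b0: "norm b\<^sub>0 = 1" "b\<^sub>0 \<bullet> b\<^sub>0 = 1"
  proof -
    have "b\<^sub>0 \<in> Basis" unfolding b\<^sub>0_def by (rule SOME_Basis)
    then show "norm b\<^sub>0 = 1" "b\<^sub>0 \<bullet> b\<^sub>0 = 1" by (simp_all add: inner_same_Basis)
  qed
  obtain C\<^sub>2 where C2: "\<And>y. y \<in> K \<Longrightarrow> \<bar>?m y b\<^sub>0 b\<^sub>0\<bar> \<le> C\<^sub>2"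
    by (rule continuous_on_compact_bound[OF K(1) cont_m[of b\<^sub>0 b\<^sub>0]]) blast
  have C2_pos: "0 < C\<^sub>2"
  proof -
    have "b\<^sub>0 \<noteq> 0" using b0(1) by auto
    from pos[OF K(4) this] C2[OF K(4)] show ?thesis by linarith
  qed
  \<comment> \<open>\<open>R\<close> bounds the frame vectors and \<open>s\<^sub>0\<close> the Christoffel symbols of the induced metric at them\<close>
  define R where "R = sqrt (1 / c\<^sub>1)"
  define s\<^sub>0 where "s\<^sub>0 = 2 * C\<^sub>3 * R\<^sup>2 / c\<^sub>1"
  define C where "C = real CARD('k) * (s\<^sub>0 + C\<^sub>4 * R\<^sup>2 + C\<^sub>5 * R\<^sup>2)"
  have R: "0 \<le> R" and s0: "0 \<le> s\<^sub>0" using c1(1) C3(1) by (simp_all add: R_def s\<^sub>0_def)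
  have C: "0 \<le> C" using s0 C4(1) C5(1) by (simp add: C_def)
  show False
  proof (rule no_strict_interior_minimum[where u=w and S="?T" and z\<^sub>0=z\<^sub>0 and r=r and b=b\<^sub>0 and c="1 / C\<^sub>2" and C=C])
    show "smooth_on ?T w" "cball z\<^sub>0 r \<subseteq> ?T" "0 < r" "norm b\<^sub>0 = 1" "0 < 1 / C\<^sub>2" "0 \<le> C"
      using w r b0 C2_pos C by auto
    show "w z\<^sub>0 < w y" if "y \<in> cball z\<^sub>0 r" "y \<noteq> z\<^sub>0" for y
      using strict that by (simp add: K_def)
    fix z M
    assume "z \<in> ball z\<^sub>0 r" and M: "0 \<le> M" "\<And>v. \<bar>frechet_derivative w (at z) v\<bar> \<le> M * norm v"
    then have z: "z \<in> K" "z \<in> ?T" "z \<in> chart_img d" using K by (auto simp: K_def)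
    define p where "p = param d z"
    have p: "d \<in> charts_at B p" "coord d p = z" using patchD(1,2)[OF dc z(2)] by (simp_all add: p_def)
    define Du where "Du = frechet_derivative u (at z)"
    define Db where "Db = frechet_derivative b (at z)"
    have Du: "\<bar>Du v\<bar> \<le> M * norm v" for v
      using M(2)[of v] \<sigma> unfolding dw(1)[OF z(2)] Du_def abs_mult by simp
    obtain e s :: "'k \<Rightarrow> real^'k" and V where
      orth: "\<And>i j. ?m z (e i) (e j) = (if i = j then 1 else 0)"
      and s: "\<And>k v. ?m z (s k) v = m.dm z (e k) (e k) v - m.dm z v (e k) (e k) / 2"
      and V: "\<And>k. V k \<in> tangent_space A (snd (\<psi> p))"
      and tr: "- fst (mean_curvature_vector B AM G \<psi> p (chosen p)) = (\<Sum>k\<in>UNIV.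
        frechet_derivative (\<lambda>y. frechet_derivative u (at y) (e k)) (at z) (e k) - Du (s k)
        + (Db (e k) * Du (e k) - \<beta>t z * (Du (e k))\<^sup>2 / 2
           + deriv (\<lambda>r. g r (snd (\<psi> p)) (V k) (V k)) (fst (\<psi> p)) / 2) / b z)"
      using mean_curvature_time_component[OF p(1) frames[of p]]
      unfolding p(2) m.dm_def Du_def Db_def u_def b_def \<beta>t_def o_apply p_def[symmetric] by blast
    have e: "norm (e k) \<le> R" for k
    proof -
      have "c\<^sub>1 * (norm (e k))\<^sup>2 \<le> 1" using c1(2)[OF z(1), of "e k"] orth[of k k] by simp
      then have "(norm (e k))\<^sup>2 \<le> 1 / c\<^sub>1" using c1(1) by (simp add: pos_le_divide_eq mult.commute)
      then show ?thesis unfolding R_def by (rule real_le_rsqrt)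
    qed
    have s_le: "norm (s k) \<le> s\<^sub>0" for k
    proof -
      have ee: "norm (e k) * norm (e k) \<le> R\<^sup>2" using mult_mono[OF e e] R by (simp add: power2_eq_square)
      have "c\<^sub>1 * (norm (s k))\<^sup>2 \<le> m.dm z (e k) (e k) (s k) - m.dm z (s k) (e k) (e k) / 2"
        using c1(2)[OF z(1), of "s k"] s[of k "s k"] by simp
      also have "\<dots> \<le> \<bar>m.dm z (e k) (e k) (s k)\<bar> + \<bar>m.dm z (s k) (e k) (e k)\<bar>" by linarith
      also have "\<dots> \<le> 2 * (C\<^sub>3 * norm (s k) * (norm (e k) * norm (e k)))"
        using C3(2)[OF z(1), of "e k" "e k" "s k"] C3(2)[OF z(1), of "s k" "e k" "e k"] by (simp add: mult_ac)
      also have "\<dots> \<le> 2 * (C\<^sub>3 * norm (s k) * R\<^sup>2)"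
        using ee C3(1) by (intro mult_left_mono) auto
      finally have "norm (s k) * (c\<^sub>1 * norm (s k)) \<le> norm (s k) * (2 * C\<^sub>3 * R\<^sup>2)"
        by (simp add: power2_eq_square mult_ac)
      then have "s k \<noteq> 0 \<Longrightarrow> c\<^sub>1 * norm (s k) \<le> 2 * C\<^sub>3 * R\<^sup>2" by (simp add: mult_le_cancel_left)
      then show ?thesis
        using c1(1) s0 by (cases "s k = 0") (simp_all add: s\<^sub>0_def pos_le_divide_eq mult.commute)
    qed
    have bz: "0 < b z" by (rule b_pos)
    have bound_k: "\<sigma> * frechet_derivative (\<lambda>y. frechet_derivative u (at y) (e k)) (at z) (e k)
        - \<sigma> * (frechet_derivative (\<lambda>y. frechet_derivative u (at y) (e k)) (at z) (e k) - Du (s k)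
        + (Db (e k) * Du (e k) - \<beta>t z * (Du (e k))\<^sup>2 / 2
           + deriv (\<lambda>r. g r (snd (\<psi> p)) (V k) (V k)) (fst (\<psi> p)) / 2) / b z)
      \<le> (s\<^sub>0 + C\<^sub>4 * R\<^sup>2 + C\<^sub>5 * R\<^sup>2) * (M + M\<^sup>2)" for k
    proof -
      define G' where "G' = deriv (\<lambda>r. g r (snd (\<psi> p)) (V k) (V k)) (fst (\<psi> p))"
      have "0 \<le> \<sigma> * G'" unfolding G'_def by (rule g[OF \<psi>_in V])
      then have G': "0 \<le> \<sigma> * (G' / 2 / b z)" using bz by (simp add: zero_le_divide_iff mult.assoc[symmetric])
      have De: "\<bar>Du (e k)\<bar> \<le> M * R"
        using Du[of "e k"] mult_left_mono[OF e[of k] M(1)] by linarith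
      have 1: "\<bar>\<sigma> * Du (s k)\<bar> \<le> s\<^sub>0 * M"
        using Du[of "s k"] mult_left_mono[OF s_le[of k] M(1)] \<sigma> by (simp add: abs_mult mult.commute)
      have "\<bar>Db (e k) / b z\<bar> \<le> C\<^sub>4 * R"
        using C4(2)[OF z(1), of "e k"] mult_left_mono[OF e[of k] C4(1)] unfolding Db_def by linarith
      then have "\<bar>Db (e k) / b z\<bar> * \<bar>Du (e k)\<bar> \<le> (C\<^sub>4 * R) * (M * R)"
        using De C4(1) R by (intro mult_mono) auto
      then have 2: "\<bar>\<sigma> * (Db (e k) / b z * Du (e k))\<bar> \<le> C\<^sub>4 * R\<^sup>2 * M"
        using \<sigma> by (simp add: abs_mult power2_eq_square mult_ac)
      have "\<bar>\<beta>t z / (2 * b z)\<bar> * (Du (e k))\<^sup>2 \<le> C\<^sub>5 * (M * R)\<^sup>2"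
        using C5 z(1) De M(1) R abs_le_square_iff[of "Du (e k)" "M * R"] by (intro mult_mono) auto
      then have 3: "\<bar>\<sigma> * (\<beta>t z / (2 * b z) * (Du (e k))\<^sup>2)\<bar> \<le> C\<^sub>5 * R\<^sup>2 * M\<^sup>2"
        using \<sigma> by (simp add: abs_mult power_mult_distrib mult_ac)
      have 4: "s\<^sub>0 * M + C\<^sub>4 * R\<^sup>2 * M + C\<^sub>5 * R\<^sup>2 * M\<^sup>2 \<le> (s\<^sub>0 + C\<^sub>4 * R\<^sup>2 + C\<^sub>5 * R\<^sup>2) * (M + M\<^sup>2)"
      proof -
        have "0 \<le> s\<^sub>0 * M\<^sup>2" "0 \<le> C\<^sub>4 * R\<^sup>2 * M\<^sup>2" "0 \<le> C\<^sub>5 * R\<^sup>2 * M"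
          using s0 C4(1) C5(1) M(1) by simp_all
        then show ?thesis by (simp add: algebra_simps)
      qed
      have "\<sigma> * frechet_derivative (\<lambda>y. frechet_derivative u (at y) (e k)) (at z) (e k)
        - \<sigma> * (frechet_derivative (\<lambda>y. frechet_derivative u (at y) (e k)) (at z) (e k) - Du (s k)
        + (Db (e k) * Du (e k) - \<beta>t z * (Du (e k))\<^sup>2 / 2 + G' / 2) / b z) =
        \<sigma> * Du (s k) - \<sigma> * (Db (e k) / b z * Du (e k)) + \<sigma> * (\<beta>t z / (2 * b z) * (Du (e k))\<^sup>2) - \<sigma> * (G' / 2 / b z)"
        by (simp add: algebra_simps add_divide_distrib diff_divide_distrib)
      then show ?thesis unfolding G'_def[symmetric] using 1 2 3 4 G' by linarith
    qed
    have "(\<Sum>k\<in>UNIV. frechet_derivative (\<lambda>y. frechet_derivative w (at y) (e k)) (at z) (e k)) \<le> C * (M + M\<^sup>2)"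
    proof -
      have "(\<Sum>k\<in>UNIV. frechet_derivative (\<lambda>y. frechet_derivative w (at y) (e k)) (at z) (e k)) \<le>
        (\<Sum>k\<in>UNIV. \<sigma> * frechet_derivative (\<lambda>y. frechet_derivative u (at y) (e k)) (at z) (e k))
          - \<sigma> * (- fst (mean_curvature_vector B AM G \<psi> p (chosen p)))"
        using H[of p] by (simp add: dw(2)[OF z(2)])
      also have "\<dots> \<le> (\<Sum>k\<in>(UNIV :: 'k set). (s\<^sub>0 + C\<^sub>4 * R\<^sup>2 + C\<^sub>5 * R\<^sup>2) * (M + M\<^sup>2))"
        unfolding tr sum_distrib_left sum_subtractf[symmetric] by (rule sum_mono) (rule bound_k)
      also have "\<dots> = C * (M + M\<^sup>2)" by (simp add: C_def)
      finally show ?thesis .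
    qed
    moreover have "1 / C\<^sub>2 \<le> (\<Sum>k\<in>UNIV. (b\<^sub>0 \<bullet> e k)\<^sup>2)"
    proof -
      have "1 \<le> ?m z b\<^sub>0 b\<^sub>0 * (\<Sum>k\<in>UNIV. (b\<^sub>0 \<bullet> e k)\<^sup>2)"
        using orthonormal_frame_transverse[OF m.bilin[OF z(3)] orth, of b\<^sub>0] b0 by simp
      also have "\<dots> \<le> C\<^sub>2 * (\<Sum>k\<in>UNIV. (b\<^sub>0 \<bullet> e k)\<^sup>2)"
        using C2[OF z(1)] by (intro mult_right_mono) (auto intro: sum_nonneg)
      finally show ?thesis using C2_pos by (simp add: pos_divide_le_eq mult.commute)
    qed
    ultimately show "\<exists>e :: 'k \<Rightarrow> real^'k. 1 / C\<^sub>2 \<le> (\<Sum>k\<in>UNIV. (b\<^sub>0 \<bullet> e k)\<^sup>2) \<and>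
        (\<Sum>k\<in>UNIV. frechet_derivative (\<lambda>y. frechet_derivative w (at y) (e k)) (at z) (e k)) \<le> C * (M + M\<^sup>2)"
      by blast
  qed
qed

lemma
  fixes v :: "(real \<times> 'f, real \<times> 'e) tangent"
  shows future_pointing_time_component:
      "future_pointing G (coordinate_time_field I A) (\<psi> q) v \<Longrightarrow> 0 \<le> fst (v (chosen q))"
    and past_pointing_time_component:
      "past_pointing G (coordinate_time_field I A) (\<psi> q) v \<Longrightarrow> fst (v (chosen q)) \<le> 0"
proof -
  have "0 < \<beta> (\<psi> q)" using \<beta>_pos[OF \<psi>_in[of q], of "snd (\<psi> q)"] by simp
  then show "0 \<le> fst (v (chosen q))" if "future_pointing G (coordinate_time_field I A) (\<psi> q) v"
    using that
    by (cases "v = zero_tangent")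
       (simp_all add: zero_tangent_def future_pointing_def metric_coordinate_time_field zero_less_mult_iff)
  show "fst (v (chosen q)) \<le> 0" if "past_pointing G (coordinate_time_field I A) (\<psi> q) v"
    using that \<open>0 < \<beta> (\<psi> q)\<close>
    by (cases "v = zero_tangent")
       (simp_all add: zero_tangent_def past_pointing_def metric_coordinate_time_field mult_less_0_iff)
qed

end

theorem theorem6p2:
  fixes I :: "real set"
    and AF :: "('f::{t2_space, second_countable_topology}, real^3) chart set"
    and \<beta> :: "real \<times> 'f \<Rightarrow> real"
    and g :: "real \<Rightarrow> ('f, real^3) metric"
    and AS :: "('s::{t2_space, second_countable_topology}, real^2) chart set"
    and \<psi> :: "'s \<Rightarrow> real \<times> 'f"
  defines "AM \<equiv> split_atlas I AF"
    and "G \<equiv> split_metric I AF \<beta> g"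
    and "\<tau> \<equiv> fst \<circ> \<psi>"
  defines "H \<equiv> mean_curvature_vector AS AM G \<psi>"
    and "future \<equiv> future_pointing G (coordinate_time_field I AF)"
    and "past \<equiv> past_pointing G (coordinate_time_field I AF)"
  assumes spacetime: "orthogonally_splitted_spacetime I AF \<beta> g"
    and surface: "smooth_manifold (UNIV :: 's set) AS" "connected (UNIV :: 's set)"
    and immersed: "spacelike_immersion (UNIV :: 's set) AS (I \<times> UNIV) AM G \<psi>"
  shows "(non_contracting I AF \<beta> g \<and>
            (trapped UNIV \<psi> G future H \<or> nearly_trapped UNIV \<psi> G future H \<or>
             weakly_trapped UNIV \<psi> G future H \<or> marginally_trapped UNIV \<psi> G future H)
          \<longrightarrow> \<not> (\<exists>q. strict_local_min \<tau> q)) \<and>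
         (non_expanding I AF \<beta> g \<and>
            (trapped UNIV \<psi> G past H \<or> nearly_trapped UNIV \<psi> G past H \<or>
             weakly_trapped UNIV \<psi> G past H \<or> marginally_trapped UNIV \<psi> G past H)
          \<longrightarrow> \<not> (\<exists>q. strict_local_max \<tau> q))"
proof -
  interpret spacelike_submanifold I AF \<beta> g AS \<psi>
    by unfold_locales (use assms in simp_all)
  have frames: "\<exists>E. local_orthonormal_frame AS h q E" for q
    by (rule local_orthonormal_frame_exists[OF surface(1) h_riemannian])
  have "\<not> strict_local_min \<tau> q" if "non_contracting I AF \<beta> g" "\<And>q. future (\<psi> q) (H q)" for q
  proof -
    have "0 \<le> 1 * fst (H q (chosen q))" for q
      using future_pointing_time_component that(2)[of q] unfolding future_def G_def by simp
    moreover have "0 \<le> 1 * deriv (\<lambda>r. g r x v v) t" if "t \<in> I" "v \<in> tangent_space AF x" for t x v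
      using \<open>non_contracting I AF \<beta> g\<close> that by (simp add: non_contracting_def)
    ultimately have "\<not> strict_local_min (\<lambda>x. 1 * fst (\<psi> x)) q"
      by (intro no_strict_local_extremum frames) (simp_all add: H_def AM_def G_def)
    then show ?thesis by (simp add: \<tau>_def comp_def)
  qed
  moreover have "\<not> strict_local_max \<tau> q" if "non_expanding I AF \<beta> g" "\<And>q. past (\<psi> q) (H q)" for q
  proof -
    have "0 \<le> - 1 * fst (H q (chosen q))" for q
      using past_pointing_time_component that(2)[of q] unfolding past_def G_def by simp
    moreover have "0 \<le> - 1 * deriv (\<lambda>r. g r x v v) t" if "t \<in> I" "v \<in> tangent_space AF x" for t x v
      using \<open>non_expanding I AF \<beta> g\<close> that by (simp add: non_expanding_def)
    ultimately have "\<not> strict_local_min (\<lambda>x. - 1 * fst (\<psi> x)) q"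
      by (intro no_strict_local_extremum frames) (simp_all add: H_def AM_def G_def)
    then show ?thesis by (simp add: \<tau>_def strict_local_min_def strict_local_max_def)
  qed
  ultimately show ?thesis
    unfolding trapped_def nearly_trapped_def weakly_trapped_def marginally_trapped_def by blast
qed

end
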